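(* Let $M$ be a Riemannian manifold of dimension $n\geqslant 2$ and let $\mathbf F$ be the force field of a Newtonian dynamical system on $M$. The system satisfies the weak normality condition if and only if, at all points $q=(p,\mathbf v)$ of the tangent bundle $TM$ with $\mathbf v\neq 0$, the force field satisfies for all $k=1,\ldots,n$ the equations $$\sum^n_{i=1}\Bigl(v^{-1}F_i+\sum^n_{j=1}\tilde\nabla_i\bigl(N^jF_j\bigr)\Bigr)P^i_k=0,$$ $$\sum^n_{i=1}\sum^n_{j=1}\bigl(\nabla_iF_j+\nabla_jF_i-2v^{-2}F_iF_j\bigr)N^jP^i_k+\sum^n_{i=1}\sum^n_{j=1}\Bigl(\frac{F^j\,\tilde\nabla_jF_i}{v}-\sum^n_{r=1}\frac{N^rN^j\,\tilde\nabla_jF_r}{v}\,F_i\Bigr)P^i_k=0.$$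
   Context: $M$ is a smooth Riemannian manifold with metric $\mathbf g$, scalar product $(\cdot\,|\,\cdot)$ and Levi-Civita connection with components $\Gamma^k_{ij}$. Indices are raised and lowered with $g$. In a local chart $x^1,\ldots,x^n$ of $M$ the tangent bundle $TM$ has coordinates $(x^1,\ldots,x^n,v^1,\ldots,v^n)$. Newtonian dynamical system. A force field is a smooth extended vector field $\mathbf F$: to each $q=(p,\mathbf v)\in TM$ it assigns $\mathbf F(p,\mathbf v)\in T_pM$. The Newtonian dynamical system with force field $\mathbf F$ is $\dot x^k=v^k$, $\nabla_tv^k=F^k(x,v)$, where $\nabla_tv^k=\dot v^k+\sum_{i,j}\Gamma^k_{ij}v^iv^j$. Its trajectories are the curves $p(t)$ in $M$ with velocity $\mathbf v(t)=\dot p(t)$ solving these equations; $\nabla_t$ denotes covariant differentiation along the trajectory. Gradients of extended fields. For an extended vector field with components $X^k(x,v)$: spatial gradient $\nabla_iX^k=\frac{\partial X^k}{\partial x^i}-\sum_{a,b}v^a\Gamma^b_{ia}\frac{\partial X^k}{\partial v^b}+\sum_a\Gamma^k_{ia}X^a$ and velocity gradient $\tilde\nabla_iX^k=\frac{\partial X^k}{\partial v^i}$. The same formulas apply to components with other index types, with the usual connection terms in $\nabla_i$ (for lower index: $-\sum_a\Gamma^a_{ik}X_a$; for scalars: no such term). Notation at points with $\mathbf v\ne0$: $v=|\mathbf v|$, $N^i=v^i/v$, $N_i=\sum_jg_{ij}N^j$, $P^i_j=\delta^i_j-N^iN_j$ (orthogonal projector onto the hyperplane perpendicular to $\mathbf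 v$), $F_i=\sum_jg_{ij}F^j$. Vector of variation: on a trajectory, a vector function $\boldsymbol\tau(t)$ along it solving the linearized equations $$\nabla_{tt}\tau^k=-\sum_{m,i,j}R^k_{mij}\tau^iv^jv^m+\sum_m\nabla_t\tau^m\,\tilde\nabla_mF^k+\sum_m\tau^m\nabla_mF^k,$$ where $\nabla_{tt}=\nabla_t\nabla_t$ and $R$ is the curvature tensor, $\sum R^k_{mij}X^iY^jZ^m=(R(X,Y)Z)^k$ with $R(X,Y)=[\nabla_X,\nabla_Y]-\nabla_{[X,Y]}$. Such $\boldsymbol\tau$ arise as derivatives $\partial x^k/\partial u$ of one-parameter families of trajectories. The function of deviation is $\varphi(t)=(\mathbf v\,|\,\boldsymbol\tau)$. Weak normality condition: for each trajectory of the system there is an ordinary differential equation $\ddot\varphi=\mathcal A(t)\dot\varphi+\mathcal B(t)\varphi$ such that every function of deviation $\varphi(t)$ on that trajectory, for any choice of vector of variation $\boldsymbol\tau$, is a solution of it. *)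

theory Defs
  imports "HOL-Analysis.Analysis"
begin

section \<open>Smooth maps between Euclidean spaces\<close>

primrec C_on :: "nat \<Rightarrow> 'a::euclidean_space set \<Rightarrow> ('a \<Rightarrow> 'b::euclidean_space) \<Rightarrow> bool" where
  "C_on 0 S f \<longleftrightarrow> continuous_on S f"
| "C_on (Suc k) S f \<longleftrightarrow> (\<forall>x\<in>S. f differentiable (at x)) \<and>
     (\<forall>u. C_on k S (\<lambda>x. frechet_derivative f (at x) u))"

text \<open>Meant for open \<open>S\<close> only, since the derivatives are unrestricted.\<close>

definition smooth_on :: "'a::euclidean_space set \<Rightarrow> ('a \<Rightarrow> 'b::euclidean_space) \<Rightarrow> bool" where
  "smooth_on S f \<longleftrightarrow> (\<forall>k. C_on k S f)"


section \<open>Smooth manifolds\<close>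

text \<open>
  A chart is a pair of its domain and its coordinate map. The manifold is the topological space
  \<open>M\<close> with a smooth atlas \<open>A\<close>, not necessarily maximal. Its dimension is \<open>CARD('n)\<close>.
\<close>

type_synonym ('a, 'n) chart = "'a set \<times> ('a \<Rightarrow> real ^ 'n)"

abbreviation chart_dom :: "('a, 'n::finite) chart \<Rightarrow> 'a set" where
  "chart_dom c \<equiv> fst c"

abbreviation chart_map :: "('a, 'n::finite) chart \<Rightarrow> 'a \<Rightarrow> real ^ 'n" where
  "chart_map c \<equiv> snd c"

definition chart_image :: "('a, 'n::finite) chart \<Rightarrow> (real ^ 'n) set" where
  "chart_image c = chart_map c ` chart_dom c"

definition is_chart :: "'a topology \<Rightarrow> ('a, 'n::finite) chart \<Rightarrow> bool" where
  "is_chart M c \<longleftrightarrow> openin M (chart_dom c) \<and> open (chart_image c) \<and>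
     homeomorphic_map (subtopology M (chart_dom c)) (top_of_set (chart_image c)) (chart_map c)"

definition transition :: "('a, 'n::finite) chart \<Rightarrow> ('a, 'n) chart \<Rightarrow> real ^ 'n \<Rightarrow> real ^ 'n" where
  "transition c d = chart_map d \<circ> inv_into (chart_dom c) (chart_map c)"

definition overlap :: "('a, 'n::finite) chart \<Rightarrow> ('a, 'n) chart \<Rightarrow> (real ^ 'n) set" where
  "overlap c d = chart_map c ` (chart_dom c \<inter> chart_dom d)"

text \<open>\<open>jacobian c d x u\<close> are the components in \<open>d\<close> of the tangent vector which has components
  \<open>u\<close> in \<open>c\<close>, at the point with coordinates \<open>x\<close> in \<open>c\<close>.\<close>

definition jacobian ::
    "('a, 'n::finite) chart \<Rightarrow> ('a, 'n) chart \<Rightarrow> real ^ 'n \<Rightarrow> real ^ 'n \<Rightarrow> real ^ 'n" where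
  "jacobian c d x = frechet_derivative (transition c d) (at x)"

definition smooth_manifold :: "'a topology \<Rightarrow> ('a, 'n::finite) chart set \<Rightarrow> bool" where
  "smooth_manifold M A \<longleftrightarrow>
     Hausdorff_space M \<and> second_countable M \<and>
     (\<forall>c\<in>A. is_chart M c) \<and> (\<Union>c\<in>A. chart_dom c) = topspace M \<and>
     (\<forall>c\<in>A. \<forall>d\<in>A. smooth_on (overlap c d) (transition c d))"


section \<open>Riemannian metrics and force fields\<close>

text \<open>
  Tensor fields are given by their components in the charts of the atlas, subject to the
  transformation law: \<open>g c x\<close> is the Gram matrix of the metric, and \<open>F c x v\<close> are the components of
  the force at the point of \<open>TM\<close> with coordinates \<open>(x, v)\<close>.
\<close>

type_synonym 'n local_metric = "real ^ 'n \<Rightarrow> real ^ 'n ^ 'n"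
type_synonym 'n ext_field = "real ^ 'n \<Rightarrow> real ^ 'n \<Rightarrow> real ^ 'n"
type_synonym 'n ext_scalar = "real ^ 'n \<Rightarrow> real ^ 'n \<Rightarrow> real"

definition scal :: "'n::finite local_metric \<Rightarrow> real ^ 'n \<Rightarrow> real ^ 'n \<Rightarrow> real ^ 'n \<Rightarrow> real" where
  "scal h x u w = (\<Sum>i\<in>UNIV. \<Sum>j\<in>UNIV. h x $ i $ j * u $ i * w $ j)"

definition riemannian_manifold ::
    "'a topology \<Rightarrow> ('a, 'n::finite) chart set \<Rightarrow> (('a, 'n) chart \<Rightarrow> 'n local_metric) \<Rightarrow> bool" where
  "riemannian_manifold M A g \<longleftrightarrow> smooth_manifold M A \<and>
     (\<forall>c\<in>A. smooth_on (chart_image c) (g c) \<and>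
        (\<forall>x\<in>chart_image c. (\<forall>u w. scal (g c) x u w = scal (g c) x w u) \<and>
           (\<forall>u. u \<noteq> 0 \<longrightarrow> scal (g c) x u u > 0))) \<and>
     (\<forall>c\<in>A. \<forall>d\<in>A. \<forall>x\<in>overlap c d. \<forall>u w.
        scal (g c) x u w =
        scal (g d) (transition c d x) (jacobian c d x u) (jacobian c d x w))"

definition force_field ::
    "('a, 'n::finite) chart set \<Rightarrow> (('a, 'n) chart \<Rightarrow> 'n ext_field) \<Rightarrow> bool" where
  "force_field A F \<longleftrightarrow>
     (\<forall>c\<in>A. smooth_on (chart_image c \<times> UNIV) (\<lambda>(x, v). F c x v)) \<and>
     (\<forall>c\<in>A. \<forall>d\<in>A. \<forall>x\<in>overlap c d. \<forall>v.
        F d (transition c d x) (jacobian c d x v) = jacobian c d x (F c x v))"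


section \<open>Connection, curvature and gradients in a chart\<close>

definition partial :: "'n::finite \<Rightarrow> (real ^ 'n \<Rightarrow> real) \<Rightarrow> real ^ 'n \<Rightarrow> real" where
  "partial i f x = frechet_derivative f (at x) (axis i 1)"

text \<open>\<open>christoffel h k i j\<close> is $\Gamma^k_{ij}$.\<close>

definition christoffel :: "'n::finite local_metric \<Rightarrow> 'n \<Rightarrow> 'n \<Rightarrow> 'n \<Rightarrow> real ^ 'n \<Rightarrow> real" where
  "christoffel h k i j x = (\<Sum>l\<in>UNIV. matrix_inv (h x) $ k $ l *
     (partial i (\<lambda>y. h y $ l $ j) x + partial j (\<lambda>y. h y $ l $ i) x
        - partial l (\<lambda>y. h y $ i $ j) x)) / 2"

text \<open>\<open>curvature h k m i j\<close> is $R^k_{mij}$, the \<open>k\<close>-th component of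
  $(\nabla_i \nabla_j - \nabla_j \nabla_i)\,\partial/\partial x^m$.\<close>

definition curvature :: "'n::finite local_metric \<Rightarrow> 'n \<Rightarrow> 'n \<Rightarrow> 'n \<Rightarrow> 'n \<Rightarrow> real ^ 'n \<Rightarrow> real" where
  "curvature h k m i j x =
     partial i (christoffel h k j m) x - partial j (christoffel h k i m) x
     + (\<Sum>a\<in>UNIV. christoffel h k i a x * christoffel h a j m x)
     - (\<Sum>a\<in>UNIV. christoffel h k j a x * christoffel h a i m x)"

definition vel_grad :: "'n::finite \<Rightarrow> 'n ext_scalar \<Rightarrow> 'n ext_scalar" where
  "vel_grad i f x v = partial i (f x) v"

text \<open>The part of $\nabla_i$ which does not depend on the type of the field.\<close>

definition spat_deriv :: "'n::finite local_metric \<Rightarrow> 'n \<Rightarrow> 'n ext_scalar \<Rightarrow> 'n ext_scalar" where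
  "spat_deriv h i f x v = partial i (\<lambda>y. f y v) x
     - (\<Sum>a\<in>UNIV. \<Sum>b\<in>UNIV. v $ a * christoffel h b i a x * vel_grad b f x v)"

definition spat_grad_vec :: "'n::finite local_metric \<Rightarrow> 'n \<Rightarrow> 'n ext_field \<Rightarrow> 'n \<Rightarrow> 'n ext_scalar" where
  "spat_grad_vec h i X k x v = spat_deriv h i (\<lambda>y w. X y w $ k) x v
     + (\<Sum>a\<in>UNIV. christoffel h k i a x * X x v $ a)"

definition spat_grad_covec :: "'n::finite local_metric \<Rightarrow> 'n \<Rightarrow> 'n ext_field \<Rightarrow> 'n \<Rightarrow> 'n ext_scalar" where
  "spat_grad_covec h i X k x v = spat_deriv h i (\<lambda>y w. X y w $ k) x v
     - (\<Sum>a\<in>UNIV. christoffel h a i k x * X x v $ a)"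

definition lower :: "'n::finite local_metric \<Rightarrow> 'n ext_field \<Rightarrow> 'n ext_field" where
  "lower h X x v = (\<chi> i. \<Sum>j\<in>UNIV. h x $ i $ j * X x v $ j)"

definition speed :: "'n::finite local_metric \<Rightarrow> 'n ext_scalar" where
  "speed h x v = sqrt (scal h x v v)"

definition unit_dir :: "'n::finite local_metric \<Rightarrow> 'n ext_field" where
  "unit_dir h x v = (\<chi> i. v $ i / speed h x v)"

text \<open>\<open>projector h i j\<close> is $P^i_j$.\<close>

definition projector :: "'n::finite local_metric \<Rightarrow> 'n \<Rightarrow> 'n \<Rightarrow> 'n ext_scalar" where
  "projector h i j x v =
     (if i = j then 1 else 0) - unit_dir h x v $ i * lower h (unit_dir h) x v $ j"


section \<open>Trajectories, vectors of variation, weak normality\<close>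

definition velocity :: "('a, 'n::finite) chart \<Rightarrow> (real \<Rightarrow> 'a) \<Rightarrow> real \<Rightarrow> real ^ 'n" where
  "velocity c p t = vector_derivative (chart_map c \<circ> p) (at t)"

text \<open>$\nabla_t w$ for a vector function along \<open>p\<close> with components \<open>w\<close> in the chart \<open>c\<close>.\<close>

definition cov_deriv ::
    "'n::finite local_metric \<Rightarrow> ('a, 'n) chart \<Rightarrow> (real \<Rightarrow> 'a) \<Rightarrow> (real \<Rightarrow> real ^ 'n) \<Rightarrow> real \<Rightarrow> real ^ 'n" where
  "cov_deriv h c p w t = (\<chi> k. vector_derivative w (at t) $ k
     + (\<Sum>i\<in>UNIV. \<Sum>j\<in>UNIV. christoffel h k i j (chart_map c (p t)) * velocity c p t $ i * w t $ j))"

definition trajectory ::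
    "'a topology \<Rightarrow> ('a, 'n::finite) chart set \<Rightarrow> (('a, 'n) chart \<Rightarrow> 'n local_metric)
     \<Rightarrow> (('a, 'n) chart \<Rightarrow> 'n ext_field) \<Rightarrow> real set \<Rightarrow> (real \<Rightarrow> 'a) \<Rightarrow> bool" where
  "trajectory M A g F I p \<longleftrightarrow>
     open I \<and> is_interval I \<and> continuous_map (top_of_set I) M p \<and>
     (\<forall>c\<in>A. \<forall>t\<in>I. p t \<in> chart_dom c \<longrightarrow>
        (chart_map c \<circ> p) differentiable (at t) \<and>
        velocity c p differentiable (at t) \<and>
        cov_deriv (g c) c p (velocity c p) t = F c (chart_map c (p t)) (velocity c p t))"

text \<open>A vector function along \<open>p\<close> is given by its components \<open>\<tau> c t\<close>; only the values at those
  \<open>t\<close> with \<open>p t \<in> chart_dom c\<close> are meaningful.\<close>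

definition variation_vector ::
    "('a, 'n::finite) chart set \<Rightarrow> (('a, 'n) chart \<Rightarrow> 'n local_metric)
     \<Rightarrow> (('a, 'n) chart \<Rightarrow> 'n ext_field) \<Rightarrow> real set \<Rightarrow> (real \<Rightarrow> 'a)
     \<Rightarrow> (('a, 'n) chart \<Rightarrow> real \<Rightarrow> real ^ 'n) \<Rightarrow> bool" where
  "variation_vector A g F I p \<tau> \<longleftrightarrow>
     (\<forall>c\<in>A. \<forall>d\<in>A. \<forall>t\<in>I. p t \<in> chart_dom c \<inter> chart_dom d \<longrightarrow>
        \<tau> d t = jacobian c d (chart_map c (p t)) (\<tau> c t)) \<and>
     (\<forall>c\<in>A. \<forall>t\<in>I. p t \<in> chart_dom c \<longrightarrow>
        (let h = g c; x = chart_map c (p t); v = velocity c p t;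
             D\<tau> = cov_deriv h c p (\<tau> c)
         in \<tau> c differentiable (at t) \<and> D\<tau> differentiable (at t) \<and>
            (\<forall>k. cov_deriv h c p D\<tau> t $ k =
               - (\<Sum>m\<in>UNIV. \<Sum>i\<in>UNIV. \<Sum>j\<in>UNIV. curvature h k m i j x * \<tau> c t $ i * v $ j * v $ m)
               + (\<Sum>m\<in>UNIV. D\<tau> t $ m * vel_grad m (\<lambda>y w. F c y w $ k) x v)
               + (\<Sum>m\<in>UNIV. \<tau> c t $ m * spat_grad_vec h m (F c) k x v))))"

definition deviation_function ::
    "('a, 'n::finite) chart set \<Rightarrow> (('a, 'n) chart \<Rightarrow> 'n local_metric) \<Rightarrow> real set \<Rightarrow> (real \<Rightarrow> 'a)
     \<Rightarrow> (('a, 'n) chart \<Rightarrow> real \<Rightarrow> real ^ 'n) \<Rightarrow> (real \<Rightarrow> real) \<Rightarrow> bool" where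
  "deviation_function A g I p \<tau> \<phi> \<longleftrightarrow>
     (\<forall>c\<in>A. \<forall>t\<in>I. p t \<in> chart_dom c \<longrightarrow>
        \<phi> t = scal (g c) (chart_map c (p t)) (velocity c p t) (\<tau> c t))"

definition solves_linear_ode2 ::
    "real set \<Rightarrow> (real \<Rightarrow> real) \<Rightarrow> (real \<Rightarrow> real) \<Rightarrow> (real \<Rightarrow> real) \<Rightarrow> bool" where
  "solves_linear_ode2 I a b \<phi> \<longleftrightarrow>
     (\<forall>t\<in>I. \<phi> differentiable (at t) \<and>
        (deriv \<phi> has_real_derivative (a t * deriv \<phi> t + b t * \<phi> t)) (at t))"

definition weak_normality ::
    "'a topology \<Rightarrow> ('a, 'n::finite) chart set \<Rightarrow> (('a, 'n) chart \<Rightarrow> 'n local_metric)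
     \<Rightarrow> (('a, 'n) chart \<Rightarrow> 'n ext_field) \<Rightarrow> bool" where
  "weak_normality M A g F \<longleftrightarrow>
     (\<forall>I p. trajectory M A g F I p \<longrightarrow>
        (\<exists>a b. \<forall>\<tau> \<phi>. variation_vector A g F I p \<tau> \<and> deviation_function A g I p \<tau> \<phi> \<longrightarrow>
           solves_linear_ode2 I a b \<phi>))"

end

theory Submission
  imports Defs
begin

text \<open>
  Along a trajectory with a vector of variation \<open>\<tau>\<close>, put \<open>D = \<nabla>\<^sub>t \<tau>\<close>. Metric compatibility of the connection and
  \<open>(v | R(\<tau>,v)v) = 0\<close> turn the equation for \<open>\<tau>\<close> into

    \<open>\<phi>' = (F | \<tau>) + (v | D)\<close> and \<open>\<phi>'' = \<xi>(D) + \<eta>(\<tau>)\<close>,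

  where \<open>\<xi>(w) = 2 (F | w) + (v | \<partial>\<^sub>w F)\<close> and \<open>\<eta>(a) = (\<nabla>\<^sub>v F + \<partial>\<^sub>F F | a) + (v | \<nabla>\<^sub>a F)\<close> are linear forms that
  depend on \<open>(x, v)\<close> only, \<open>\<partial>\<close> denoting velocity derivatives (\<open>deviation_derivative\<close>,
  \<open>deviation_second_derivative\<close>). Weak normality is thus a question of linear algebra at each point of the
  tangent bundle, provided that \<open>(\<tau>, D)\<close> can be any pair of vectors \<open>(a, w)\<close>: the form \<open>\<xi>(w) + \<eta>(a)\<close> has to be
  a combination of \<open>(F | a) + (v | w)\<close> and \<open>(v | a)\<close>. For \<open>v \<noteq> 0\<close> this means, for all \<open>u\<close> orthogonal to \<open>v\<close>,

    \<open>\<xi>(u) = 0\<close> and \<open>|v|\<^sup>2 \<eta>(u) = (F | u) \<xi>(v)\<close>,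

  and these are the two systems of equations, contracted with \<open>u\<close> and multiplied by powers of \<open>|v|\<close>
  (\<open>normality_equations_iff_normal_at\<close>). A trajectory may also pass through \<open>v = 0\<close>. There the first
  equation, in the limit along rays, makes \<open>F\<close> orthogonal to every hyperplane, so that \<open>F = 0\<close> in dimension
  at least two; then \<open>\<phi>\<close>, \<open>\<phi>'\<close> and \<open>\<phi>''\<close> all vanish (\<open>force_vanishes_at_rest\<close>).

  Sufficiency of the equations needs nothing more, because the coefficients of the differential equation may be
  chosen separately at each time. Necessity needs a trajectory through each \<open>(x, v)\<close> with a vector of variation
  that has prescribed values \<open>\<tau>\<close>, \<open>D\<close> there, and in fact only one whose \<open>\<phi>\<close> and \<open>\<phi>'\<close> vanish at that point. It
  is found with Picard's theorem in one chart (\<open>local_solution_exists\<close>), applied to position, velocity, \<open>\<tau>\<close> and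
  \<open>\<tau>'\<close> at once. The defining conditions have to hold in all charts, however. In a chart the trajectories are the
  integral curves of the spray \<open>(x, v) \<mapsto> (v, F - \<Gamma>(v, v))\<close>, and the equation for \<open>\<tau>\<close> is its linearization:
  curvature and Christoffel symbols cancel (\<open>fd_spray_covariant\<close>). The sprays of two charts are related by the
  tangent map of the transition map (\<open>spray_transform\<close>), and differentiating this relation shows that their
  linearizations are related as well (\<open>spray_transform_linearized\<close>), which transports solutions between charts
  without transforming the curvature tensor.
\<close>

section \<open>Calculus of finitely often differentiable maps\<close>

abbreviation fd :: "('a::euclidean_space \<Rightarrow> 'b::euclidean_space) \<Rightarrow> 'a \<Rightarrow> 'a \<Rightarrow> 'b" where
  "fd f x u \<equiv> frechet_derivative f (at x) u"

lemma fd_eq: "(f has_derivative f') (at x) \<Longrightarrow> fd f x u = f' u"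
  using frechet_derivative_at by metis

lemma fd_has_derivative: "f differentiable (at x) \<Longrightarrow> (f has_derivative fd f x) (at x)"
  using frechet_derivative_works by blast

lemma fd_linear: "f differentiable (at x) \<Longrightarrow> linear (fd f x)"
  by (rule linear_frechet_derivative)

text \<open>Reduces directions that vary with the point to finitely many fixed ones.\<close>

lemma fd_sum_Basis:
  assumes "f differentiable (at x)"
  shows "fd f x u = (\<Sum>b\<in>Basis. (u \<bullet> b) *\<^sub>R fd f x b)"
proof -
  have "fd f x u = fd f x (\<Sum>b\<in>Basis. (u \<bullet> b) *\<^sub>R b)"
    by (simp add: euclidean_representation)
  also have "\<dots> = (\<Sum>b\<in>Basis. (u \<bullet> b) *\<^sub>R fd f x b)"
    by (simp only: linear_sum[OF fd_linear[OF assms]] linear_cmul[OF fd_linear[OF assms]])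
  finally show ?thesis .
qed

lemma C_on_cong:
  assumes "open S" "C_on k S f" "\<And>x. x \<in> S \<Longrightarrow> f x = g x"
  shows "C_on k S g"
  using assms(2,3)
proof (induction k arbitrary: f g)
  case 0
  then show ?case using continuous_on_cong[of S S f g] by simp
next
  case (Suc k)
  have df: "f differentiable (at x)" if "x \<in> S" for x
    using Suc.prems(1) that by simp
  have dg: "(g has_derivative fd f x) (at x)" if "x \<in> S" for x
    by (rule has_derivative_transform_within_open[OF fd_has_derivative[OF df[OF that]]
          \<open>open S\<close> that Suc.prems(2)])
  have "C_on k S (\<lambda>x. fd g x u)" for u
  proof (rule Suc.IH[of "\<lambda>x. fd f x u"])
    show "C_on k S (\<lambda>x. fd f x u)" using Suc.prems(1) by simp
    show "fd f x u = fd g x u" if "x \<in> S" for x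
      by (rule fd_eq[OF dg[OF that], symmetric])
  qed
  moreover have "g differentiable (at x)" if "x \<in> S" for x
    using dg[OF that] unfolding differentiable_def by blast
  ultimately show ?case by simp
qed

lemma C_on_continuous: "C_on k S f \<Longrightarrow> continuous_on S f"
proof (cases k)
  case (Suc j)
  assume "C_on k S f"
  then have "continuous (at x) f" if "x \<in> S" for x
    using that Suc differentiable_imp_continuous_within by fastforce
  then show ?thesis
    by (simp add: continuous_at_imp_continuous_on)
qed simp

lemma C_on_mono: "C_on (Suc k) S f \<Longrightarrow> C_on k S f"
proof (induction k arbitrary: f)
  case 0
  then show ?case using C_on_continuous by fastforce
next
  case (Suc k)
  have "C_on k S (\<lambda>x. fd f x u)" for u
    using Suc.IH Suc.prems C_on.simps(2) by metis
  then show ?case using Suc.prems by simp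
qed

lemma C_on_differentiable: "C_on (Suc k) S f \<Longrightarrow> x \<in> S \<Longrightarrow> f differentiable (at x)"
  by simp

lemma C_on_fd: "C_on (Suc k) S f \<Longrightarrow> C_on k S (\<lambda>x. fd f x u)"
  by simp

lemma C_on_subset: "C_on k S f \<Longrightarrow> T \<subseteq> S \<Longrightarrow> C_on k T f"
  by (induction k arbitrary: f) (auto intro: continuous_on_subset)

lemma C_on_const: "C_on k S (\<lambda>x. c)"
  by (induction k arbitrary: c) auto

text \<open>Any explicit formula for the derivative can be used, by uniqueness of derivatives.\<close>

lemma C_on_SucI:
  assumes "open S" "\<And>x. x \<in> S \<Longrightarrow> (f has_derivative f' x) (at x)" "\<And>u. C_on k S (\<lambda>x. f' x u)"
  shows "C_on (Suc k) S f"
proof -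
  have "C_on k S (\<lambda>x. fd f x u)" for u
    by (rule C_on_cong[OF \<open>open S\<close> assms(3)]) (rule fd_eq[OF assms(2), symmetric])
  moreover have "f differentiable (at x)" if "x \<in> S" for x
    using assms(2)[OF that] unfolding differentiable_def by blast
  ultimately show ?thesis by simp
qed

lemma C_on_linear:
  assumes "bounded_linear L" "C_on k S f" "open S"
  shows "C_on k S (\<lambda>x. L (f x))"
  using assms(2)
proof (induction k arbitrary: f)
  case 0
  then show ?case using bounded_linear.continuous_on[OF assms(1)] by simp
next
  case (Suc k)
  show ?case
  proof (rule C_on_SucI[OF \<open>open S\<close>])
    show "((\<lambda>x. L (f x)) has_derivative (\<lambda>u. L (fd f x u))) (at x)" if "x \<in> S" for x
      by (rule bounded_linear.has_derivative[OF assms(1) fd_has_derivative[OF C_on_differentiable[OF Suc.prems that]]])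
    show "C_on k S (\<lambda>x. L (fd f x u))" for u
      using Suc.IH Suc.prems by simp
  qed
qed

lemma C_on_add:
  assumes "C_on k S f" "C_on k S g" "open S"
  shows "C_on k S (\<lambda>x. f x + g x)"
  using assms(1,2)
proof (induction k arbitrary: f g)
  case 0
  then show ?case by (simp add: continuous_on_add)
next
  case (Suc k)
  show ?case
  proof (rule C_on_SucI[OF \<open>open S\<close>])
    show "((\<lambda>x. f x + g x) has_derivative (\<lambda>u. fd f x u + fd g x u)) (at x)" if "x \<in> S" for x
      by (intro has_derivative_add fd_has_derivative
          C_on_differentiable[OF Suc.prems(1) that] C_on_differentiable[OF Suc.prems(2) that])
    show "C_on k S (\<lambda>x. fd f x u + fd g x u)" for u
      using Suc.IH Suc.prems by simp
  qed
qed

lemma C_on_sum: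
  assumes "\<And>i. i \<in> I \<Longrightarrow> C_on k S (f i)" "open S"
  shows "C_on k S (\<lambda>x. \<Sum>i\<in>I. f i x)"
  using assms(1)
proof (induction I rule: infinite_finite_induct)
  case (insert i I)
  then have "C_on k S (f i)" "C_on k S (\<lambda>x. \<Sum>i\<in>I. f i x)" by simp_all
  from C_on_add[OF this \<open>open S\<close>] show ?case using insert by simp
qed (simp_all add: C_on_const)

text \<open>The product rule expresses the derivative by products of the same shape, so the order grows by induction.\<close>

lemma C_on_bilinear:
  assumes B: "bounded_bilinear B" and "C_on k S f" "C_on k S g" "open S"
  shows "C_on k S (\<lambda>x. B (f x) (g x))"
  using assms(2,3)
proof (induction k arbitrary: f g)
  case 0
  then show ?case using bounded_bilinear.continuous_on[OF B] by simp
next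
  case (Suc k)
  show ?case
  proof (rule C_on_SucI[OF \<open>open S\<close>])
    show "((\<lambda>x. B (f x) (g x)) has_derivative (\<lambda>u. B (f x) (fd g x u) + B (fd f x u) (g x))) (at x)"
      if "x \<in> S" for x
      by (intro bounded_bilinear.FDERIV[OF B] fd_has_derivative
          C_on_differentiable[OF Suc.prems(1) that] C_on_differentiable[OF Suc.prems(2) that])
    show "C_on k S (\<lambda>x. B (f x) (fd g x u) + B (fd f x u) (g x))" for u
      by (intro C_on_add[OF _ _ \<open>open S\<close>] Suc.IH C_on_fd Suc.prems C_on_mono[OF Suc.prems(1)]
          C_on_mono[OF Suc.prems(2)])
  qed
qed

lemmas C_on_mult = C_on_bilinear[OF bounded_bilinear_mult]
lemmas C_on_scaleR = C_on_bilinear[OF bounded_bilinear_scaleR]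

lemma C_on_diff:
  assumes "C_on k S f" "C_on k S g" "open S"
  shows "C_on k S (\<lambda>x. f x - g x)"
  using C_on_add[OF assms(1) C_on_linear[OF bounded_linear_minus[OF bounded_linear_ident] assms(2)]] assms(3)
  by simp

lemma C_on_prod:
  fixes f :: "'i \<Rightarrow> 'a::euclidean_space \<Rightarrow> real"
  assumes "\<And>i. i \<in> I \<Longrightarrow> C_on k S (f i)" "open S"
  shows "C_on k S (\<lambda>x. \<Prod>i\<in>I. f i x)"
  using assms(1)
proof (induction I rule: infinite_finite_induct)
  case (insert i I)
  then have "C_on k S (f i)" "C_on k S (\<lambda>x. \<Prod>i\<in>I. f i x)" by simp_all
  from C_on_mult[OF this \<open>open S\<close>] show ?case using insert by simp
qed (simp_all add: C_on_const)

lemma C_on_inverse: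
  fixes f :: "'a::euclidean_space \<Rightarrow> real"
  assumes "C_on k S f" "\<And>x. x \<in> S \<Longrightarrow> f x \<noteq> 0" "open S"
  shows "C_on k S (\<lambda>x. inverse (f x))"
  using assms(1)
proof (induction k)
  case 0
  then show ?case using assms by (auto intro: continuous_on_inverse)
next
  case (Suc k)
  show ?case
  proof (rule C_on_SucI[OF \<open>open S\<close>])
    show "((\<lambda>x. inverse (f x)) has_derivative (\<lambda>u. (inverse (f x) * inverse (f x)) * (- fd f x u))) (at x)"
      if "x \<in> S" for x
      using Deriv.has_derivative_inverse[OF assms(2)[OF that]
          fd_has_derivative[OF C_on_differentiable[OF Suc.prems that]]]
      by (simp add: mult_ac)
    have "C_on k S (\<lambda>x. inverse (f x))" using Suc.IH C_on_mono[OF Suc.prems] by simp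
    moreover have "C_on k S (\<lambda>x. - fd f x u)" for u
      by (rule C_on_linear[OF bounded_linear_minus[OF bounded_linear_ident] C_on_fd[OF Suc.prems] \<open>open S\<close>])
    ultimately show "C_on k S (\<lambda>x. (inverse (f x) * inverse (f x)) * (- fd f x u))" for u
      by (intro C_on_mult[OF _ _ \<open>open S\<close>])
  qed
qed

lemma C_on_vec:
  fixes f :: "'a::euclidean_space \<Rightarrow> 'b::euclidean_space ^ 'n"
  assumes "\<And>i. C_on k S (\<lambda>x. f x $ i)" "open S"
  shows "C_on k S f"
proof -
  have f: "f = (\<lambda>x. \<Sum>i\<in>UNIV. axis i (f x $ i))"
    by (auto simp: vec_eq_iff axis_def if_distrib cong: if_cong)
  show ?thesis
  proof (subst f, rule C_on_sum[OF _ assms(2)])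
    fix i :: 'n
    show "C_on k S (\<lambda>x. axis i (f x $ i))"
    by (rule C_on_linear[OF _ assms(1) assms(2), of "axis i"])
       (auto intro!: linear_conv_bounded_linear[THEN iffD1] linearI simp: vec_eq_iff axis_def)
  qed
qed

lemma C_on_nth:
  fixes f :: "'a::euclidean_space \<Rightarrow> 'b::euclidean_space ^ 'n"
  assumes "C_on k S f" "open S"
  shows "C_on k S (\<lambda>x. f x $ i)"
  by (rule C_on_linear[OF bounded_linear_vec_nth assms])

lemma C_on_Pair:
  assumes "C_on k S f" "C_on k S g" "open S"
  shows "C_on k S (\<lambda>x. (f x, g x))"
proof -
  have "C_on k S (\<lambda>x. (f x, 0) + (0, g x))"
    by (intro C_on_add C_on_linear[where L="\<lambda>a. (a, 0)"] C_on_linear[where L="\<lambda>a. (0, a)"] assms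
        bounded_linear_Pair bounded_linear_ident bounded_linear_zero)
  then show ?thesis by simp
qed

lemma C_on_bounded_linear:
  assumes "bounded_linear L" "open S"
  shows "C_on k S L"
proof (cases k)
  case 0
  then show ?thesis using linear_continuous_on[OF assms(1)] by simp
next
  case (Suc j)
  show ?thesis unfolding Suc
    by (rule C_on_SucI[OF \<open>open S\<close> bounded_linear_imp_has_derivative[OF assms(1)] C_on_const])
qed

text \<open>Substituting a projection turns a function of some of the variables into a function of all of them.\<close>

lemma C_on_compose_linear:
  assumes "bounded_linear L" "C_on k S f" "open T" "L ` T \<subseteq> S"
  shows "C_on k T (\<lambda>x. f (L x))"
  using assms(2)
proof (induction k arbitrary: f)
  case 0
  then show ?case
    using continuous_on_compose2[OF _ linear_continuous_on[OF assms(1)] assms(4)] by simp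
next
  case (Suc k)
  show ?case
  proof (rule C_on_SucI[OF \<open>open T\<close>])
    show "((\<lambda>x. f (L x)) has_derivative (\<lambda>u. fd f (L x) (L u))) (at x)" if "x \<in> T" for x
      by (rule has_derivative_compose[OF bounded_linear_imp_has_derivative[OF assms(1)]
              fd_has_derivative])
         (use Suc.prems that assms(4) in auto)
    show "C_on k T (\<lambda>x. fd f (L x) (L u))" for u
      using Suc.IH[of "\<lambda>x. fd f x (L u)"] Suc.prems by simp
  qed
qed

text \<open>The fibre component \<open>(x, u) \<mapsto> fd f x u\<close> of the tangent map loses only one order of differentiability.\<close>

lemma C_on_tangent:
  fixes f :: "'a::euclidean_space \<Rightarrow> 'b::euclidean_space"
  assumes "C_on (Suc k) S f" "open S"
  shows "C_on k (S \<times> UNIV) (\<lambda>z. fd f (fst z) (snd z))"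
proof -
  have o: "open (S \<times> (UNIV :: 'a set))" using \<open>open S\<close> by (simp add: open_Times)
  have "C_on k (S \<times> UNIV) (\<lambda>z. \<Sum>b\<in>Basis. (snd z \<bullet> b) *\<^sub>R fd f (fst z) b)"
  proof (intro C_on_sum C_on_scaleR o)
    fix b :: 'a
    show "C_on k (S \<times> UNIV) (\<lambda>z::'a\<times>'a. snd z \<bullet> b)"
      by (intro C_on_bounded_linear o bounded_linear_compose[OF bounded_linear_inner_left bounded_linear_snd])
    show "C_on k (S \<times> UNIV) (\<lambda>z::'a\<times>'a. fd f (fst z) b)"
      by (rule C_on_compose_linear[OF bounded_linear_fst C_on_fd[OF assms(1)] o]) auto
  qed
  moreover have "(\<Sum>b\<in>Basis. (snd z \<bullet> b) *\<^sub>R fd f (fst z) b) = fd f (fst z) (snd z)"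
    if "z \<in> S \<times> UNIV" for z :: "'a\<times>'a"
    using fd_sum_Basis[OF C_on_differentiable[OF assms(1)], of "fst z" "snd z"] that by auto
  ultimately show ?thesis by (rule C_on_cong[OF o])
qed

lemma matrix_mult_matrix_inv:
  assumes "invertible (A :: real ^ 'n ^ 'n)"
  shows "A ** matrix_inv A = mat 1"
  using someI_ex[OF assms[unfolded invertible_def]] by (simp add: matrix_inv_def)

lemma C_on_matrix_inv:
  fixes h :: "'a::euclidean_space \<Rightarrow> real ^ 'n ^ 'n"
  assumes h: "C_on k S h" and "open S" and inv: "\<And>x. x \<in> S \<Longrightarrow> invertible (h x)"
  shows "C_on k S (\<lambda>x. matrix_inv (h x) $ i $ l)"
proof -
  have hij: "C_on k S (\<lambda>x. h x $ a $ b)" for a b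
    using C_on_nth[OF C_on_nth[OF h]] \<open>open S\<close> by blast
  have det: "C_on k S (\<lambda>x. det (A x))" if "\<And>a b. C_on k S (\<lambda>x. A x $ a $ b)"
    for A :: "'a \<Rightarrow> real ^ 'n ^ 'n"
    unfolding det_def by (intro C_on_sum C_on_mult C_on_const C_on_prod that \<open>open S\<close>)
  define e :: "real ^ 'n" where "e = axis l 1"
  have "C_on k S (\<lambda>x. det (\<chi> a b. if b = i then e $ a else h x $ a $ b) * inverse (det (h x)))"
  proof (intro C_on_mult det C_on_inverse \<open>open S\<close> hij)
    show "det (h x) \<noteq> 0" if "x \<in> S" for x using inv[OF that] by (simp add: invertible_det_nz)
    show "C_on k S (\<lambda>x. (\<chi> a b. if b = i then e $ a else h x $ a $ b) $ a $ b)" for a b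
      by (cases "b = i") (simp_all add: hij C_on_const)
  qed
  moreover have "det (\<chi> a b. if b = i then e $ a else h x $ a $ b) * inverse (det (h x))
      = matrix_inv (h x) $ i $ l" if "x \<in> S" for x
  proof -
    \<comment> \<open>Cramer's rule for the \<open>l\<close>-th column of the inverse\<close>
    have "h x *v (matrix_inv (h x) *v e) = e"
      using matrix_mult_matrix_inv[OF inv[OF that]] by (simp add: matrix_vector_mul_assoc)
    then have "matrix_inv (h x) *v e = (\<chi> k. det(\<chi> a b. if b=k then e$a else h x$a$b) / det (h x))"
      using cramer[of "h x"] inv[OF that] by (simp add: invertible_det_nz)
    then have "(matrix_inv (h x) *v e) $ i = det (\<chi> a b. if b = i then e $ a else h x $ a $ b) / det (h x)"
      by simp
    then show ?thesis
      by (simp add: e_def matrix_vector_mult_basis column_def field_simps)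
  qed
  ultimately show ?thesis by (rule C_on_cong[OF \<open>open S\<close>])
qed

section \<open>Derivatives along curves and symmetry of second derivatives\<close>

lemma fd_along_curve:
  assumes "f differentiable (at (c t))" "(c has_vector_derivative c') (at t)"
  shows "((\<lambda>s. f (c s)) has_vector_derivative fd f (c t) c') (at t)"
proof -
  have "(f \<circ> c has_derivative fd f (c t) \<circ> (\<lambda>s. s *\<^sub>R c')) (at t)"
    using diff_chain_at[OF assms(2)[unfolded has_vector_derivative_def] fd_has_derivative[OF assms(1)]] .
  moreover have "fd f (c t) \<circ> (\<lambda>s. s *\<^sub>R c') = (\<lambda>s. s *\<^sub>R fd f (c t) c')"
    using linear_cmul[OF fd_linear[OF assms(1)]] by (auto simp: o_def)
  ultimately show ?thesis by (simp add: has_vector_derivative_def o_def)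
qed

lemma has_vector_derivative_vec:
  fixes f :: "real \<Rightarrow> real ^ 'n"
  assumes "\<And>k. ((\<lambda>s. f s $ k) has_vector_derivative f' $ k) (at t)"
  shows "(f has_vector_derivative f') (at t)"
proof -
  have e: "y = (\<Sum>k\<in>UNIV. (y $ k) *\<^sub>R axis k 1)" for y :: "real ^ 'n"
    by (simp add: vec_eq_iff axis_def if_distrib cong: if_cong)
  have "((\<lambda>s. \<Sum>k\<in>UNIV. (f s $ k) *\<^sub>R (axis k 1 :: real ^ 'n)) has_vector_derivative
      (\<Sum>k\<in>UNIV. (f' $ k) *\<^sub>R axis k 1)) (at t)"
    by (intro has_vector_derivative_sum)
       (auto intro!: derivative_eq_intros assms[unfolded has_real_derivative_iff_has_vector_derivative[symmetric]])
  then show ?thesis using e[of f'] e[of "f _"] by simp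
qed

lemma fd_along_line:
  assumes "f differentiable (at (x + r *\<^sub>R u))"
  shows "((\<lambda>r. f (x + r *\<^sub>R u)) has_vector_derivative fd f (x + r *\<^sub>R u) u) (at r)"
proof -
  have "((\<lambda>r. x + r *\<^sub>R u) has_vector_derivative u) (at r)"
    by (auto intro!: derivative_eq_intros simp: has_vector_derivative_def)
  from vector_derivative_diff_chain_within[OF this[unfolded has_vector_derivative_def[symmetric]], of f "fd f (x + r *\<^sub>R u)"]
  show ?thesis
    using fd_has_derivative[OF assms] has_derivative_at_withinI by (auto simp: o_def)
qed

text \<open>The mean value theorem, applied in the direction \<open>u\<close> to the increment in the direction \<open>w\<close> and then in the
  direction \<open>w\<close> to the derivative, evaluates the symmetric second difference by a mixed second derivative.\<close>

lemma second_difference_mean_value: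
  fixes f :: "'a::euclidean_space \<Rightarrow> real"
  assumes C2: "C_on (Suc (Suc 0)) (ball x e) f" and s: "0 < s" "s * (norm u + norm w) < e"
  shows "\<exists>y. dist x y \<le> s * (norm u + norm w) \<and>
    f (x + s *\<^sub>R u + s *\<^sub>R w) - f (x + s *\<^sub>R u) - f (x + s *\<^sub>R w) + f x
      = s * s * fd (\<lambda>y. fd f y u) y w"
proof -
  have near: "dist x (x + r *\<^sub>R u + q *\<^sub>R w) \<le> s * (norm u + norm w)"
    if "0 \<le> r" "r \<le> s" "0 \<le> q" "q \<le> s" for r q
  proof -
    have "dist x (x + r *\<^sub>R u + q *\<^sub>R w) = norm (r *\<^sub>R u + q *\<^sub>R w)"
      by (subst dist_commute) (simp add: dist_norm add.assoc)
    also have "\<dots> \<le> r * norm u + q * norm w"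
      using norm_triangle_ineq[of "r *\<^sub>R u" "q *\<^sub>R w"] that by simp
    also have "\<dots> \<le> s * (norm u + norm w)"
      using that by (simp add: distrib_left add_mono mult_right_mono)
    finally show ?thesis .
  qed
  have df: "f differentiable (at (x + r *\<^sub>R u + q *\<^sub>R w))"
    if "0 \<le> r" "r \<le> s" "0 \<le> q" "q \<le> s" for r q
    using C_on_differentiable[OF C2] near[OF that] s by force
  have ddf: "(\<lambda>y. fd f y u) differentiable (at (x + r *\<^sub>R u + q *\<^sub>R w))"
    if "0 \<le> r" "r \<le> s" "0 \<le> q" "q \<le> s" for r q
    using C_on_differentiable[OF C_on_fd[OF C2]] near[OF that] s by force
  define G where "G = (\<lambda>r. f (x + s *\<^sub>R w + r *\<^sub>R u) - f (x + r *\<^sub>R u))"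
  have "(G has_real_derivative fd f (x + s *\<^sub>R w + r *\<^sub>R u) u - fd f (x + r *\<^sub>R u) u) (at r)"
    if "0 \<le> r" "r \<le> s" for r
  proof -
    have "f differentiable (at (x + s *\<^sub>R w + r *\<^sub>R u))" "f differentiable (at (x + r *\<^sub>R u))"
      using df[OF that, of s] df[OF that, of 0] s by (simp_all add: ac_simps)
    then show ?thesis
      unfolding has_real_derivative_iff_has_vector_derivative G_def
      by (intro has_vector_derivative_diff fd_along_line)
  qed
  from MVT2[OF s(1), of G, OF this] obtain r where r: "0 < r" "r < s"
    and Gs: "G s - G 0 = s * (fd f (x + s *\<^sub>R w + r *\<^sub>R u) u - fd f (x + r *\<^sub>R u) u)"
    by auto
  define H where "H = (\<lambda>q. fd f (x + r *\<^sub>R u + q *\<^sub>R w) u)"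
  have "(H has_real_derivative fd (\<lambda>y. fd f y u) (x + r *\<^sub>R u + q *\<^sub>R w) w) (at q)"
    if "0 \<le> q" "q \<le> s" for q
    unfolding has_real_derivative_iff_has_vector_derivative H_def
    using r that by (intro fd_along_line ddf) auto
  from MVT2[OF s(1), of H, OF this] obtain q where q: "0 < q" "q < s"
    and Hs: "H s - H 0 = s * fd (\<lambda>y. fd f y u) (x + r *\<^sub>R u + q *\<^sub>R w) w"
    by auto
  have "f (x + s *\<^sub>R u + s *\<^sub>R w) - f (x + s *\<^sub>R u) - f (x + s *\<^sub>R w) + f x = G s - G 0"
    by (simp add: G_def ac_simps)
  also have "\<dots> = s * (H s - H 0)"
    unfolding Gs by (simp add: H_def ac_simps)
  also have "\<dots> = s * s * fd (\<lambda>y. fd f y u) (x + r *\<^sub>R u + q *\<^sub>R w) w"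
    unfolding Hs by simp
  finally show ?thesis
    using near[of r q] r q by (intro exI[of _ "x + r *\<^sub>R u + q *\<^sub>R w"]) simp
qed

text \<open>The second difference is symmetric in \<open>u\<close> and \<open>w\<close>; shrink the parallelogram and use continuity of the
  second derivatives.\<close>

lemma fd_commute_real:
  fixes f :: "'a::euclidean_space \<Rightarrow> real"
  assumes C2: "C_on (Suc (Suc 0)) S f" and S: "open S" "x \<in> S"
  shows "fd (\<lambda>y. fd f y u) x w = fd (\<lambda>y. fd f y w) x u"
proof -
  obtain e where e: "e > 0" "ball x e \<subseteq> S" using S open_contains_ball by blast
  have C2': "C_on (Suc (Suc 0)) (ball x e) f" using C_on_subset[OF C2 e(2)] .
  define K where "K = norm u + norm w"
  have K: "K \<ge> 0" by (simp add: K_def)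
  \<comment> \<open>side lengths that tend to zero and keep the parallelograms inside the ball\<close>
  define s where "s = (\<lambda>n::nat. e / (K + 1) / real (Suc (Suc n)))"
  have s0: "s n > 0" for n using e K by (simp add: s_def)
  have sK: "s n * K < e" for n
  proof -
    have "s n * K = e * (K / ((K + 1) * real (Suc (Suc n))))" by (simp add: s_def)
    also have "\<dots> < e * 1"
    proof (rule mult_strict_left_mono[OF _ e(1)])
      have "K < (K + 1) * 1" by simp
      also have "\<dots> \<le> (K + 1) * real (Suc (Suc n))" using K by (intro mult_left_mono) auto
      finally show "K / ((K + 1) * real (Suc (Suc n))) < 1" using K by (simp add: divide_less_eq)
    qed
    finally show ?thesis by simp
  qed
  have slim: "(\<lambda>n. s n * K) \<longlonglongrightarrow> 0"
  proof -
    have "(\<lambda>n. (e / (K + 1) * K) * (1 / real (Suc (Suc n)))) \<longlonglongrightarrow> (e / (K + 1) * K) * 0"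
      by (intro tendsto_mult_left LIMSEQ_Suc[OF LIMSEQ_Suc[OF lim_1_over_n]])
    then show ?thesis by (simp add: s_def)
  qed
  have "\<exists>y z. dist x y \<le> s n * K \<and> dist x z \<le> s n * K \<and>
      fd (\<lambda>y. fd f y u) y w = fd (\<lambda>y. fd f y w) z u" for n
  proof -
    have sK': "s n * (norm u + norm w) < e" "s n * (norm w + norm u) < e"
      using sK[of n] by (simp_all add: K_def add.commute)
    obtain y where y: "dist x y \<le> s n * K"
      "f (x + s n *\<^sub>R u + s n *\<^sub>R w) - f (x + s n *\<^sub>R u) - f (x + s n *\<^sub>R w) + f x
      = s n * s n * fd (\<lambda>y. fd f y u) y w"
      using second_difference_mean_value[OF C2' s0 sK'(1)] unfolding K_def by blast
    obtain z where z: "dist x z \<le> s n * K"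
      "f (x + s n *\<^sub>R w + s n *\<^sub>R u) - f (x + s n *\<^sub>R w) - f (x + s n *\<^sub>R u) + f x
      = s n * s n * fd (\<lambda>y. fd f y w) z u"
      using second_difference_mean_value[OF C2' s0 sK'(2)] unfolding K_def add.commute[of "norm u"]
      by blast
    have "s n * s n * fd (\<lambda>y. fd f y u) y w = s n * s n * fd (\<lambda>y. fd f y w) z u"
      unfolding y(2)[symmetric] z(2)[symmetric] add.assoc add.commute[of "s n *\<^sub>R w" "s n *\<^sub>R u"]
      by linarith
    then show ?thesis using y(1) z(1) s0[of n] by auto
  qed
  then obtain y z where yz: "\<And>n. dist x (y n) \<le> s n * K" "\<And>n. dist x (z n) \<le> s n * K"
    "\<And>n. fd (\<lambda>y. fd f y u) (y n) w = fd (\<lambda>y. fd f y w) (z n) u" by metis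
  have conv: "q \<longlonglongrightarrow> x" if "\<And>n. dist x (q n) \<le> s n * K" for q
  proof (rule metric_tendsto_imp_tendsto[OF slim], rule always_eventually, rule allI)
    show "dist (q n) x \<le> dist (s n * K) 0" for n
      using that[of n] by (simp add: dist_commute)
  qed
  have cont: "isCont (\<lambda>y. fd (\<lambda>y. fd f y a) y b) x" for a b
    using C_on_continuous[OF C_on_fd[OF C_on_fd[OF C2]]] S continuous_on_eq_continuous_at by blast
  have "(\<lambda>n. fd (\<lambda>y. fd f y u) (y n) w) \<longlonglongrightarrow> fd (\<lambda>y. fd f y u) x w"
    "(\<lambda>n. fd (\<lambda>y. fd f y w) (z n) u) \<longlonglongrightarrow> fd (\<lambda>y. fd f y w) x u"
    by (rule isCont_tendsto_compose[OF cont conv[OF yz(1)]], rule isCont_tendsto_compose[OF cont conv[OF yz(2)]])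
  then show ?thesis unfolding yz(3) by (rule LIMSEQ_unique)
qed

lemma fd_bounded_linear:
  assumes "bounded_linear L" "f differentiable (at x)"
  shows "fd (\<lambda>x. L (f x)) x u = L (fd f x u)"
  by (rule fd_eq[OF bounded_linear.has_derivative[OF assms(1) fd_has_derivative[OF assms(2)]]])

theorem fd_commute:
  fixes f :: "'a::euclidean_space \<Rightarrow> 'b::euclidean_space"
  assumes C2: "C_on (Suc (Suc 0)) S f" and S: "open S" "x \<in> S"
  shows "fd (\<lambda>y. fd f y u) x w = fd (\<lambda>y. fd f y w) x u"
proof (rule euclidean_eqI)
  fix b :: 'b
  have bl: "bounded_linear (\<lambda>y. y \<bullet> b)" by (rule bounded_linear_inner_left)
  have *: "fd (\<lambda>y. fd f y u) x w \<bullet> b = fd (\<lambda>y. fd (\<lambda>y. f y \<bullet> b) y u) x w" for u w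
  proof -
    have d: "((\<lambda>y. fd f y u \<bullet> b) has_derivative (\<lambda>w. fd (\<lambda>y. fd f y u) x w \<bullet> b)) (at x)"
      by (rule bounded_linear.has_derivative[OF bl fd_has_derivative[OF
            C_on_differentiable[OF C_on_fd[OF C2] S(2)]]])
    have "((\<lambda>y. fd (\<lambda>y. f y \<bullet> b) y u) has_derivative (\<lambda>w. fd (\<lambda>y. fd f y u) x w \<bullet> b)) (at x)"
      by (rule has_derivative_transform_within_open[OF d S])
         (rule fd_bounded_linear[OF bl C_on_differentiable[OF C2], symmetric])
    then show ?thesis by (rule fd_eq[symmetric])
  qed
  show "fd (\<lambda>y. fd f y u) x w \<bullet> b = fd (\<lambda>y. fd f y w) x u \<bullet> b"
    unfolding * by (rule fd_commute_real[OF C_on_linear[OF bl C2 S(1)] S])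
qed

section \<open>Local solutions of autonomous differential equations\<close>

text \<open>The derivative is bounded on the compact ball, since it is in each of the finitely many basis directions.\<close>

lemma C1_lipschitz_on_cball:
  fixes f :: "'a::euclidean_space \<Rightarrow> 'b::euclidean_space"
  assumes C1: "C_on (Suc 0) S f" and sub: "cball x0 r \<subseteq> S"
  obtains L where "L \<ge> 0" "\<And>x y. x \<in> cball x0 r \<Longrightarrow> y \<in> cball x0 r \<Longrightarrow> norm (f x - f y) \<le> L * norm (x - y)"
proof -
  have "\<exists>B. \<forall>x\<in>cball x0 r. norm (fd f x b) \<le> B" for b
  proof -
    have "continuous_on (cball x0 r) (\<lambda>x. fd f x b)"
      using continuous_on_subset[OF C_on_continuous[OF C_on_fd[OF C1]] sub] .
    from compact_imp_bounded[OF compact_continuous_image[OF this compact_cball]] show ?thesis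
      unfolding bounded_iff by blast
  qed
  then obtain B where B: "\<And>b x. x \<in> cball x0 r \<Longrightarrow> norm (fd f x b) \<le> B b" by metis
  define L where "L = (\<Sum>b\<in>Basis. \<bar>B b\<bar>)"
  have L0: "L \<ge> 0" by (simp add: L_def sum_nonneg)
  have on: "onorm (fd f x) \<le> L" if x: "x \<in> cball x0 r" for x
  proof (rule onorm_bound[OF L0])
    fix u
    have "norm (fd f x u) = norm (\<Sum>b\<in>Basis. (u \<bullet> b) *\<^sub>R fd f x b)"
      by (subst fd_sum_Basis[OF C_on_differentiable[OF C1 subsetD[OF sub x]]]) (rule refl)
    also have "\<dots> \<le> (\<Sum>b\<in>Basis. norm ((u \<bullet> b) *\<^sub>R fd f x b))" by (rule norm_sum)
    also have "\<dots> \<le> (\<Sum>b\<in>Basis. norm u * \<bar>B b\<bar>)"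
    proof (rule sum_mono)
      fix b :: 'a assume "b \<in> Basis"
      have "norm (fd f x b) \<le> \<bar>B b\<bar>" using B[OF x, of b] by linarith
      then show "norm ((u \<bullet> b) *\<^sub>R fd f x b) \<le> norm u * \<bar>B b\<bar>"
        using Basis_le_norm[OF \<open>b \<in> Basis\<close>, of u] by (simp add: mult_mono)
    qed
    also have "\<dots> = L * norm u" by (simp add: L_def sum_distrib_left mult.commute)
    finally show "norm (fd f x u) \<le> L * norm u" .
  qed
  have "norm (f x - f y) \<le> L * norm (x - y)" if "x \<in> cball x0 r" "y \<in> cball x0 r" for x y
  proof (rule differentiable_bound[OF convex_cball _ on that])
    show "(f has_derivative fd f x) (at x within cball x0 r)" if "x \<in> cball x0 r" for x
      by (rule has_derivative_at_withinI[OF fd_has_derivative[OF C_on_differentiable[OF C1 subsetD[OF sub that]]]])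
  qed (use on in blast)+
  then show thesis using that L0 by blast
qed

text \<open>Picard's fixed point argument for a bounded, globally Lipschitz right-hand side. The integral operator
  is made to act on functions on the whole line by clipping time to \<open>[-e, e]\<close>; its integrals start at \<open>-e\<close> and are
  normalised to vanish at time zero, which costs a harmless factor three in the contraction constant.\<close>

lemma picard_bounded_lipschitz:
  fixes f :: "'a::euclidean_space \<Rightarrow> 'a"
  assumes L: "L \<ge> 0" "\<And>x y. norm (f x - f y) \<le> L * norm (x - y)"
    and B: "\<And>x. norm (f x) \<le> B" and e: "0 < e" "3 * e * L < 1"
  obtains x where "x 0 = x0"
    "\<And>t. t \<in> {-e<..<e} \<Longrightarrow> (x has_vector_derivative f (x t)) (at t)"
    "\<And>t. t \<in> {-e<..<e} \<Longrightarrow> norm (x t - x0) \<le> 3 * e * B"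
proof -
  have B0: "B \<ge> 0" using B norm_ge_zero order_trans by blast
  have contf: "continuous_on UNIV f"
  proof (rule lipschitz_on_continuous_on)
    show "L-lipschitz_on UNIV f" using L by (auto simp: lipschitz_on_def dist_norm)
  qed
  define clip where "clip = (\<lambda>t::real. max (-e) (min e t))"
  have clip: "clip t \<in> {-e..e}" for t using e by (auto simp: clip_def)
  have contclip: "continuous_on UNIV clip" unfolding clip_def by (intro continuous_intros)
  define J where "J = (\<lambda>y t. integral {-e..t} (\<lambda>s. f (apply_bcontfun y s)))"
  define T where "T = (\<lambda>y t. x0 + (J y (clip t) - J y 0))"
  have contfy: "continuous_on S (\<lambda>s. f (apply_bcontfun y s))" for y S
    using continuous_on_compose2[OF contf continuous_on_apply_bcontfun] by blast
  have int: "(\<lambda>s. f (apply_bcontfun y s)) integrable_on {-e..t}" for y t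
    by (rule integrable_continuous_real[OF contfy])
  have Jb: "norm (J y t - J z t) \<le> L * dist y z * (2 * e)" if "t \<in> {-e..e}" for y z t
  proof -
    have "J y t - J z t = integral {-e..t} (\<lambda>s. f (apply_bcontfun y s) - f (apply_bcontfun z s))"
      unfolding J_def by (rule integral_diff[symmetric, OF int int])
    also have "norm \<dots> \<le> L * dist y z * (t - (-e))"
    proof (rule integral_bound)
      show "norm (f (apply_bcontfun y s) - f (apply_bcontfun z s)) \<le> L * dist y z" for s
        using L(2)[of "apply_bcontfun y s" "apply_bcontfun z s"]
          mult_left_mono[OF dist_bounded[of y s z] L(1)] by (simp add: dist_norm)
    qed (use that in \<open>auto intro!: continuous_intros contfy\<close>)
    also have "\<dots> \<le> L * dist y z * (2 * e)" using that L(1) by (intro mult_left_mono) auto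
    finally show ?thesis .
  qed
  have Jn: "norm (J y t) \<le> B * (2 * e)" if "t \<in> {-e..e}" for y t
  proof -
    have "norm (J y t) \<le> B * (t - (-e))" unfolding J_def
      using that B by (intro integral_bound contfy) auto
    also have "\<dots> \<le> B * (2 * e)" using that B0 by (intro mult_left_mono) auto
    finally show ?thesis .
  qed
  have J0: "norm (J y 0) \<le> B * e" for y
    using integral_bound[OF _ contfy B, of "-e" 0 y] e unfolding J_def by simp
  have J0b: "norm (J y 0 - J z 0) \<le> L * dist y z * e" for y z
  proof -
    have "J y 0 - J z 0 = integral {-e..0} (\<lambda>s. f (apply_bcontfun y s) - f (apply_bcontfun z s))"
      unfolding J_def by (rule integral_diff[symmetric, OF int int])
    also have "norm \<dots> \<le> L * dist y z * (0 - (-e))"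
    proof (rule integral_bound)
      show "norm (f (apply_bcontfun y s) - f (apply_bcontfun z s)) \<le> L * dist y z" for s
        using L(2)[of "apply_bcontfun y s" "apply_bcontfun z s"]
          mult_left_mono[OF dist_bounded[of y s z] L(1)] by (simp add: dist_norm)
    qed (use e in \<open>auto intro!: continuous_intros contfy\<close>)
    finally show ?thesis by simp
  qed
  have Tn: "norm (T y t - x0) \<le> 3 * e * B" for y t
    using norm_triangle_ineq4[of "J y (clip t)" "J y 0"] Jn[OF clip, of y t] J0[of y]
    by (simp add: T_def algebra_simps)
  have contJ: "continuous_on {-e..e} (J y)" for y
    unfolding J_def by (rule indefinite_integral_continuous_1[OF int])
  have contT: "continuous_on UNIV (T y)" for y
    unfolding T_def using clip
    by (intro continuous_intros continuous_on_compose2[OF contJ contclip]) auto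
  have Tbc: "T y \<in> bcontfun" for y
  proof -
    have "norm (T y t) \<le> norm x0 + 3 * e * B" for t
      using Tn[of y t] norm_triangle_ineq2[of "T y t" x0] by linarith
    then show ?thesis using contT by (auto simp: bcontfun_def bounded_iff)
  qed
  define P where "P = (\<lambda>y. Bcontfun (T y))"
  have P: "apply_bcontfun (P y) = T y" for y
    unfolding P_def by (rule Bcontfun_inverse[OF Tbc])
  have "dist (P y) (P z) \<le> (3 * e * L) * dist y z" for y z
  proof (rule dist_bound)
    fix t
    have "T y t - T z t = (J y (clip t) - J z (clip t)) - (J y 0 - J z 0)" by (simp add: T_def)
    then have "norm (T y t - T z t) \<le> norm (J y (clip t) - J z (clip t)) + norm (J y 0 - J z 0)"
      by (simp only: norm_triangle_ineq4)
    also have "\<dots> \<le> L * dist y z * (2 * e) + L * dist y z * e"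
      by (intro add_mono Jb[OF clip] J0b)
    finally show "dist (apply_bcontfun (P y) t) (apply_bcontfun (P z) t) \<le> (3 * e * L) * dist y z"
      by (simp add: P dist_norm algebra_simps)
  qed
  moreover have "0 \<le> 3 * e * L" using e L by simp
  ultimately obtain y where y: "P y = y"
    using banach_fix_type[of "3 * e * L" P] e(2) by blast
  define x where "x = apply_bcontfun y"
  have x: "x t = T y t" for t using P[of y] y by (simp add: x_def)
  show thesis
  proof
    show "x 0 = x0" using e by (simp add: x T_def clip_def)
    show "norm (x t - x0) \<le> 3 * e * B" for t using Tn by (simp add: x)
    fix t assume t: "t \<in> {-e<..<e}"
    have "((\<lambda>t. x0 + (J y t - J y 0)) has_vector_derivative (0 + (f (x t) - 0))) (at t within {-e..e})"
      unfolding J_def x_def using t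
      by (intro has_vector_derivative_add has_vector_derivative_diff has_vector_derivative_const
          integral_has_vector_derivative[OF contfy]) auto
    then have "((\<lambda>t. x0 + (J y t - J y 0)) has_vector_derivative f (x t)) (at t)"
      using t at_within_Icc_at[of "-e" t e] by simp
    then show "(x has_vector_derivative f (x t)) (at t)"
    proof (rule has_vector_derivative_transform_within_open[OF _ open_greaterThanLessThan t])
      show "x0 + (J y s - J y 0) = x s" if "s \<in> {-e<..<e}" for s
        using that by (simp add: x T_def clip_def)
    qed
  qed
qed

text \<open>The right-hand side is composed with the nearest-point projection onto a ball, which makes it bounded and
  globally Lipschitz; on a short time interval the solution does not leave the ball and the cutoff is invisible.\<close>

theorem local_solution_exists:
  fixes f :: "'a::euclidean_space \<Rightarrow> 'a"
  assumes C1: "C_on (Suc 0) S f" and S: "open S" "x0 \<in> S"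
  obtains e x where "e > 0" "x 0 = x0"
    "\<And>t. t \<in> {-e<..<e} \<Longrightarrow> x t \<in> S"
    "\<And>t. t \<in> {-e<..<e} \<Longrightarrow> (x has_vector_derivative f (x t)) (at t)"
proof -
  obtain r where r: "r > 0" "cball x0 r \<subseteq> S" using S open_contains_cball by blast
  obtain L where L: "L \<ge> 0" "\<And>x y. x \<in> cball x0 r \<Longrightarrow> y \<in> cball x0 r \<Longrightarrow> norm (f x - f y) \<le> L * norm (x - y)"
    using C1_lipschitz_on_cball[OF C1 r(2)] by blast
  have "continuous_on (cball x0 r) f"
    using continuous_on_subset[OF C_on_continuous[OF C1] r(2)] .
  from compact_imp_bounded[OF compact_continuous_image[OF this compact_cball]]
  obtain B where B: "B > 0" "\<And>x. x \<in> cball x0 r \<Longrightarrow> norm (f x) \<le> B"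
    unfolding bounded_pos by blast
  \<comment> \<open>cut off \<open>f\<close> outside the ball without increasing its Lipschitz constant\<close>
  define c where "c = closest_point (cball x0 r)"
  have c: "c x \<in> cball x0 r" for x unfolding c_def
    using r by (intro closest_point_in_set) auto
  have c1: "norm (c x - c y) \<le> norm (x - y)" for x y
    using closest_point_lipschitz[of "cball x0 r" x y] r by (simp add: c_def dist_norm)
  \<comment> \<open>the first bound makes the integral operator contract, the second keeps the solution in the ball\<close>
  define e where "e = min (1 / (4 * (L + 1))) (r / (4 * B))"
  have e: "e > 0" using L B r by (simp add: e_def)
  have "3 * e * L \<le> 3 * (1 / (4 * (L + 1))) * L"
    using L by (intro mult_right_mono) (auto simp: e_def)
  also have "\<dots> < 1" using L by (simp add: field_simps)
  finally have e1: "3 * e * L < 1" .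
  have "3 * e * B \<le> 3 * (r / (4 * B)) * B"
    using B by (intro mult_right_mono) (auto simp: e_def)
  also have "\<dots> \<le> r" using B r by (simp add: field_simps)
  finally have e2: "3 * e * B \<le> r" .
  obtain x where x: "x 0 = x0" "\<And>t. t \<in> {-e<..<e} \<Longrightarrow> (x has_vector_derivative f (c (x t))) (at t)"
    "\<And>t. t \<in> {-e<..<e} \<Longrightarrow> norm (x t - x0) \<le> 3 * e * B"
  proof (rule picard_bounded_lipschitz[where f="\<lambda>x. f (c x)" and L=L and B=B and e=e and ?x0.0=x0])
    show "norm (f (c x) - f (c y)) \<le> L * norm (x - y)" for x y
      using L(2)[OF c c, of x y] mult_left_mono[OF c1 L(1)] order_trans by blast
  qed (use L B c e e1 in auto)
  have ball: "x t \<in> cball x0 r" if "t \<in> {-e<..<e}" for t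
    using x(3)[OF that] e2 by (simp add: dist_norm norm_minus_commute)
  show thesis
  proof (rule that[of e x, OF e x(1)])
    show "x t \<in> S" if "t \<in> {-e<..<e}" for t using ball[OF that] r by blast
    show "(x has_vector_derivative f (x t)) (at t)" if "t \<in> {-e<..<e}" for t
      using x(2)[OF that] closest_point_self[OF ball[OF that]] by (simp add: c_def)
  qed
qed

section \<open>Bilinear maps in components\<close>

text \<open>The bilinear form with matrix \<open>G\<close>, for metrics and for their derivatives alike, which need not be positive.\<close>

definition gram :: "real ^ 'n ^ 'n \<Rightarrow> real ^ 'n \<Rightarrow> real ^ 'n \<Rightarrow> real" where
  "gram G u w = u \<bullet> (G *v w)"

lemma gram_sum: "gram G u w = (\<Sum>i\<in>UNIV. \<Sum>j\<in>UNIV. G $ i $ j * u $ i * w $ j)"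
  by (simp add: gram_def inner_vec_def matrix_vector_mult_def sum_distrib_left mult_ac)

lemma scal_gram: "scal h x u w = gram (h x) u w"
  by (simp add: gram_sum scal_def)

lemma gram_add [simp]:
  "gram (G + G') u w = gram G u w + gram G' u w"
  "gram G (u + u') w = gram G u w + gram G u' w"
  "gram G u (w + w') = gram G u w + gram G u w'"
  by (simp_all add: gram_def matrix_vector_mult_add_rdistrib matrix_vector_right_distrib inner_add_left inner_add_right)

lemma gram_scaleR [simp]:
  "gram (r *\<^sub>R G) u w = r * gram G u w"
  "gram G (r *\<^sub>R u) w = r * gram G u w"
  "gram G u (r *\<^sub>R w) = r * gram G u w"
  by (simp_all add: gram_sum sum_distrib_left mult_ac)

lemma gram_minus [simp]:
  "gram G (- u) w = - gram G u w" "gram G u (- w) = - gram G u w"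
  using gram_scaleR(2)[of G "-1" u w] gram_scaleR(3)[of G u "-1" w] by simp_all

lemma gram_diff [simp]:
  "gram G (u - u') w = gram G u w - gram G u' w"
  "gram G u (w - w') = gram G u w - gram G u w'"
  using gram_add(2)[of G u "-u'" w] gram_add(3)[of G u w "-w'"] by simp_all

lemma gram_zero [simp]: "gram G 0 w = 0" "gram G u 0 = 0"
  by (simp_all add: gram_sum)

lemma gram_axis: "gram G (axis i 1) (axis j 1) = G $ i $ j"
  by (simp add: gram_def matrix_vector_mult_basis inner_axis' column_def)

lemma sum_gram_axis:
  "(\<Sum>i\<in>UNIV. u $ i * gram G (axis i 1) w) = gram G u w"
proof -
  have "gram G (axis i 1) w = (G *v w) $ i" for i
    by (simp add: gram_def inner_axis')
  then show ?thesis by (simp add: gram_def inner_vec_def)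
qed

lemma lower_gram: "lower h X y w $ j = gram (h y) (axis j 1) (X y w)"
  by (simp add: lower_def gram_def inner_axis' matrix_vector_mult_def)

lemma sum_lower: "(\<Sum>j\<in>UNIV. u $ j * lower h X y w $ j) = gram (h y) u (X y w)"
  by (simp add: lower_gram sum_gram_axis)

lemma bounded_bilinear_gram: "bounded_bilinear (gram G)"
  unfolding bilinear_conv_bounded_bilinear[symmetric] bilinear_def by (auto intro!: linearI)

lemma gram_along_curve:
  fixes h :: "'a::euclidean_space \<Rightarrow> real ^ 'n ^ 'n"
  assumes h: "h differentiable (at (x t))" and x: "(x has_vector_derivative x') (at t)"
    and a: "(a has_vector_derivative a') (at t)" and b: "(b has_vector_derivative b') (at t)"
  shows "((\<lambda>s. gram (h (x s)) (a s) (b s)) has_real_derivative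
    gram (fd h (x t) x') (a t) (b t) + gram (h (x t)) a' (b t) + gram (h (x t)) (a t) b') (at t)"
proof -
  have "bounded_bilinear (\<lambda>(G :: real ^ 'n ^ 'n) w. G *v w)"
    unfolding bilinear_conv_bounded_bilinear[symmetric] bilinear_def
    by (auto intro!: linearI simp: matrix_vector_mult_add_rdistrib matrix_vector_right_distrib
        scaleR_matrix_vector_assoc matrix_vector_mult_scaleR)
  note Gb = bounded_bilinear.has_vector_derivative[OF this fd_along_curve[OF h x] b]
  show ?thesis
    using bounded_bilinear.has_vector_derivative[OF bounded_bilinear_inner a Gb]
    by (simp add: gram_def has_real_derivative_iff_has_vector_derivative inner_add_right algebra_simps)
qed

text \<open>The contraction of coefficients \<open>C\<^sup>k\<^sub>i\<^sub>j\<close> such as the Christoffel symbols with two vectors.\<close>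

definition bil :: "('n::finite \<Rightarrow> 'n \<Rightarrow> 'n \<Rightarrow> real ^ 'n \<Rightarrow> real) \<Rightarrow> real ^ 'n \<Rightarrow> real ^ 'n \<Rightarrow> real ^ 'n \<Rightarrow> real ^ 'n" where
  "bil C x u w = (\<chi> k. \<Sum>i\<in>UNIV. \<Sum>j\<in>UNIV. C k i j x * u $ i * w $ j)"

definition dbil :: "('n::finite \<Rightarrow> 'n \<Rightarrow> 'n \<Rightarrow> real ^ 'n \<Rightarrow> real) \<Rightarrow> real ^ 'n \<Rightarrow> real ^ 'n \<Rightarrow> real ^ 'n \<Rightarrow> real ^ 'n \<Rightarrow> real ^ 'n" where
  "dbil C x a u w = bil (\<lambda>k i j y. fd (C k i j) y a) x u w"

lemma bil_add:
  "bil C x (u + u') w = bil C x u w + bil C x u' w"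
  "bil C x u (w + w') = bil C x u w + bil C x u w'"
  by (simp_all add: bil_def vec_eq_iff algebra_simps sum.distrib)

lemma bil_scaleR:
  "bil C x (r *\<^sub>R u) w = r *\<^sub>R bil C x u w"
  "bil C x u (r *\<^sub>R w) = r *\<^sub>R bil C x u w"
  by (simp_all add: bil_def vec_eq_iff sum_distrib_left mult_ac)

lemma bil_minus: "bil C x (- u) w = - bil C x u w" "bil C x u (- w) = - bil C x u w"
  using bil_scaleR(1)[of C x "-1" u w] bil_scaleR(2)[of C x u "-1" w] by simp_all

lemma bil_diff:
  "bil C x (u - u') w = bil C x u w - bil C x u' w"
  "bil C x u (w - w') = bil C x u w - bil C x u w'"
  using bil_add(1)[of C x u "-u'" w] bil_add(2)[of C x u w "-w'"] by (simp_all add: bil_minus)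

lemma bil_zero [simp]: "bil C x 0 w = 0" "bil C x u 0 = 0"
  by (simp_all add: bil_def vec_eq_iff)

lemma bil_along_curve:
  assumes C: "\<And>k i j. C k i j differentiable (at (x t))"
    and x: "(x has_vector_derivative x') (at t)"
    and a: "(a has_vector_derivative a') (at t)" and b: "(b has_vector_derivative b') (at t)"
  shows "((\<lambda>s. bil C (x s) (a s) (b s)) has_vector_derivative
    dbil C (x t) x' (a t) (b t) + bil C (x t) a' (b t) + bil C (x t) (a t) b') (at t)"
proof (rule has_vector_derivative_vec)
  fix k
  have nth: "((\<lambda>s. y s $ i) has_real_derivative y' $ i) (at t)"
    if "(y has_vector_derivative y') (at t)" for y :: "real \<Rightarrow> real ^ 'n" and y' i
    unfolding has_real_derivative_iff_has_vector_derivative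
    by (rule bounded_linear.has_vector_derivative[OF bounded_linear_vec_nth that])
  have Cx: "((\<lambda>s. C k i j (x s)) has_real_derivative fd (C k i j) (x t) x') (at t)" for i j
    unfolding has_real_derivative_iff_has_vector_derivative by (rule fd_along_curve[OF C x])
  have "((\<lambda>s. \<Sum>i\<in>UNIV. \<Sum>j\<in>UNIV. C k i j (x s) * a s $ i * b s $ j) has_real_derivative
    (\<Sum>i\<in>UNIV. \<Sum>j\<in>UNIV. (fd (C k i j) (x t) x' * a t $ i + C k i j (x t) * a' $ i) * b t $ j
       + C k i j (x t) * a t $ i * b' $ j)) (at t)"
    by (intro DERIV_sum) (auto intro!: derivative_eq_intros Cx nth[OF a] nth[OF b] simp: algebra_simps)
  then show "((\<lambda>s. bil C (x s) (a s) (b s) $ k) has_vector_derivative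
      (dbil C (x t) x' (a t) (b t) + bil C (x t) a' (b t) + bil C (x t) (a t) b') $ k) (at t)"
    by (simp add: has_real_derivative_iff_has_vector_derivative bil_def dbil_def sum.distrib algebra_simps)
qed

lemma sum_rotate: "(\<Sum>i\<in>A. \<Sum>j\<in>B. \<Sum>l\<in>C. f i j l) = (\<Sum>l\<in>C. \<Sum>i\<in>A. \<Sum>j\<in>B. f i j l)"
proof -
  have "(\<Sum>i\<in>A. \<Sum>j\<in>B. \<Sum>l\<in>C. f i j l) = (\<Sum>i\<in>A. \<Sum>l\<in>C. \<Sum>j\<in>B. f i j l)"
    by (rule sum.cong[OF refl], rule sum.swap)
  also have "\<dots> = (\<Sum>l\<in>C. \<Sum>i\<in>A. \<Sum>j\<in>B. f i j l)"
    by (rule sum.swap)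
  finally show ?thesis .
qed

lemma vec_sum_axis: "u = (\<Sum>i\<in>UNIV. (u $ i) *\<^sub>R axis i 1)" for u :: "real ^ 'n"
  by (simp add: vec_eq_iff axis_def if_distrib cong: if_cong)

lemma fd_sum_partial:
  fixes f :: "real ^ 'n \<Rightarrow> real"
  assumes "f differentiable (at x)"
  shows "fd f x u = (\<Sum>i\<in>UNIV. u $ i * partial i f x)"
proof -
  have "fd f x u = fd f x (\<Sum>i\<in>UNIV. (u $ i) *\<^sub>R axis i 1)" by (subst vec_sum_axis) (rule refl)
  also have "\<dots> = (\<Sum>i\<in>UNIV. (u $ i) *\<^sub>R fd f x (axis i 1))"
    by (simp only: linear_sum[OF fd_linear[OF assms]] linear_cmul[OF fd_linear[OF assms]])
  finally show ?thesis by (simp add: partial_def)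
qed

lemma fd_nth:
  fixes f :: "'a::euclidean_space \<Rightarrow> 'b::euclidean_space ^ 'n"
  assumes "f differentiable (at x)"
  shows "fd (\<lambda>y. f y $ i) x u = fd f x u $ i"
  by (rule fd_bounded_linear[OF bounded_linear_vec_nth assms])

lemma differentiable_nth:
  fixes f :: "'a::euclidean_space \<Rightarrow> 'b::euclidean_space ^ 'n"
  assumes "f differentiable (at x)"
  shows "(\<lambda>y. f y $ i) differentiable (at x)"
  using bounded_linear.has_derivative[OF bounded_linear_vec_nth fd_has_derivative[OF assms]]
  unfolding differentiable_def by blast

section \<open>The Levi-Civita connection in a chart\<close>

locale metric_chart =
  fixes S :: "(real ^ 'n) set" and h :: "'n::finite local_metric"
  assumes S: "open S" and h_smooth: "smooth_on S h"
    and gram_commute: "x \<in> S \<Longrightarrow> gram (h x) u w = gram (h x) w u"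
    and gram_pos: "x \<in> S \<Longrightarrow> u \<noteq> 0 \<Longrightarrow> gram (h x) u u > 0"
begin

abbreviation "\<Gamma> \<equiv> bil (christoffel h)"
abbreviation "d\<Gamma> \<equiv> dbil (christoffel h)"

lemma h_C: "C_on k S h"
  using h_smooth by (simp add: smooth_on_def)

lemma h_diff: "x \<in> S \<Longrightarrow> h differentiable (at x)"
  using C_on_differentiable[OF h_C] .

lemma gram_nondegenerate:
  assumes "x \<in> S" "\<And>z. gram (h x) u z = 0"
  shows "u = 0"
  using gram_pos[OF assms(1), of u] assms(2)[of u] by force

text \<open>A positive definite matrix has trivial kernel.\<close>

lemma h_invertible: "x \<in> S \<Longrightarrow> invertible (h x)"
proof -
  assume x: "x \<in> S"
  have "h x *v u = 0 \<Longrightarrow> u = 0" for u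
    using gram_pos[OF x, of u] by (force simp: gram_def)
  then show ?thesis
    by (simp add: invertible_left_inverse matrix_left_invertible_ker)
qed

lemma h_entry_commute: "x \<in> S \<Longrightarrow> h x $ i $ j = h x $ j $ i"
  using gram_commute[of x "axis i 1" "axis j 1"] by (simp add: gram_axis)

lemma fd_h_entry: "x \<in> S \<Longrightarrow> fd h x u $ l $ j = (\<Sum>i\<in>UNIV. u $ i * partial i (\<lambda>y. h y $ l $ j) x)"
proof -
  assume x: "x \<in> S"
  have "fd h x u $ l $ j = fd (\<lambda>y. h y $ l $ j) x u"
    by (simp only: fd_nth[OF h_diff[OF x]] fd_nth[OF differentiable_nth[OF h_diff[OF x]]])
  also have "\<dots> = (\<Sum>i\<in>UNIV. u $ i * partial i (\<lambda>y. h y $ l $ j) x)"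
    by (rule fd_sum_partial[OF differentiable_nth[OF differentiable_nth[OF h_diff[OF x]]]])
  finally show ?thesis .
qed

lemma fd_h_commute:
  assumes x: "x \<in> S"
  shows "gram (fd h x a) u w = gram (fd h x a) w u"
proof -
  have "fd h x a $ i $ j = fd h x a $ j $ i" for i j
  proof -
    have e: "fd h x a $ i $ j = fd (\<lambda>y. h y $ i $ j) x a" for i j
      by (simp only: fd_nth[OF h_diff[OF x]] fd_nth[OF differentiable_nth[OF h_diff[OF x]]])
    have "frechet_derivative (\<lambda>y. h y $ i $ j) (at x) = frechet_derivative (\<lambda>y. h y $ j $ i) (at x)"
      by (rule frechet_derivative_transform_within_open[OF _ S x h_entry_commute])
         (rule differentiable_nth[OF differentiable_nth[OF h_diff[OF x]]])
    then show ?thesis by (simp add: e)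
  qed
  then have "gram (fd h x a) u w = (\<Sum>i\<in>UNIV. \<Sum>j\<in>UNIV. fd h x a $ j $ i * u $ i * w $ j)"
    by (simp add: gram_sum)
  also have "\<dots> = gram (fd h x a) w u"
    unfolding gram_sum by (subst sum.swap) (simp add: mult_ac)
  finally show ?thesis .
qed

text \<open>The Koszul formula for vector fields with constant components, whose brackets vanish.\<close>

lemma koszul:
  assumes x: "x \<in> S"
  shows "2 * gram (h x) z (\<Gamma> x u w)
    = gram (fd h x u) z w + gram (fd h x w) z u - gram (fd h x z) u w"
proof -
  define K where "K = (\<lambda>l i j. partial i (\<lambda>y. h y $ l $ j) x + partial j (\<lambda>y. h y $ l $ i) x
        - partial l (\<lambda>y. h y $ i $ j) x)"
  define \<kappa> where "\<kappa> = (\<chi> l. (\<Sum>i\<in>UNIV. \<Sum>j\<in>UNIV. K l i j * u $ i * w $ j) / 2)"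
  have "\<Gamma> x u w $ k = (matrix_inv (h x) *v \<kappa>) $ k" for k
  proof -
    have "\<Gamma> x u w $ k = (\<Sum>i\<in>UNIV. \<Sum>j\<in>UNIV. \<Sum>l\<in>UNIV. matrix_inv (h x) $ k $ l * (K l i j * u $ i * w $ j / 2))"
      by (simp add: bil_def christoffel_def K_def sum_distrib_right sum_divide_distrib mult.assoc)
    also have "\<dots> = (\<Sum>l\<in>UNIV. \<Sum>i\<in>UNIV. \<Sum>j\<in>UNIV. matrix_inv (h x) $ k $ l * (K l i j * u $ i * w $ j / 2))"
      by (rule sum_rotate)
    also have "\<dots> = (matrix_inv (h x) *v \<kappa>) $ k"
      by (simp add: matrix_vector_mult_def \<kappa>_def sum_distrib_left sum_divide_distrib)
    finally show ?thesis .
  qed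
  then have "\<Gamma> x u w = matrix_inv (h x) *v \<kappa>" by (simp add: vec_eq_iff)
  then have "h x *v \<Gamma> x u w = \<kappa>"
    using matrix_mult_matrix_inv[OF h_invertible[OF x]] by (simp add: matrix_vector_mul_assoc)
  then have "2 * gram (h x) z (\<Gamma> x u w) = (\<Sum>l\<in>UNIV. z $ l * (2 * \<kappa> $ l))"
    by (simp add: gram_def inner_vec_def sum_distrib_left mult_ac)
  also have "\<dots> = (\<Sum>l\<in>UNIV. z $ l * (\<Sum>i\<in>UNIV. \<Sum>j\<in>UNIV. K l i j * u $ i * w $ j))"
    by (simp add: \<kappa>_def)
  also have "\<dots> = (\<Sum>l\<in>UNIV. \<Sum>i\<in>UNIV. \<Sum>j\<in>UNIV. z $ l * K l i j * u $ i * w $ j)"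
    by (simp add: sum_distrib_left mult.assoc)
  also have "\<dots> = (\<Sum>l\<in>UNIV. \<Sum>i\<in>UNIV. \<Sum>j\<in>UNIV. partial i (\<lambda>y. h y $ l $ j) x * z $ l * u $ i * w $ j)
     + (\<Sum>l\<in>UNIV. \<Sum>i\<in>UNIV. \<Sum>j\<in>UNIV. partial j (\<lambda>y. h y $ l $ i) x * z $ l * u $ i * w $ j)
     - (\<Sum>l\<in>UNIV. \<Sum>i\<in>UNIV. \<Sum>j\<in>UNIV. partial l (\<lambda>y. h y $ i $ j) x * z $ l * u $ i * w $ j)"
    by (simp add: K_def algebra_simps sum.distrib sum_subtractf)
  also have "(\<Sum>l\<in>UNIV. \<Sum>i\<in>UNIV. \<Sum>j\<in>UNIV. partial i (\<lambda>y. h y $ l $ j) x * z $ l * u $ i * w $ j)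
      = gram (fd h x u) z w"
    unfolding gram_sum fd_h_entry[OF x] sum_distrib_right
    by (rule sum.cong[OF refl], subst sum.swap) (simp add: mult_ac)
  also have "(\<Sum>l\<in>UNIV. \<Sum>i\<in>UNIV. \<Sum>j\<in>UNIV. partial j (\<lambda>y. h y $ l $ i) x * z $ l * u $ i * w $ j)
      = gram (fd h x w) z u"
    unfolding gram_sum fd_h_entry[OF x] sum_distrib_right by (simp add: mult_ac)
  also have "(\<Sum>l\<in>UNIV. \<Sum>i\<in>UNIV. \<Sum>j\<in>UNIV. partial l (\<lambda>y. h y $ i $ j) x * z $ l * u $ i * w $ j)
      = gram (fd h x z) u w"
    unfolding gram_sum fd_h_entry[OF x] sum_distrib_right
    by (subst sum.swap, rule sum.cong[OF refl], subst sum.swap) (simp add: mult_ac)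
  finally show ?thesis .
qed

text \<open>Torsion is zero: the Koszul formula is symmetric in the two arguments and the metric is nondegenerate.\<close>

lemma \<Gamma>_commute:
  assumes x: "x \<in> S"
  shows "\<Gamma> x u w = \<Gamma> x w u"
proof -
  have "gram (h x) z (\<Gamma> x u w) = gram (h x) z (\<Gamma> x w u)" for z
    using koszul[OF x, of z u w] koszul[OF x, of z w u] fd_h_commute[OF x, of z u w] by simp
  then have "gram (h x) (\<Gamma> x u w - \<Gamma> x w u) z = 0" for z
    using gram_commute[OF x, of _ z] by simp
  then show ?thesis using gram_nondegenerate[OF x] by fastforce
qed

text \<open>Compatibility of the connection with the metric.\<close>

lemma fd_h:
  assumes x: "x \<in> S"
  shows "gram (fd h x v) a b = gram (h x) (\<Gamma> x v a) b + gram (h x) a (\<Gamma> x v b)"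
proof -
  have "2 * gram (h x) (\<Gamma> x v a) b = gram (fd h x v) b a + gram (fd h x a) b v - gram (fd h x b) v a"
    using koszul[OF x, of b v a] gram_commute[OF x, of "\<Gamma> x v a" b] by simp
  moreover have "2 * gram (h x) a (\<Gamma> x v b) = gram (fd h x v) a b + gram (fd h x b) a v - gram (fd h x a) v b"
    by (rule koszul[OF x])
  ultimately show ?thesis
    using fd_h_commute[OF x, of v a b] fd_h_commute[OF x, of a b v] fd_h_commute[OF x, of b a v] by linarith
qed

text \<open>Leibniz rule along a curve, for which \<open>a'\<close> and \<open>b'\<close> stand for the covariant derivatives of \<open>a\<close> and \<open>b\<close>.\<close>

lemma gram_covariant_along_curve:
  assumes x: "x t \<in> S" "(x has_vector_derivative v) (at t)"
    and a: "(a has_vector_derivative a' - \<Gamma> (x t) v (a t)) (at t)"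
    and b: "(b has_vector_derivative b' - \<Gamma> (x t) v (b t)) (at t)"
  shows "((\<lambda>s. gram (h (x s)) (a s) (b s)) has_real_derivative
    gram (h (x t)) a' (b t) + gram (h (x t)) (a t) b') (at t)"
  using gram_along_curve[OF h_diff[OF x(1)] x(2) a b] by (simp add: fd_h[OF x(1)])

lemma christoffel_C: "C_on k S (christoffel h l i j)"
proof -
  have e: "C_on m S (\<lambda>y. h y $ a $ b)" for m a b
    by (rule C_on_nth[OF C_on_nth[OF h_C S] S])
  have p: "C_on k S (partial i (\<lambda>y. h y $ a $ b))" for i a b
    using C_on_fd[OF e[of "Suc k" a b], of "axis i 1"] unfolding partial_def[abs_def] .
  have "C_on k S (\<lambda>x. (\<Sum>m\<in>UNIV. matrix_inv (h x) $ l $ m *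
     (partial i (\<lambda>y. h y $ m $ j) x + partial j (\<lambda>y. h y $ m $ i) x
        - partial m (\<lambda>y. h y $ i $ j) x)) * (1 / 2))"
    by (intro C_on_mult C_on_sum C_on_matrix_inv C_on_const C_on_diff C_on_add p S h_C h_invertible)
  then show ?thesis unfolding christoffel_def[abs_def] by simp
qed

lemma christoffel_diff: "x \<in> S \<Longrightarrow> christoffel h l i j differentiable (at x)"
  using C_on_differentiable[OF christoffel_C] .

text \<open>\<open>curv x a v\<close> is $R(a,v)v$.\<close>

definition curv :: "real ^ 'n \<Rightarrow> real ^ 'n \<Rightarrow> real ^ 'n \<Rightarrow> real ^ 'n" where
  "curv x a v = d\<Gamma> x a v v - d\<Gamma> x v a v + \<Gamma> x a (\<Gamma> x v v) - \<Gamma> x v (\<Gamma> x a v)"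

text \<open>For a vector field \<open>v\<close> with constant components, the second derivatives of the function \<open>|v|\<^sup>2\<close> on the chart
  are symmetric. Expressed by covariant derivatives, the two mixed derivatives in the directions \<open>a\<close>
  and \<open>b\<close> differ by \<open>2 (v | R(a,b)v)\<close>; the claim is the case \<open>b = v\<close>.\<close>

lemma curv_orthogonal:
  assumes x: "x \<in> S"
  shows "gram (h x) v (curv x a v) = 0"
proof -
  have key: "gram (fd (\<lambda>y. fd h y a) x b) v v = 2 * (gram (h x) (\<Gamma> x b v) (\<Gamma> x a v)
      + gram (h x) v (\<Gamma> x b (\<Gamma> x a v) + d\<Gamma> x b a v))" for a b
  proof -
    define l where "l = (\<lambda>s::real. x + s *\<^sub>R b)"
    have l0: "l 0 = x" by (simp add: l_def)
    have l: "(l has_vector_derivative b) (at 0)"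
      unfolding l_def by (auto intro!: derivative_eq_intros simp: has_vector_derivative_def)
    have "(\<lambda>y. fd h y a) differentiable (at (l 0))"
      unfolding l0 by (rule C_on_differentiable[OF C_on_fd[OF h_C] x])
    from gram_along_curve[of "\<lambda>y. fd h y a" l, OF this l has_vector_derivative_const has_vector_derivative_const, of v v]
    have 1: "((\<lambda>s. gram (fd h (l s) a) v v) has_real_derivative gram (fd (\<lambda>y. fd h y a) x b) v v) (at 0)"
      by (simp add: l0)
    have \<Gamma>': "((\<lambda>s. \<Gamma> (l s) a v) has_vector_derivative (\<Gamma> x b (\<Gamma> x a v) + d\<Gamma> x b a v) - \<Gamma> x b (\<Gamma> x a v)) (at 0)"
      using bil_along_curve[of "christoffel h" l, OF christoffel_diff[OF x[folded l0]] l
          has_vector_derivative_const has_vector_derivative_const, of a v]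
      by (simp add: l0)
    have v': "((\<lambda>s. v) has_vector_derivative \<Gamma> x b v - \<Gamma> x b v) (at (0::real))"
      by simp
    have 2: "((\<lambda>s. gram (h (l s)) v (\<Gamma> (l s) a v)) has_real_derivative gram (h x) (\<Gamma> x b v) (\<Gamma> x a v)
      + gram (h x) v (\<Gamma> x b (\<Gamma> x a v) + d\<Gamma> x b a v)) (at 0)"
      using gram_covariant_along_curve[of l 0 b "\<lambda>s. v" "\<Gamma> x b v" "\<lambda>s. \<Gamma> (l s) a v"] x l v' \<Gamma>'
      unfolding l0 by blast
    have "open (l -` S)" unfolding l_def
      by (intro open_vimage S continuous_intros)
    then have "((\<lambda>s. gram (fd h (l s) a) v v) has_real_derivative 2 * (gram (h x) (\<Gamma> x b v) (\<Gamma> x a v)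
      + gram (h x) v (\<Gamma> x b (\<Gamma> x a v) + d\<Gamma> x b a v))) (at 0)"
    proof (rule has_field_derivative_transform_within_open[OF DERIV_cmult[OF 2, of 2]])
      show "0 \<in> l -` S" using x l0 by simp
      show "2 * gram (h (l s)) v (\<Gamma> (l s) a v) = gram (fd h (l s) a) v v" if "s \<in> l -` S" for s
        using fd_h[of "l s" a v v] gram_commute[of "l s" v] that by simp
    qed
    from DERIV_unique[OF 1 this] show ?thesis .
  qed
  have "fd (\<lambda>y. fd h y a) x v = fd (\<lambda>y. fd h y v) x a"
    by (rule fd_commute[OF h_C S x])
  then have "gram (h x) (\<Gamma> x v v) (\<Gamma> x a v) + gram (h x) v (\<Gamma> x v (\<Gamma> x a v) + d\<Gamma> x v a v)
      = gram (h x) (\<Gamma> x a v) (\<Gamma> x v v) + gram (h x) v (\<Gamma> x a (\<Gamma> x v v) + d\<Gamma> x a v v)"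
    using key[of a v] key[of v a] by simp
  then show ?thesis
    using gram_commute[OF x, of "\<Gamma> x v v"] by (simp add: curv_def)
qed

lemma d\<Gamma>_partial:
  assumes x: "x \<in> S"
  shows "d\<Gamma> x a u w $ k = (\<Sum>m\<in>UNIV. \<Sum>i\<in>UNIV. \<Sum>j\<in>UNIV. a $ m * partial m (christoffel h k i j) x * u $ i * w $ j)"
proof -
  have "d\<Gamma> x a u w $ k = (\<Sum>i\<in>UNIV. \<Sum>j\<in>UNIV. \<Sum>m\<in>UNIV. a $ m * partial m (christoffel h k i j) x * u $ i * w $ j)"
    by (simp add: dbil_def bil_def fd_sum_partial[OF christoffel_diff[OF x]] sum_distrib_right)
  also have "\<dots> = (\<Sum>i\<in>UNIV. \<Sum>m\<in>UNIV. \<Sum>j\<in>UNIV. a $ m * partial m (christoffel h k i j) x * u $ i * w $ j)"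
    by (rule sum.cong[OF refl], rule sum.swap)
  also have "\<dots> = (\<Sum>m\<in>UNIV. \<Sum>i\<in>UNIV. \<Sum>j\<in>UNIV. a $ m * partial m (christoffel h k i j) x * u $ i * w $ j)"
    by (rule sum.swap)
  finally show ?thesis .
qed

lemma \<Gamma>_\<Gamma>_sum:
  "\<Gamma> x a (\<Gamma> x u w) $ k = (\<Sum>i\<in>UNIV. \<Sum>j\<in>UNIV. \<Sum>m\<in>UNIV. 
     (\<Sum>b\<in>UNIV. christoffel h k i b x * christoffel h b j m x) * a $ i * u $ j * w $ m)"
proof -
  have "\<Gamma> x a (\<Gamma> x u w) $ k = (\<Sum>i\<in>UNIV. \<Sum>b\<in>UNIV. \<Sum>j\<in>UNIV. \<Sum>m\<in>UNIV.
     christoffel h k i b x * christoffel h b j m x * a $ i * u $ j * w $ m)"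
    by (simp add: bil_def sum_distrib_left sum_distrib_right mult_ac)
  also have "\<dots> = (\<Sum>i\<in>UNIV. \<Sum>j\<in>UNIV. \<Sum>b\<in>UNIV. \<Sum>m\<in>UNIV.
     christoffel h k i b x * christoffel h b j m x * a $ i * u $ j * w $ m)"
    by (rule sum.cong[OF refl], rule sum.swap)
  also have "\<dots> = (\<Sum>i\<in>UNIV. \<Sum>j\<in>UNIV. \<Sum>m\<in>UNIV. \<Sum>b\<in>UNIV.
     christoffel h k i b x * christoffel h b j m x * a $ i * u $ j * w $ m)"
    by (rule sum.cong[OF refl], rule sum.cong[OF refl], rule sum.swap)
  finally show ?thesis by (simp add: sum_distrib_right)
qed

lemma curvature_sum:
  assumes x: "x \<in> S"
  shows "(\<Sum>m\<in>UNIV. \<Sum>i\<in>UNIV. \<Sum>j\<in>UNIV. curvature h k m i j x * a $ i * v $ j * v $ m) = curv x a v $ k"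
proof -
  have swap: "(\<Sum>i\<in>UNIV. \<Sum>j\<in>UNIV. \<Sum>m\<in>UNIV. f i j m) = (\<Sum>j\<in>UNIV. \<Sum>i\<in>UNIV. \<Sum>m\<in>UNIV. f i j m)"
    for f :: "'n \<Rightarrow> 'n \<Rightarrow> 'n \<Rightarrow> real"
    by (rule sum.swap)
  have "(\<Sum>m\<in>UNIV. \<Sum>i\<in>UNIV. \<Sum>j\<in>UNIV. curvature h k m i j x * a $ i * v $ j * v $ m)
    = (\<Sum>i\<in>UNIV. \<Sum>j\<in>UNIV. \<Sum>m\<in>UNIV. curvature h k m i j x * a $ i * v $ j * v $ m)"
    by (rule sum_rotate[symmetric])
  also have "\<dots> = (\<Sum>i\<in>UNIV. \<Sum>j\<in>UNIV. \<Sum>m\<in>UNIV. a $ i * partial i (christoffel h k j m) x * v $ j * v $ m)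
    - (\<Sum>i\<in>UNIV. \<Sum>j\<in>UNIV. \<Sum>m\<in>UNIV. v $ j * partial j (christoffel h k i m) x * a $ i * v $ m)
    + (\<Sum>i\<in>UNIV. \<Sum>j\<in>UNIV. \<Sum>m\<in>UNIV. (\<Sum>b\<in>UNIV. christoffel h k i b x * christoffel h b j m x) * a $ i * v $ j * v $ m)
    - (\<Sum>i\<in>UNIV. \<Sum>j\<in>UNIV. \<Sum>m\<in>UNIV. (\<Sum>b\<in>UNIV. christoffel h k j b x * christoffel h b i m x) * v $ j * a $ i * v $ m)"
    unfolding sum.distrib[symmetric] sum_subtractf[symmetric]
    by (intro sum.cong refl) (simp add: curvature_def algebra_simps)
  also have "\<dots> = curv x a v $ k"
    unfolding curv_def vector_add_component vector_minus_component d\<Gamma>_partial[OF x] \<Gamma>_\<Gamma>_sum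
    by (subst swap[of "\<lambda>i j m. v $ j * partial j (christoffel h k i m) x * a $ i * v $ m"],
        subst swap[of "\<lambda>i j m. (\<Sum>b\<in>UNIV. christoffel h k j b x * christoffel h b i m x) * v $ j * a $ i * v $ m"]) (rule refl)
  finally show ?thesis .
qed

lemma christoffel_commute:
  assumes x: "x \<in> S"
  shows "christoffel h k i j x = christoffel h k j i x"
proof -
  have e: "\<Gamma> x (axis i 1) (axis j 1) $ k = christoffel h k i j x" for i j
  proof -
    have "christoffel h k l m x * axis i 1 $ l * axis j 1 $ m
        = (if m = j then if l = i then christoffel h k l m x else 0 else 0)" for l m
      by (simp add: axis_def)
    then show ?thesis by (simp add: bil_def)
  qed
  show ?thesis using arg_cong[OF \<Gamma>_commute[OF x, of "axis i 1" "axis j 1"], of "\<lambda>y. y $ k"] by (simp only: e)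
qed

lemma d\<Gamma>_commute:
  assumes x: "x \<in> S"
  shows "d\<Gamma> x a u w = d\<Gamma> x a w u"
proof -
  have "fd (christoffel h k i j) x a = fd (christoffel h k j i) x a" for k i j
    using frechet_derivative_transform_within_open[OF christoffel_diff[OF x] S x christoffel_commute]
    by metis
  then have "d\<Gamma> x a u w $ k = (\<Sum>i\<in>UNIV. \<Sum>j\<in>UNIV. fd (christoffel h k j i) x a * u $ i * w $ j)" for k
    by (simp add: dbil_def bil_def)
  also have "(\<Sum>i\<in>UNIV. \<Sum>j\<in>UNIV. fd (christoffel h k j i) x a * u $ i * w $ j) = d\<Gamma> x a w u $ k" for k
    by (subst sum.swap) (simp add: dbil_def bil_def mult_ac)
  finally show ?thesis by (simp add: vec_eq_iff)
qed

end

section \<open>Force fields in a chart\<close>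

locale force_chart = metric_chart +
  fixes F :: "'a ext_field"
  assumes F_smooth: "smooth_on (S \<times> UNIV) (\<lambda>(x, v). F x v)"
begin

abbreviation Fz :: "(real ^ 'a) \<times> (real ^ 'a) \<Rightarrow> real ^ 'a" where
  "Fz z \<equiv> F (fst z) (snd z)"

lemma S_UNIV: "open (S \<times> (UNIV :: (real ^ 'a) set))"
  by (simp add: S open_Times)

lemma Fz_C: "C_on k (S \<times> UNIV) (\<lambda>z. Fz z)"
  using F_smooth by (simp add: smooth_on_def case_prod_beta')

lemma Fz_diff: "x \<in> S \<Longrightarrow> (\<lambda>z. Fz z) differentiable (at (x, v))"
  using C_on_differentiable[OF Fz_C] by simp

lemma Fz_linear: "x \<in> S \<Longrightarrow> linear (fd (\<lambda>z. Fz z) (x, v))"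
  by (rule fd_linear[OF Fz_diff])

text \<open>\<open>velD x v b\<close> and \<open>covD x v a\<close> are $\sum_m b^m \tilde\nabla_m F$ and $\sum_m a^m \nabla_m F$.\<close>

definition velD :: "real ^ 'a \<Rightarrow> real ^ 'a \<Rightarrow> real ^ 'a \<Rightarrow> real ^ 'a" where
  "velD x v b = fd (\<lambda>z. Fz z) (x, v) (0, b)"

definition covD :: "real ^ 'a \<Rightarrow> real ^ 'a \<Rightarrow> real ^ 'a \<Rightarrow> real ^ 'a" where
  "covD x v a = fd (\<lambda>z. Fz z) (x, v) (a, - \<Gamma> x a v) + \<Gamma> x a (F x v)"

lemma velD_scaleR: "x \<in> S \<Longrightarrow> velD x v (r *\<^sub>R b) = r *\<^sub>R velD x v b"
  using linear_cmul[OF Fz_linear, of x v r "(0, b)"] by (simp add: velD_def)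

lemma velD_zero [simp]: "x \<in> S \<Longrightarrow> velD x v 0 = 0"
  using velD_scaleR[of x v 0 0] by simp

lemma velD_add: "x \<in> S \<Longrightarrow> velD x v (b + b') = velD x v b + velD x v b'"
  using linear_add[OF Fz_linear, of x v "(0, b)" "(0, b')"] by (simp add: velD_def)

lemma covD_scaleR: "x \<in> S \<Longrightarrow> covD x v (r *\<^sub>R a) = r *\<^sub>R covD x v a"
  using linear_cmul[OF Fz_linear, of x v r "(a, - \<Gamma> x a v)"]
  by (simp add: covD_def bil_scaleR scaleR_add_right)

lemma covD_add: "x \<in> S \<Longrightarrow> covD x v (a + a') = covD x v a + covD x v a'"
  using linear_add[OF Fz_linear, of x v "(a, - \<Gamma> x a v)" "(a', - \<Gamma> x a' v)"]
  by (simp add: covD_def bil_add)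

lemma covD_zero [simp]: "x \<in> S \<Longrightarrow> covD x v 0 = 0"
  using covD_scaleR[of x v 0 0] by simp

lemma F_velocity_derivative:
  assumes x: "x \<in> S"
  shows "(F x has_derivative velD x v) (at v)"
proof -
  have "((\<lambda>w. (x, w)) has_derivative (\<lambda>b. (0, b))) (at v)"
    by (auto intro!: derivative_eq_intros)
  from has_derivative_compose[OF this fd_has_derivative[OF Fz_diff[OF x]]] show ?thesis
    by (simp add: velD_def[abs_def])
qed

text \<open>The acceleration \<open>v'\<close> in coordinates: the trajectories are the solutions of \<open>x' = v\<close>, \<open>v' = spray (x, v)\<close>.\<close>

definition spray :: "(real ^ 'a) \<times> (real ^ 'a) \<Rightarrow> real ^ 'a" where
  "spray z = Fz z - \<Gamma> (fst z) (snd z) (snd z)"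

lemma spray_C: "C_on k (S \<times> UNIV) spray"
proof -
  have "C_on k (S \<times> UNIV) (\<lambda>z::(real^'a)\<times>(real^'a). \<Sum>i\<in>UNIV. \<Sum>j\<in>UNIV.
      christoffel h l i j (fst z) * snd z $ i * snd z $ j)" for l
    by (intro C_on_sum C_on_mult S_UNIV C_on_nth C_on_bounded_linear bounded_linear_snd
        C_on_compose_linear[OF bounded_linear_fst christoffel_C S_UNIV]) auto
  then have "C_on k (S \<times> UNIV) (\<lambda>z::(real^'a)\<times>(real^'a). \<Gamma> (fst z) (snd z) (snd z))"
    by (intro C_on_vec S_UNIV) (simp add: bil_def)
  from C_on_diff[OF Fz_C this S_UNIV] show ?thesis
    unfolding spray_def[abs_def] .
qed

lemma fd_spray:
  assumes x: "x \<in> S"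
  shows "fd spray (x, v) (a, b) = fd (\<lambda>z. Fz z) (x, v) (a, b) - (d\<Gamma> x a v v + \<Gamma> x b v + \<Gamma> x v b)"
proof -
  define p where "p = (\<lambda>s::real. x + s *\<^sub>R a)"
  define q where "q = (\<lambda>s::real. v + s *\<^sub>R b)"
  have p: "(p has_vector_derivative a) (at 0)" and q: "(q has_vector_derivative b) (at 0)"
    unfolding p_def q_def by (auto intro!: derivative_eq_intros simp: has_vector_derivative_def)
  have p0: "p 0 = x" and q0: "q 0 = v" by (simp_all add: p_def q_def)
  have pq: "((\<lambda>s. (p s, q s)) has_vector_derivative (a, b)) (at 0)"
    by (rule has_vector_derivative_Pair[OF p q])
  have "spray differentiable (at (p 0, q 0))"
    unfolding p0 q0 using C_on_differentiable[OF spray_C] x by simp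
  from fd_along_curve[of spray "\<lambda>s. (p s, q s)", OF this pq]
  have 1: "((\<lambda>s. spray (p s, q s)) has_vector_derivative fd spray (x, v) (a, b)) (at 0)"
    by (simp add: p0 q0)
  have "(\<lambda>z. Fz z) differentiable (at (p 0, q 0))"
    unfolding p0 q0 by (rule Fz_diff[OF x])
  from fd_along_curve[of "\<lambda>z. Fz z" "\<lambda>s. (p s, q s)", OF this pq]
  have 2: "((\<lambda>s. F (p s) (q s)) has_vector_derivative fd (\<lambda>z. Fz z) (x, v) (a, b)) (at 0)"
    by (simp add: p0 q0)
  have "x \<in> S \<Longrightarrow> christoffel h k i j differentiable (at (p 0))" for k i j
    unfolding p0 by (rule christoffel_diff)
  from bil_along_curve[of "christoffel h" p, OF this[OF x] p q q]
  have 3: "((\<lambda>s. \<Gamma> (p s) (q s) (q s)) has_vector_derivative d\<Gamma> x a v v + \<Gamma> x b v + \<Gamma> x v b) (at 0)"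
    by (simp add: p0 q0)
  show ?thesis
    using has_vector_derivative_diff[OF 2 3] 1 vector_derivative_unique_at
    unfolding spray_def by fastforce
qed

text \<open>The right-hand side of the equation for vectors of variation, with \<open>d\<close> for $\nabla_t\tau$.\<close>

definition variation_rhs :: "real ^ 'a \<Rightarrow> real ^ 'a \<Rightarrow> real ^ 'a \<Rightarrow> real ^ 'a \<Rightarrow> real ^ 'a" where
  "variation_rhs x v a d = - curv x a v + velD x v d + covD x v a"

text \<open>The linearization of the spray is the equation for vectors of variation, written in coordinates. With
  \<open>d = b + \<Gamma> x v a\<close> for the covariant derivative, all terms of \<open>curv\<close> cancel against those that come from
  differentiating \<open>d\<close> and from the Christoffel symbols inside \<open>covD\<close>.\<close>

lemma fd_spray_covariant:
  assumes x: "x \<in> S"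
  shows "fd spray (x, v) (a, b) + (d\<Gamma> x v v a + \<Gamma> x (spray (x, v)) a + \<Gamma> x v b)
    = variation_rhs x v a (b + \<Gamma> x v a) - \<Gamma> x v (b + \<Gamma> x v a)"
proof -
  have "velD x v (b + \<Gamma> x v a) + covD x v a = fd (\<lambda>z. Fz z) (x, v) (a, b) + \<Gamma> x a (F x v)"
    using linear_add[OF Fz_linear[OF x], of v "(0, b + \<Gamma> x v a)" "(a, - \<Gamma> x a v)"]
    by (simp add: velD_def covD_def \<Gamma>_commute[OF x, of v a])
  then show ?thesis
    unfolding fd_spray[OF x] variation_rhs_def curv_def spray_def
    by (simp add: bil_diff bil_add \<Gamma>_commute[OF x, of _ a] \<Gamma>_commute[OF x, of b v]
        d\<Gamma>_commute[OF x, of v v a] algebra_simps)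
qed

lemma linearized_imp_covariant:
  assumes xt: "x t \<in> S" and x: "(x has_vector_derivative v t) (at t)"
    and v: "(v has_vector_derivative spray (x t, v t)) (at t)"
    and \<tau>: "(\<tau> has_vector_derivative \<omega> t) (at t)"
    and \<omega>: "(\<omega> has_vector_derivative fd spray (x t, v t) (\<tau> t, \<omega> t)) (at t)"
    and D: "D = (\<lambda>s. \<omega> s + \<Gamma> (x s) (v s) (\<tau> s))"
  shows "(D has_vector_derivative
    variation_rhs (x t) (v t) (\<tau> t) (D t) - \<Gamma> (x t) (v t) (D t)) (at t)"
  unfolding D fd_spray_covariant[OF xt, symmetric]
  by (rule has_vector_derivative_add[OF \<omega> bil_along_curve[of "christoffel h", OF christoffel_diff[OF xt] x v \<tau>]])

text \<open>Along a trajectory the covariant derivative of the force is \<open>\<nabla>\<^sub>v F\<close> plus the velocity derivative of \<open>F\<close> in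
  the direction \<open>F\<close>.\<close>

lemma F_along_curve:
  assumes xt: "x t \<in> S" and x: "(x has_vector_derivative v t) (at t)"
    and v: "(v has_vector_derivative F (x t) (v t) - \<Gamma> (x t) (v t) (v t)) (at t)"
  shows "((\<lambda>s. F (x s) (v s)) has_vector_derivative
    (covD (x t) (v t) (v t) + velD (x t) (v t) (F (x t) (v t))) - \<Gamma> (x t) (v t) (F (x t) (v t))) (at t)"
proof -
  have "((\<lambda>s. F (x s) (v s)) has_vector_derivative
    fd (\<lambda>z. Fz z) (x t, v t) (v t, F (x t) (v t) - \<Gamma> (x t) (v t) (v t))) (at t)"
    using fd_along_curve[of "\<lambda>z. Fz z" "\<lambda>s. (x s, v s)", OF Fz_diff[OF xt] has_vector_derivative_Pair[OF x v]]
    by simp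
  moreover have "fd (\<lambda>z. Fz z) (x t, v t) (v t, F (x t) (v t) - \<Gamma> (x t) (v t) (v t))
      = (covD (x t) (v t) (v t) + velD (x t) (v t) (F (x t) (v t))) - \<Gamma> (x t) (v t) (F (x t) (v t))"
    using linear_add[OF Fz_linear[OF xt], of "v t" "(v t, - \<Gamma> (x t) (v t) (v t))" "(0, F (x t) (v t))"]
    by (simp add: velD_def covD_def)
  ultimately show ?thesis by simp
qed

text \<open>The coefficients of the second derivative of \<open>(v | \<tau>)\<close>: \<open>\<xi>\<close> acts on $\nabla_t\tau$ and \<open>\<eta>\<close> on $\tau$.\<close>

definition \<xi> :: "real ^ 'a \<Rightarrow> real ^ 'a \<Rightarrow> real ^ 'a \<Rightarrow> real" where
  "\<xi> x v w = 2 * gram (h x) (F x v) w + gram (h x) v (velD x v w)"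

definition \<eta> :: "real ^ 'a \<Rightarrow> real ^ 'a \<Rightarrow> real ^ 'a \<Rightarrow> real" where
  "\<eta> x v a = gram (h x) (covD x v v + velD x v (F x v)) a + gram (h x) v (covD x v a)"

lemma deviation_derivative:
  assumes xt: "x t \<in> S" and x: "(x has_vector_derivative v t) (at t)"
    and v: "(v has_vector_derivative F (x t) (v t) - \<Gamma> (x t) (v t) (v t)) (at t)"
    and \<tau>: "(\<tau> has_vector_derivative D t - \<Gamma> (x t) (v t) (\<tau> t)) (at t)"
  shows "((\<lambda>s. gram (h (x s)) (v s) (\<tau> s)) has_real_derivative
    gram (h (x t)) (F (x t) (v t)) (\<tau> t) + gram (h (x t)) (v t) (D t)) (at t)"
  by (rule gram_covariant_along_curve[OF xt x v \<tau>])

text \<open>The curvature term of \<open>variation_rhs\<close> is orthogonal to \<open>v\<close> and drops out.\<close>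

lemma deviation_second_derivative:
  assumes xt: "x t \<in> S" and x: "(x has_vector_derivative v t) (at t)"
    and v: "(v has_vector_derivative F (x t) (v t) - \<Gamma> (x t) (v t) (v t)) (at t)"
    and \<tau>: "(\<tau> has_vector_derivative D t - \<Gamma> (x t) (v t) (\<tau> t)) (at t)"
    and D: "(D has_vector_derivative
      variation_rhs (x t) (v t) (\<tau> t) (D t) - \<Gamma> (x t) (v t) (D t)) (at t)"
  shows "((\<lambda>s. gram (h (x s)) (F (x s) (v s)) (\<tau> s) + gram (h (x s)) (v s) (D s)) has_real_derivative
    \<xi> (x t) (v t) (D t) + \<eta> (x t) (v t) (\<tau> t)) (at t)"
proof -
  note 1 = gram_covariant_along_curve[OF xt x F_along_curve[OF xt x v] \<tau>]
  note 2 = gram_covariant_along_curve[OF xt x v D]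
  show ?thesis
    using DERIV_add[OF 1 2] curv_orthogonal[OF xt]
    by (simp add: \<xi>_def \<eta>_def variation_rhs_def algebra_simps)
qed

section \<open>The normality equations at a point\<close>

text \<open>The normality equations, contracted with an arbitrary vector \<open>u\<close> orthogonal to \<open>v\<close>. The second one is
  \<open>\<eta> u = \<alpha> (F | u)\<close> with \<open>\<alpha> = \<xi> v / |v|\<^sup>2\<close>, cleared of its denominator.\<close>

definition normal_at :: "real ^ 'a \<Rightarrow> real ^ 'a \<Rightarrow> bool" where
  "normal_at x v \<longleftrightarrow> (\<forall>u. gram (h x) v u = 0 \<longrightarrow>
     \<xi> x v u = 0 \<and> \<eta> x v u * gram (h x) v v = gram (h x) (F x v) u * \<xi> x v v)"

lemma \<xi>_scaleR: "x \<in> S \<Longrightarrow> \<xi> x v (r *\<^sub>R w) = r * \<xi> x v w"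
  by (simp add: \<xi>_def velD_scaleR algebra_simps)

lemma \<xi>_add: "x \<in> S \<Longrightarrow> \<xi> x v (w + w') = \<xi> x v w + \<xi> x v w'"
  by (simp add: \<xi>_def velD_add algebra_simps)

lemma \<eta>_scaleR: "x \<in> S \<Longrightarrow> \<eta> x v (r *\<^sub>R w) = r * \<eta> x v w"
  by (simp add: \<eta>_def covD_scaleR algebra_simps)

lemma \<eta>_add: "x \<in> S \<Longrightarrow> \<eta> x v (w + w') = \<eta> x v w + \<eta> x v w'"
  by (simp add: \<eta>_def covD_add algebra_simps)

text \<open>Initial data for which the function of deviation and its first derivative vanish suffice: \<open>(0, u)\<close> gives the
  first equation, and \<open>(u, r v)\<close> with the \<open>r\<close> that cancels \<open>(F | u)\<close> gives the second.\<close>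

lemma normal_atI:
  assumes x: "x \<in> S" and v: "v \<noteq> 0"
    and 0: "\<And>u w. gram (h x) v u = 0 \<Longrightarrow> gram (h x) (F x v) u + gram (h x) v w = 0 \<Longrightarrow>
      \<xi> x v w + \<eta> x v u = 0"
  shows "normal_at x v"
  unfolding normal_at_def
proof (intro allI impI conjI)
  fix u assume u: "gram (h x) v u = 0"
  have vv: "gram (h x) v v > 0" using gram_pos[OF x v] .
  have "\<eta> x v 0 = 0" using \<eta>_scaleR[OF x, of v 0 0] by simp
  then show "\<xi> x v u = 0" using 0[of 0 u] u by simp
  define r where "r = - gram (h x) (F x v) u / gram (h x) v v"
  have "gram (h x) (F x v) u + gram (h x) v (r *\<^sub>R v) = 0"
    using vv by (simp add: r_def)
  from 0[OF u this] have "\<eta> x v u = - r * \<xi> x v v" by (simp add: \<xi>_scaleR[OF x])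
  then show "\<eta> x v u * gram (h x) v v = gram (h x) (F x v) u * \<xi> x v v"
    using vv by (simp add: r_def)
qed

text \<open>Split vectors into their parts parallel and orthogonal to \<open>v\<close>; \<open>\<alpha>\<close> and \<open>\<beta>\<close> are then read off at \<open>v\<close>
  itself.\<close>

lemma normal_at_coefficients:
  assumes x: "x \<in> S" and v: "v \<noteq> 0" and n: "normal_at x v"
  shows "\<exists>\<alpha> \<beta>. \<forall>u w. \<xi> x v w + \<eta> x v u
    = \<alpha> * (gram (h x) (F x v) u + gram (h x) v w) + \<beta> * gram (h x) v u"
proof -
  define s where "s = gram (h x) v v"
  have s: "s > 0" using gram_pos[OF x v] by (simp add: s_def)
  define \<alpha> where "\<alpha> = \<xi> x v v / s"
  define \<beta> where "\<beta> = (\<eta> x v v - \<alpha> * gram (h x) (F x v) v) / s"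
  have split: "\<exists>r u'. u = r *\<^sub>R v + u' \<and> gram (h x) v u' = 0 \<and> r = gram (h x) v u / s" for u
    using s by (intro exI[of _ "gram (h x) v u / s"] exI[of _ "u - (gram (h x) v u / s) *\<^sub>R v"])
       (simp add: s_def)
  have "\<xi> x v w = \<alpha> * gram (h x) v w" for w
  proof -
    obtain r w' where w: "w = r *\<^sub>R v + w'" "gram (h x) v w' = 0" "r = gram (h x) v w / s"
      using split[of w] by blast
    have "\<xi> x v w = r * \<xi> x v v"
      using n w(2) unfolding w(1) normal_at_def by (simp add: \<xi>_add[OF x] \<xi>_scaleR[OF x])
    then show ?thesis using s by (simp add: w(3) \<alpha>_def)
  qed
  moreover have "\<eta> x v u = \<alpha> * gram (h x) (F x v) u + \<beta> * gram (h x) v u" for u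
  proof -
    obtain r u' where u: "u = r *\<^sub>R v + u'" "gram (h x) v u' = 0" "r = gram (h x) v u / s"
      using split[of u] by blast
    have "\<eta> x v u' * s = gram (h x) (F x v) u' * \<xi> x v v"
      using n u(2) unfolding normal_at_def s_def by blast
    then have u': "\<eta> x v u' = \<alpha> * gram (h x) (F x v) u'"
      using s by (simp add: \<alpha>_def field_simps)
    have "\<beta> * gram (h x) v u = r * (\<eta> x v v - \<alpha> * gram (h x) (F x v) v)"
      by (simp add: u(3) \<beta>_def)
    moreover have "\<eta> x v u = r * \<eta> x v v + \<alpha> * gram (h x) (F x v) u'"
      unfolding u(1) by (simp add: \<eta>_add[OF x] \<eta>_scaleR[OF x] u')
    moreover have "gram (h x) (F x v) u = r * gram (h x) (F x v) v + gram (h x) (F x v) u'"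
      unfolding u(1) by simp
    ultimately show ?thesis by (simp add: algebra_simps)
  qed
  ultimately have "\<xi> x v w + \<eta> x v u
      = \<alpha> * (gram (h x) (F x v) u + gram (h x) v w) + \<beta> * gram (h x) v u" for u w
    by (simp add: algebra_simps)
  then show ?thesis by blast
qed

text \<open>In the span of two basis vectors the form \<open>u \<mapsto> (u | w)\<close> has a kernel.\<close>

lemma orthogonal_vector_exists:
  assumes x: "x \<in> S" and n: "CARD('a) \<ge> 2"
  shows "\<exists>u. u \<noteq> 0 \<and> gram (h x) u w = 0"
proof -
  obtain i j :: 'a where ij: "i \<noteq> j"
    using n by (metis card_2_iff' ex_card subset_UNIV)
  define u where "u = gram (h x) (axis j 1) w *\<^sub>R axis i 1 - gram (h x) (axis i 1) w *\<^sub>R (axis j 1 :: real ^ 'a)"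
  show ?thesis
  proof (cases "u = 0")
    case False
    then show ?thesis by (intro exI[of _ u]) (simp add: u_def)
  next
    case True
    have "u $ j = - gram (h x) (axis i 1) w" using ij by (simp add: u_def axis_def)
    then show ?thesis using True by (intro exI[of _ "axis i 1"]) simp
  qed
qed

text \<open>Along a ray \<open>v = \<epsilon> u\<close> the first equation says \<open>2 (F | w) + \<epsilon> (u | \<dots>) = 0\<close> for \<open>w \<bottom> u\<close>.\<close>

lemma force_vanishes_at_rest:
  assumes x: "x \<in> S" and n: "CARD('a) \<ge> 2" and norm: "\<And>v. v \<noteq> 0 \<Longrightarrow> normal_at x v"
  shows "F x 0 = 0"
proof (rule gram_nondegenerate[OF x])
  fix w
  obtain u where u: "u \<noteq> 0" "gram (h x) u w = 0" using orthogonal_vector_exists[OF x n] by blast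
  have line: "((\<lambda>e::real. (x, e *\<^sub>R u)) \<longlongrightarrow> (x, 0)) (at_right 0)"
    by (auto intro!: tendsto_eq_intros)
  have lim: "((\<lambda>e. G (x, e *\<^sub>R u)) \<longlongrightarrow> G (x, 0)) (at_right 0)"
    if G: "C_on 0 (S \<times> UNIV) G" for G :: "_ \<Rightarrow> real ^ 'a"
  proof -
    have "isCont G (x, 0)"
      using C_on_continuous[OF G] S_UNIV x continuous_on_eq_continuous_at by blast
    then show ?thesis using line isCont_tendsto_compose by blast
  qed
  have l1: "((\<lambda>e. gram (h x) (F x (e *\<^sub>R u)) w) \<longlongrightarrow> gram (h x) (F x 0) w) (at_right 0)"
    unfolding gram_def using lim[OF Fz_C] by (auto intro!: tendsto_eq_intros)
  have l2: "((\<lambda>e. gram (h x) u (velD x (e *\<^sub>R u) w)) \<longlongrightarrow> gram (h x) u (velD x 0 w)) (at_right 0)"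
    unfolding velD_def
    by (rule bounded_linear.tendsto[OF bounded_bilinear.bounded_linear_right[OF bounded_bilinear_gram]
          lim[OF C_on_fd[OF Fz_C]]])
  have "((\<lambda>e. 2 * gram (h x) (F x (e *\<^sub>R u)) w + e * gram (h x) u (velD x (e *\<^sub>R u) w))
      \<longlongrightarrow> 2 * gram (h x) (F x 0) w + 0 * gram (h x) u (velD x 0 w)) (at_right 0)"
    by (intro tendsto_add tendsto_mult l1 l2 tendsto_const tendsto_ident_at)
  moreover have "eventually (\<lambda>e. 2 * gram (h x) (F x (e *\<^sub>R u)) w + e * gram (h x) u (velD x (e *\<^sub>R u) w) = 0) (at_right 0)"
    unfolding eventually_at_right_field
  proof (intro exI[of _ 1] conjI allI impI)
    fix e :: real assume "0 < e"
    then have "\<xi> x (e *\<^sub>R u) w = 0"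
      using norm[of "e *\<^sub>R u"] u unfolding normal_at_def by simp
    then show "2 * gram (h x) (F x (e *\<^sub>R u)) w + e * gram (h x) u (velD x (e *\<^sub>R u) w) = 0"
      by (simp add: \<xi>_def)
  qed simp
  ultimately have "((\<lambda>e::real. 0::real) \<longlongrightarrow> 2 * gram (h x) (F x 0) w) (at_right 0)"
    using tendsto_cong by fastforce
  from tendsto_unique[OF _ this tendsto_const] show "gram (h x) (F x 0) w = 0" by simp
qed

lemma normality_coefficients:
  assumes x: "x \<in> S" and n: "CARD('a) \<ge> 2" and norm: "\<And>v. v \<noteq> 0 \<Longrightarrow> normal_at x v"
  shows "\<exists>\<alpha> \<beta>. \<forall>u w. \<xi> x v w + \<eta> x v u
    = \<alpha> * (gram (h x) (F x v) u + gram (h x) v w) + \<beta> * gram (h x) v u"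
proof (cases "v = 0")
  case False
  then show ?thesis using normal_at_coefficients[OF x False norm] by blast
next
  case True
  have "\<xi> x 0 w + \<eta> x 0 u = 0" for u w
    using force_vanishes_at_rest[OF x n norm] by (simp add: \<xi>_def \<eta>_def x)
  then show ?thesis unfolding True by (intro exI[of _ 0]) simp
qed

lemma vel_grad_sum:
  assumes "(f x has_derivative f') (at v)"
  shows "(\<Sum>m\<in>UNIV. b $ m * vel_grad m f x v) = f' b"
proof -
  have "f x differentiable (at v)" using assms unfolding differentiable_def by blast
  from fd_sum_partial[OF this, of b] fd_eq[OF assms] show ?thesis by (simp add: vel_grad_def)
qed

text \<open>Spatial differentiation in the direction \<open>a\<close> is ordinary differentiation on the tangent bundle along the
  horizontal lift \<open>(a, - \<Gamma> x a v)\<close>.\<close>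

lemma spat_deriv_sum:
  assumes f: "((\<lambda>z. f (fst z) (snd z)) has_derivative f') (at (x, v))"
  shows "(\<Sum>m\<in>UNIV. a $ m * spat_deriv h m f x v) = f' (a, - \<Gamma> x a v)"
proof -
  have l: "linear f'" by (rule has_derivative_linear[OF f])
  have "((\<lambda>y. (y, v)) has_derivative (\<lambda>a. (a, 0))) (at x)"
    by (auto intro!: derivative_eq_intros)
  from has_derivative_compose[OF this f] have pos: "((\<lambda>y. f y v) has_derivative (\<lambda>a. f' (a, 0))) (at x)"
    by simp
  have "((\<lambda>w. (x, w)) has_derivative (\<lambda>b. (0, b))) (at v)"
    by (auto intro!: derivative_eq_intros)
  from has_derivative_compose[OF this f] have vel: "(f x has_derivative (\<lambda>b. f' (0, b))) (at v)"
    by simp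
  have "(\<lambda>y. f y v) differentiable (at x)" using pos unfolding differentiable_def by blast
  then have 1: "(\<Sum>m\<in>UNIV. a $ m * partial m (\<lambda>y. f y v) x) = f' (a, 0)"
    using fd_sum_partial[of "\<lambda>y. f y v" x a] fd_eq[OF pos] by simp
  have "(\<Sum>m\<in>UNIV. a $ m * (\<Sum>i\<in>UNIV. \<Sum>b\<in>UNIV. v $ i * christoffel h b m i x * vel_grad b f x v))
      = (\<Sum>m\<in>UNIV. \<Sum>i\<in>UNIV. \<Sum>b\<in>UNIV. christoffel h b m i x * a $ m * v $ i * vel_grad b f x v)"
    by (simp add: sum_distrib_left mult_ac)
  also have "\<dots> = (\<Sum>b\<in>UNIV. \<Sum>m\<in>UNIV. \<Sum>i\<in>UNIV. christoffel h b m i x * a $ m * v $ i * vel_grad b f x v)"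
    by (rule sum_rotate)
  also have "\<dots> = (\<Sum>b\<in>UNIV. \<Gamma> x a v $ b * vel_grad b f x v)"
    by (simp add: bil_def sum_distrib_right)
  also have "\<dots> = f' (0, \<Gamma> x a v)" by (rule vel_grad_sum[of f, OF vel])
  finally have 2: "(\<Sum>m\<in>UNIV. a $ m * (\<Sum>i\<in>UNIV. \<Sum>b\<in>UNIV. v $ i * christoffel h b m i x * vel_grad b f x v))
      = f' (0, \<Gamma> x a v)" .
  show ?thesis
    unfolding spat_deriv_def right_diff_distrib sum_subtractf 1 2
    using linear_diff[OF l, of "(a, 0)" "(0, \<Gamma> x a v)"] by simp
qed

lemma vel_grad_F_sum:
  assumes x: "x \<in> S"
  shows "(\<Sum>m\<in>UNIV. b $ m * vel_grad m (\<lambda>y w. F y w $ k) x v) = velD x v b $ k"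
  by (rule vel_grad_sum[where f="\<lambda>y w. F y w $ k",
        OF bounded_linear.has_derivative[OF bounded_linear_vec_nth F_velocity_derivative[OF x]]])

lemma spat_grad_vec_sum:
  assumes x: "x \<in> S"
  shows "(\<Sum>m\<in>UNIV. a $ m * spat_grad_vec h m F k x v) = covD x v a $ k"
proof -
  have "(\<Sum>m\<in>UNIV. a $ m * spat_deriv h m (\<lambda>y w. F y w $ k) x v) = fd (\<lambda>z. Fz z) (x, v) (a, - \<Gamma> x a v) $ k"
    by (rule spat_deriv_sum[OF bounded_linear.has_derivative[OF bounded_linear_vec_nth fd_has_derivative[OF Fz_diff[OF x]]]])
  then show ?thesis
    by (simp add: spat_grad_vec_def covD_def distrib_left sum.distrib bil_def sum_distrib_left mult_ac)
qed

lemma variation_rhs_components: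
  assumes x: "x \<in> S"
  shows "- (\<Sum>m\<in>UNIV. \<Sum>i\<in>UNIV. \<Sum>j\<in>UNIV. curvature h k m i j x * a $ i * v $ j * v $ m)
     + (\<Sum>m\<in>UNIV. d $ m * vel_grad m (\<lambda>y w. F y w $ k) x v)
     + (\<Sum>m\<in>UNIV. a $ m * spat_grad_vec h m F k x v) = variation_rhs x v a d $ k"
  by (simp add: curvature_sum[OF x] vel_grad_F_sum[OF x] spat_grad_vec_sum[OF x] variation_rhs_def)

lemma gram_F_derivative:
  assumes x: "x \<in> S"
  shows "((\<lambda>z. gram (h (fst z)) b (F (fst z) (snd z))) has_derivative
    (\<lambda>c. gram (fd h x (fst c)) b (F x v) + gram (h x) b (fd (\<lambda>z. Fz z) (x, v) c))) (at (x, v))"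
proof -
  have "(h has_derivative fd h x) (at (fst (x, v)))"
    using fd_has_derivative[OF h_diff[OF x]] by simp
  from has_derivative_compose[OF has_derivative_fst[OF has_derivative_ident] this]
  have h': "((\<lambda>z. h (fst z)) has_derivative (\<lambda>c. fd h x (fst c))) (at (x, v))" by simp
  have "bounded_bilinear (\<lambda>(G :: real ^ 'a ^ 'a) w. gram G b w)"
    unfolding bilinear_conv_bounded_bilinear[symmetric] bilinear_def by (auto intro!: linearI)
  from bounded_bilinear.FDERIV[OF this h' fd_has_derivative[OF Fz_diff[OF x]]]
  show ?thesis by (simp add: add.commute)
qed

text \<open>Lowering an index commutes with the spatial gradient, because the metric is covariantly constant.\<close>

lemma spat_grad_covec_sum:
  assumes x: "x \<in> S"
  shows "(\<Sum>i\<in>UNIV. \<Sum>j\<in>UNIV. a $ i * b $ j * spat_grad_covec h i (lower h F) j x v) = gram (h x) b (covD x v a)"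
proof -
  define f where "f = fd (\<lambda>z. Fz z) (x, v) (a, - \<Gamma> x a v)"
  have 1: "(\<Sum>i\<in>UNIV. a $ i * spat_deriv h i (\<lambda>y w. lower h F y w $ j) x v)
      = gram (fd h x a) (axis j 1) (F x v) + gram (h x) (axis j 1) f" for j
    using spat_deriv_sum[of "\<lambda>y w. lower h F y w $ j", OF gram_F_derivative[OF x, of "axis j 1" v, folded lower_gram], of a]
    unfolding lower_gram by (simp add: f_def)
  have "(\<Sum>i\<in>UNIV. \<Sum>j\<in>UNIV. a $ i * b $ j * spat_deriv h i (\<lambda>y w. lower h F y w $ j) x v)
      = (\<Sum>j\<in>UNIV. b $ j * (\<Sum>i\<in>UNIV. a $ i * spat_deriv h i (\<lambda>y w. lower h F y w $ j) x v))"
    by (subst sum.swap) (simp add: sum_distrib_left mult_ac)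
  also have "\<dots> = gram (fd h x a) b (F x v) + gram (h x) b f"
    unfolding 1 by (simp add: distrib_left sum.distrib sum_gram_axis)
  finally have 2: "(\<Sum>i\<in>UNIV. \<Sum>j\<in>UNIV. a $ i * b $ j * spat_deriv h i (\<lambda>y w. lower h F y w $ j) x v)
      = gram (fd h x a) b (F x v) + gram (h x) b f" .
  have "(\<Sum>i\<in>UNIV. \<Sum>j\<in>UNIV. a $ i * b $ j * (\<Sum>m\<in>UNIV. christoffel h m i j x * lower h F x v $ m))
      = (\<Sum>i\<in>UNIV. \<Sum>j\<in>UNIV. \<Sum>m\<in>UNIV. christoffel h m i j x * a $ i * b $ j * lower h F x v $ m)"
    by (simp add: sum_distrib_left mult_ac)
  also have "\<dots> = (\<Sum>m\<in>UNIV. \<Sum>i\<in>UNIV. \<Sum>j\<in>UNIV. christoffel h m i j x * a $ i * b $ j * lower h F x v $ m)"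
    by (rule sum_rotate)
  also have "\<dots> = (\<Sum>m\<in>UNIV. \<Gamma> x a b $ m * lower h F x v $ m)"
    by (simp add: bil_def sum_distrib_right)
  also have "\<dots> = gram (h x) (\<Gamma> x a b) (F x v)" by (rule sum_lower)
  finally show ?thesis
    unfolding spat_grad_covec_def right_diff_distrib sum_subtractf 2
    by (simp add: fd_h[OF x] covD_def f_def)
qed

lemma vel_grad_lower_sum:
  assumes x: "x \<in> S"
  shows "(\<Sum>m\<in>UNIV. b $ m * vel_grad m (\<lambda>y w. lower h F y w $ i) x v) = gram (h x) (axis i 1) (velD x v b)"
  unfolding lower_gram
  by (rule vel_grad_sum[where f="\<lambda>y w. gram (h y) (axis i 1) (F y w)", OF bounded_linear.has_derivative[OF bounded_bilinear.bounded_linear_right[OF bounded_bilinear_gram] F_velocity_derivative[OF x]]])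

lemma speed_gram: "speed h x v = sqrt (gram (h x) v v)"
  by (simp add: speed_def scal_gram)

lemma speed_pos: "x \<in> S \<Longrightarrow> v \<noteq> 0 \<Longrightarrow> speed h x v > 0"
  by (simp add: speed_gram gram_pos)

lemma speed_square: "x \<in> S \<Longrightarrow> (speed h x v)\<^sup>2 = gram (h x) v v"
  using gram_pos[of x v] by (cases "v = 0") (auto simp: speed_gram)

lemma unit_dir_eq: "unit_dir h x v = (1 / speed h x v) *\<^sub>R v"
  by (simp add: unit_dir_def vec_eq_iff)

lemma speed_derivative:
  assumes x: "x \<in> S" and v: "v \<noteq> 0"
  shows "(speed h x has_derivative (\<lambda>u. gram (h x) v u / speed h x v)) (at v)"
proof -
  have "((\<lambda>w. gram (h x) w w) has_derivative (\<lambda>u. gram (h x) v u + gram (h x) u v)) (at v)"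
    by (rule bounded_bilinear.FDERIV[OF bounded_bilinear_gram has_derivative_ident has_derivative_ident])
  from has_derivative_real_sqrt[OF gram_pos[OF x v] this]
  have "(speed h x has_derivative (\<lambda>u. (gram (h x) v u + gram (h x) u v) * (inverse (speed h x v) / 2))) (at v)"
    by (simp add: speed_gram[abs_def])
  moreover have "(gram (h x) v u + gram (h x) u v) * (inverse (speed h x v) / 2) = gram (h x) v u / speed h x v" for u
    using gram_commute[OF x, of u v] by (simp add: field_simps)
  ultimately show ?thesis by simp
qed

text \<open>The velocity derivative in the direction \<open>u\<close> of \<open>N\<^sup>j F\<^sub>j = (v | F) / |v|\<close>.\<close>

lemma power_derivative_sum:
  assumes x: "x \<in> S" and v: "v \<noteq> 0"
  shows "(\<Sum>i\<in>UNIV. u $ i * (\<Sum>j\<in>UNIV. vel_grad i (\<lambda>y w. unit_dir h y w $ j * lower h F y w $ j) x v))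
    = (gram (h x) u (F x v) + gram (h x) v (velD x v u)) / speed h x v
      - gram (h x) v (F x v) * gram (h x) v u / speed h x v ^ 3"
proof -
  define s where "s = speed h x v"
  have s: "s > 0" using speed_pos[OF x v] by (simp add: s_def)
  have N: "((\<lambda>w. unit_dir h x w $ j) has_derivative (\<lambda>u. u $ j / s - v $ j * gram (h x) v u / s ^ 3)) (at v)" for j
  proof -
    have "((\<lambda>w. w $ j / speed h x w) has_derivative
        (\<lambda>u. (u $ j * speed h x v - v $ j * (gram (h x) v u / speed h x v)) / (speed h x v * speed h x v))) (at v)"
      using speed_pos[OF x v]
      by (intro has_derivative_divide' speed_derivative[OF x v] bounded_linear_imp_has_derivative[OF bounded_linear_vec_nth]) simp
    moreover have "(u $ j * s - v $ j * (gram (h x) v u / s)) / (s * s) = u $ j / s - v $ j * gram (h x) v u / s ^ 3" for u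
      using s by (simp add: field_simps power3_eq_cube)
    ultimately show ?thesis unfolding unit_dir_def s_def by simp
  qed
  have L: "((\<lambda>w. lower h F x w $ j) has_derivative (\<lambda>u. gram (h x) (axis j 1) (velD x v u))) (at v)" for j
    unfolding lower_gram
    by (rule bounded_linear.has_derivative[OF bounded_bilinear.bounded_linear_right[OF bounded_bilinear_gram] F_velocity_derivative[OF x]])
  have "(\<Sum>i\<in>UNIV. u $ i * (\<Sum>j\<in>UNIV. vel_grad i (\<lambda>y w. unit_dir h y w $ j * lower h F y w $ j) x v))
      = (\<Sum>j\<in>UNIV. \<Sum>i\<in>UNIV. u $ i * vel_grad i (\<lambda>y w. unit_dir h y w $ j * lower h F y w $ j) x v)"
    by (subst sum.swap) (simp add: sum_distrib_left)
  also have "\<dots> = (\<Sum>j\<in>UNIV. unit_dir h x v $ j * gram (h x) (axis j 1) (velD x v u)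
      + (u $ j / s - v $ j * gram (h x) v u / s ^ 3) * lower h F x v $ j)"
    by (intro sum.cong refl vel_grad_sum[where f="\<lambda>y w. unit_dir h y w $ _ * lower h F y w $ _"] has_derivative_mult N L)
  also have "\<dots> = (\<Sum>j\<in>UNIV. v $ j * gram (h x) (axis j 1) (velD x v u)) / s
      + (\<Sum>j\<in>UNIV. u $ j * lower h F x v $ j) / s - (\<Sum>j\<in>UNIV. v $ j * lower h F x v $ j) * gram (h x) v u / s ^ 3"
    unfolding sum_distrib_right sum_divide_distrib sum.distrib[symmetric] sum_subtractf[symmetric]
    by (intro sum.cong refl) (simp add: unit_dir_def s_def algebra_simps)
  also have "\<dots> = (gram (h x) u (F x v) + gram (h x) v (velD x v u)) / s
      - gram (h x) v (F x v) * gram (h x) v u / s ^ 3"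
    by (simp add: sum_gram_axis sum_lower add_divide_distrib)
  finally show ?thesis unfolding s_def .
qed

text \<open>A covector annihilated by the projector is one that vanishes on the orthogonal complement of \<open>v\<close>: the columns
  of the projector span this complement.\<close>

lemma projected_zero_iff:
  fixes X :: "'a \<Rightarrow> real"
  assumes x: "x \<in> S" and v: "v \<noteq> 0"
  shows "(\<forall>k. (\<Sum>i\<in>UNIV. X i * projector h i k x v) = 0) \<longleftrightarrow>
    (\<forall>u. gram (h x) v u = 0 \<longrightarrow> (\<Sum>i\<in>UNIV. u $ i * X i) = 0)"
proof -
  define s2 where "s2 = gram (h x) v v"
  have s2: "s2 > 0" using gram_pos[OF x v] by (simp add: s2_def)
  define Xv where "Xv = (\<Sum>i\<in>UNIV. v $ i * X i)"
  have P: "(\<Sum>i\<in>UNIV. X i * projector h i k x v) = X k - Xv * gram (h x) (axis k 1) v / s2" for k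
  proof -
    have proj: "projector h i k x v = (if i = k then 1 else 0) - v $ i * gram (h x) (axis k 1) v / s2" for i
      using speed_square[OF x, of v]
      by (simp add: projector_def lower_gram unit_dir_eq s2_def power2_eq_square)
    have "(\<Sum>i\<in>UNIV. X i * projector h i k x v)
        = (\<Sum>i\<in>UNIV. if i = k then X i else 0) - (\<Sum>i\<in>UNIV. v $ i * X i * gram (h x) (axis k 1) v / s2)"
      unfolding sum_subtractf[symmetric] proj by (intro sum.cong refl) (simp add: algebra_simps)
    then show ?thesis by (simp add: Xv_def sum_distrib_right sum_divide_distrib)
  qed
  show ?thesis unfolding P
  proof (intro iffI allI impI)
    fix u assume X: "\<forall>k. X k - Xv * gram (h x) (axis k 1) v / s2 = 0" and u: "gram (h x) v u = 0"
    have "(\<Sum>k\<in>UNIV. u $ k * X k) = (\<Sum>k\<in>UNIV. Xv / s2 * (u $ k * gram (h x) (axis k 1) v))"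
      using X by (intro sum.cong refl) simp
    also have "\<dots> = 0"
      unfolding sum_distrib_left[symmetric] sum_gram_axis using u gram_commute[OF x, of u v] by simp
    finally show "(\<Sum>k\<in>UNIV. u $ k * X k) = 0" .
  next
    fix k assume X: "\<forall>u. gram (h x) v u = 0 \<longrightarrow> (\<Sum>i\<in>UNIV. u $ i * X i) = 0"
    define u where "u = axis k 1 - (gram (h x) (axis k 1) v / s2) *\<^sub>R v"
    have "gram (h x) v u = 0"
      using s2 gram_commute[OF x, of v "axis k 1"] by (simp add: u_def s2_def)
    then have "(\<Sum>i\<in>UNIV. u $ i * X i) = 0" using X by blast
    moreover have "(\<Sum>i\<in>UNIV. u $ i * X i) = (\<Sum>i\<in>UNIV. if i = k then X i else 0)
        - (\<Sum>i\<in>UNIV. gram (h x) (axis k 1) v / s2 * (v $ i * X i))"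
      unfolding sum_subtractf[symmetric] by (intro sum.cong refl) (simp add: u_def axis_def algebra_simps)
    ultimately show "X k - Xv * gram (h x) (axis k 1) v / s2 = 0"
      unfolding sum_distrib_left[symmetric] Xv_def[symmetric] by (simp add: mult.commute)
  qed
qed

text \<open>Contracted with \<open>u\<close> orthogonal to \<open>v\<close>, the two covectors \<open>X\<close> and \<open>Y\<close> in the equations become
  \<open>\<xi> u / s\<close> and \<open>(s\<^sup>2 \<eta> u - (F | u) \<xi> v) / s\<^sup>3\<close>.\<close>

theorem normality_equations_iff_normal_at:
  assumes x: "x \<in> S" and v: "v \<noteq> 0"
  shows "(let s = speed h x v; N = unit_dir h; P = projector h; Fl = lower h F
       in \<forall>k.
        (\<Sum>i\<in>UNIV. (Fl x v $ i / s
            + (\<Sum>j\<in>UNIV. vel_grad i (\<lambda>y w. N y w $ j * Fl y w $ j) x v)) * P i k x v) = 0 \<and>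
        (\<Sum>i\<in>UNIV. \<Sum>j\<in>UNIV.
            (spat_grad_covec h i Fl j x v + spat_grad_covec h j Fl i x v
              - 2 / s\<^sup>2 * Fl x v $ i * Fl x v $ j) * N x v $ j * P i k x v)
        + (\<Sum>i\<in>UNIV. \<Sum>j\<in>UNIV.
            (F x v $ j * vel_grad j (\<lambda>y w. Fl y w $ i) x v / s
              - (\<Sum>r\<in>UNIV. N x v $ r * N x v $ j * vel_grad j (\<lambda>y w. Fl y w $ r) x v / s
                   * Fl x v $ i)) * P i k x v) = 0)
    \<longleftrightarrow> normal_at x v"
proof -
  define s where "s = speed h x v"
  have s: "s > 0" using speed_pos[OF x v] by (simp add: s_def)
  have s2: "gram (h x) v v = s\<^sup>2" by (simp add: s_def speed_square[OF x])
  define N where "N = unit_dir h x v"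
  define Fl where "Fl = lower h F"
  define X where "X = (\<lambda>i. Fl x v $ i / s
            + (\<Sum>j\<in>UNIV. vel_grad i (\<lambda>y w. unit_dir h y w $ j * Fl y w $ j) x v))"
  define Y where "Y = (\<lambda>i. (\<Sum>j\<in>UNIV. (spat_grad_covec h i Fl j x v + spat_grad_covec h j Fl i x v
              - 2 / s\<^sup>2 * Fl x v $ i * Fl x v $ j) * N $ j)
        + (\<Sum>j\<in>UNIV. F x v $ j * vel_grad j (\<lambda>y w. Fl y w $ i) x v / s
              - (\<Sum>r\<in>UNIV. N $ r * N $ j * vel_grad j (\<lambda>y w. Fl y w $ r) x v / s * Fl x v $ i)))"
  have Xu: "s * (\<Sum>i\<in>UNIV. u $ i * X i) = \<xi> x v u" if u: "gram (h x) v u = 0" for u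
  proof -
    have "(\<Sum>i\<in>UNIV. u $ i * X i) = (\<Sum>i\<in>UNIV. u $ i * Fl x v $ i) / s
        + (gram (h x) u (F x v) + gram (h x) v (velD x v u)) / s"
      using power_derivative_sum[OF x v, of u] u
      by (simp add: X_def Fl_def s_def distrib_left sum.distrib sum_divide_distrib)
    then show ?thesis
      using s gram_commute[OF x, of u "F x v"]
      by (simp add: Fl_def sum_lower \<xi>_def add_divide_distrib[symmetric])
  qed
  have Yu: "s ^ 3 * (\<Sum>i\<in>UNIV. u $ i * Y i) = \<eta> x v u * s\<^sup>2 - gram (h x) (F x v) u * \<xi> x v v" for u
  proof -
    define c where "c = (\<Sum>j\<in>UNIV. N $ j * Fl x v $ j)"
    have c: "c = gram (h x) v (F x v) / s"
      unfolding c_def Fl_def sum_lower by (simp add: N_def unit_dir_eq s_def)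
    define W where "W = (\<Sum>j\<in>UNIV. \<Sum>r\<in>UNIV. N $ r * (N $ j * vel_grad j (\<lambda>y w. Fl y w $ r) x v))"
    define B where "B = (\<lambda>i. \<Sum>j\<in>UNIV. F x v $ j * vel_grad j (\<lambda>y w. Fl y w $ i) x v)"
    define A1 where "A1 = (\<lambda>i. \<Sum>j\<in>UNIV. N $ j * spat_grad_covec h i Fl j x v)"
    define A2 where "A2 = (\<lambda>i. \<Sum>j\<in>UNIV. N $ j * spat_grad_covec h j Fl i x v)"
    have Yi: "Y i = A1 i + A2 i - 2 / s\<^sup>2 * Fl x v $ i * c + B i / s - Fl x v $ i * W / s" for i
      by (simp add: Y_def A1_def A2_def B_def c_def W_def sum.distrib sum_subtractf sum_distrib_left
          sum_distrib_right sum_divide_distrib algebra_simps)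
    have "(\<Sum>i\<in>UNIV. u $ i * Y i) = (\<Sum>i\<in>UNIV. u $ i * A1 i) + (\<Sum>i\<in>UNIV. u $ i * A2 i)
       - 2 / s\<^sup>2 * ((\<Sum>i\<in>UNIV. u $ i * Fl x v $ i) * c)
       + (\<Sum>i\<in>UNIV. u $ i * B i) / s - (\<Sum>i\<in>UNIV. u $ i * Fl x v $ i) * W / s"
      unfolding Yi sum_distrib_left sum_distrib_right sum_divide_distrib
        sum.distrib[symmetric] sum_subtractf[symmetric]
      by (intro sum.cong refl) (simp add: algebra_simps)
    also have "(\<Sum>i\<in>UNIV. u $ i * A1 i) = (\<Sum>i\<in>UNIV. \<Sum>j\<in>UNIV. u $ i * N $ j * spat_grad_covec h i Fl j x v)"
      by (simp add: A1_def sum_distrib_left mult.assoc)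
    also have "(\<Sum>i\<in>UNIV. u $ i * A2 i) = (\<Sum>i\<in>UNIV. \<Sum>j\<in>UNIV. u $ i * N $ j * spat_grad_covec h j Fl i x v)"
      by (simp add: A2_def sum_distrib_left mult.assoc)
    also have "(\<Sum>i\<in>UNIV. \<Sum>j\<in>UNIV. u $ i * N $ j * spat_grad_covec h i Fl j x v) = gram (h x) N (covD x v u)"
      unfolding Fl_def by (rule spat_grad_covec_sum[OF x])
    also have "(\<Sum>i\<in>UNIV. \<Sum>j\<in>UNIV. u $ i * N $ j * spat_grad_covec h j Fl i x v) = gram (h x) u (covD x v N)"
      unfolding Fl_def spat_grad_covec_sum[OF x, symmetric] by (subst sum.swap) (simp add: mult_ac)
    also have "(\<Sum>i\<in>UNIV. u $ i * B i) = gram (h x) u (velD x v (F x v))"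
      unfolding B_def Fl_def vel_grad_lower_sum[OF x] by (rule sum_gram_axis)
    also have "W = gram (h x) N (velD x v N)"
      unfolding W_def by (subst sum.swap) (simp add: sum_distrib_left[symmetric] Fl_def vel_grad_lower_sum[OF x] sum_gram_axis)
    finally have "(\<Sum>i\<in>UNIV. u $ i * Y i) = gram (h x) v (covD x v u) / s + gram (h x) u (covD x v v) / s
        - 2 * gram (h x) u (F x v) * gram (h x) v (F x v) / s ^ 3 + gram (h x) u (velD x v (F x v)) / s
        - gram (h x) u (F x v) * gram (h x) v (velD x v v) / s ^ 3"
      using s by (simp add: c Fl_def sum_lower N_def unit_dir_eq s_def[symmetric] covD_scaleR[OF x] velD_scaleR[OF x]
          power2_eq_square power3_eq_cube)
    moreover have "s ^ 3 * (a / s + b / s - 2 * p * q / s ^ 3 + d / s - p * e / s ^ 3)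
        = (a + b + d) * s\<^sup>2 - p * (2 * q + e)" for a b d p q e
      using s by (simp add: field_simps power2_eq_square power3_eq_cube)
    ultimately have "s ^ 3 * (\<Sum>i\<in>UNIV. u $ i * Y i) = (gram (h x) v (covD x v u) + gram (h x) u (covD x v v)
         + gram (h x) u (velD x v (F x v))) * s\<^sup>2
        - gram (h x) u (F x v) * (2 * gram (h x) v (F x v) + gram (h x) v (velD x v v))"
      by (simp only:)
    then show ?thesis
      using gram_commute[OF x, of u "covD x v v"] gram_commute[OF x, of u "velD x v (F x v)"]
        gram_commute[OF x, of u "F x v"] gram_commute[OF x, of v "F x v"]
      by (simp add: \<xi>_def \<eta>_def algebra_simps)
  qed
  have Ysum: "(\<Sum>i\<in>UNIV. \<Sum>j\<in>UNIV.
            (spat_grad_covec h i Fl j x v + spat_grad_covec h j Fl i x v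
              - 2 / s\<^sup>2 * Fl x v $ i * Fl x v $ j) * N $ j * projector h i k x v)
        + (\<Sum>i\<in>UNIV. \<Sum>j\<in>UNIV.
            (F x v $ j * vel_grad j (\<lambda>y w. Fl y w $ i) x v / s
              - (\<Sum>r\<in>UNIV. N $ r * N $ j * vel_grad j (\<lambda>y w. Fl y w $ r) x v / s
                   * Fl x v $ i)) * projector h i k x v) = (\<Sum>i\<in>UNIV. Y i * projector h i k x v)" for k
    unfolding Y_def distrib_right sum_distrib_right sum.distrib ..
  have "(\<forall>k. (\<Sum>i\<in>UNIV. X i * projector h i k x v) = 0 \<and> (\<Sum>i\<in>UNIV. Y i * projector h i k x v) = 0)
    \<longleftrightarrow> (\<forall>u. gram (h x) v u = 0 \<longrightarrow> (\<Sum>i\<in>UNIV. u $ i * X i) = 0) \<and>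
      (\<forall>u. gram (h x) v u = 0 \<longrightarrow> (\<Sum>i\<in>UNIV. u $ i * Y i) = 0)"
    using projected_zero_iff[OF x v, of X] projected_zero_iff[OF x v, of Y] by blast
  also have "\<dots> \<longleftrightarrow> normal_at x v"
  proof -
    have "(\<Sum>i\<in>UNIV. u $ i * X i) = 0 \<longleftrightarrow> \<xi> x v u = 0" if "gram (h x) v u = 0" for u
      unfolding Xu[OF that, symmetric] using s by simp
    moreover have "(\<Sum>i\<in>UNIV. u $ i * Y i) = 0 \<longleftrightarrow> \<eta> x v u * s\<^sup>2 = gram (h x) (F x v) u * \<xi> x v v" for u
    proof -
      have "(\<Sum>i\<in>UNIV. u $ i * Y i) = 0 \<longleftrightarrow> s ^ 3 * (\<Sum>i\<in>UNIV. u $ i * Y i) = 0" using s by simp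
      then show ?thesis unfolding Yu by simp
    qed
    ultimately show ?thesis unfolding normal_at_def s2 by blast
  qed
  finally show ?thesis
    unfolding Let_def s_def[symmetric] Fl_def[symmetric] N_def[symmetric] Ysum X_def .
qed

end

section \<open>Changes of charts\<close>

text \<open>The partial derivative in the point is a second derivative of \<open>f\<close>; in the vector the map is linear.\<close>

lemma tangent_derivative:
  fixes f :: "'a::euclidean_space \<Rightarrow> 'b::euclidean_space"
  assumes f: "C_on (Suc (Suc 0)) S f" and S: "open S" "x \<in> S"
  shows "((\<lambda>z. fd f (fst z) (snd z)) has_derivative
    (\<lambda>(a, b). fd (\<lambda>y. fd f y v) x a + fd f x b)) (at (x, v))"
proof -
  let ?K = "\<lambda>z. fd f (fst z) (snd z)"
  have K: "(?K has_derivative fd ?K (x, v)) (at (x, v))"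
    using fd_has_derivative[OF C_on_differentiable[OF C_on_tangent[OF f S(1)]], of "(x, v)"] S by simp
  have "((\<lambda>y. (y, v)) has_derivative (\<lambda>a. (a, 0))) (at x)"
    by (auto intro!: derivative_eq_intros)
  from has_derivative_compose[OF this K] have 1: "fd ?K (x, v) (a, 0) = fd (\<lambda>y. fd f y v) x a" for a
    using fd_eq by fastforce
  have "((\<lambda>w. (x, w)) has_derivative (\<lambda>b. (0, b))) (at v)"
    by (auto intro!: derivative_eq_intros)
  from has_derivative_compose[OF this K]
  have vel: "((\<lambda>w. fd f x w) has_derivative (\<lambda>b. fd ?K (x, v) (0, b))) (at v)"
    by simp
  have "bounded_linear (fd f x)"
    using fd_has_derivative[OF C_on_differentiable[OF f S(2)]] has_derivative_bounded_linear by blast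
  from has_derivative_unique[OF vel bounded_linear_imp_has_derivative[OF this]]
  have 2: "fd ?K (x, v) (0, b) = fd f x b" for b
    by (rule fun_cong)
  have "fd ?K (x, v) (a, b) = fd (\<lambda>y. fd f y v) x a + fd f x b" for a b
    using linear_add[OF has_derivative_linear[OF K], of "(a, 0)" "(0, b)"] by (simp add: 1 2)
  then have "fd ?K (x, v) = (\<lambda>(a, b). fd (\<lambda>y. fd f y v) x a + fd f x b)" by auto
  then show ?thesis using K by simp
qed

lemma fd_tangent:
  fixes f :: "'a::euclidean_space \<Rightarrow> 'b::euclidean_space"
  assumes f: "C_on (Suc (Suc 0)) S f" and S: "open S" "x \<in> S"
  shows "fd (\<lambda>z. fd f (fst z) (snd z)) (x, v) (a, b) = fd (\<lambda>y. fd f y v) x a + fd f x b"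
  using fd_eq[OF tangent_derivative[OF f S]] by simp

lemma tangent_along_curve:
  fixes f :: "'a::euclidean_space \<Rightarrow> 'b::euclidean_space"
  assumes f: "C_on (Suc (Suc 0)) S f" and S: "open S" "x t \<in> S"
    and x: "(x has_vector_derivative x') (at t)" and v: "(v has_vector_derivative v') (at t)"
  shows "((\<lambda>s. fd f (x s) (v s)) has_vector_derivative fd (\<lambda>y. fd f y (v t)) (x t) x' + fd f (x t) v') (at t)"
proof -
  have "(\<lambda>z. fd f (fst z) (snd z)) differentiable (at (x t, v t))"
    using tangent_derivative[OF f S] unfolding differentiable_def by blast
  from fd_along_curve[of _ "\<lambda>s. (x s, v s)", OF this has_vector_derivative_Pair[OF x v]]
  show ?thesis unfolding fd_tangent[OF f S] by simp
qed

locale newtonian_system =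
  fixes M :: "'a topology" and A :: "('a, 'n::finite) chart set"
    and g :: "('a, 'n) chart \<Rightarrow> 'n local_metric" and F :: "('a, 'n) chart \<Rightarrow> 'n ext_field"
  assumes riemannian: "riemannian_manifold M A g" and force: "force_field A F"
begin

lemma is_chart: "c \<in> A \<Longrightarrow> is_chart M c"
  using riemannian by (simp add: riemannian_manifold_def smooth_manifold_def)

lemma covered: "p \<in> topspace M \<Longrightarrow> \<exists>c\<in>A. p \<in> chart_dom c"
  using riemannian unfolding riemannian_manifold_def smooth_manifold_def by blast

lemma force_chart: "c \<in> A \<Longrightarrow> force_chart (chart_image c) (g c) (F c)"
  using is_chart[of c] riemannian force
  by (auto simp: riemannian_manifold_def is_chart_def force_field_def scal_gram
      intro!: force_chart.intro force_chart_axioms.intro metric_chart.intro)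

lemma chart_inj: "c \<in> A \<Longrightarrow> inj_on (chart_map c) (chart_dom c)"
  using homeomorphic_imp_injective_map[of "subtopology M (chart_dom c)"] is_chart[of c]
    openin_subset[of M "chart_dom c"]
  by (fastforce simp: is_chart_def topspace_subtopology Int_absorb1)

lemma chart_map_in: "p \<in> chart_dom c \<Longrightarrow> chart_map c p \<in> chart_image c"
  by (simp add: chart_image_def)

lemma open_image: "c \<in> A \<Longrightarrow> open (chart_image c)"
  using is_chart by (simp add: is_chart_def)

lemma open_overlap:
  assumes "c \<in> A" "d \<in> A"
  shows "open (overlap c d)"
proof -
  have "open_map (subtopology M (chart_dom c)) (top_of_set (chart_image c)) (chart_map c)"
    using is_chart[OF assms(1)] homeomorphic_imp_open_map by (auto simp: is_chart_def)
  moreover have "openin (subtopology M (chart_dom c)) (chart_dom c \<inter> chart_dom d)"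
    using is_chart[OF assms(2)] by (auto simp: is_chart_def openin_subtopology)
  ultimately have "openin (top_of_set (chart_image c)) (overlap c d)"
    by (auto simp: open_map_def overlap_def)
  then show ?thesis using openin_open_trans open_image[OF assms(1)] by blast
qed

lemma overlap_subset: "overlap c d \<subseteq> chart_image c"
  by (auto simp: overlap_def chart_image_def)

lemma overlap_self: "overlap c c = chart_image c"
  by (simp add: overlap_def chart_image_def)

lemma transition_chart_map:
  "c \<in> A \<Longrightarrow> p \<in> chart_dom c \<Longrightarrow> transition c d (chart_map c p) = chart_map d p"
  by (simp add: transition_def inv_into_f_f[OF chart_inj])

lemma transition_in_overlap:
  assumes "c \<in> A" "x \<in> overlap c d"
  shows "transition c d x \<in> overlap d c"
proof -
  obtain p where "p \<in> chart_dom c \<inter> chart_dom d" "x = chart_map c p"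
    using assms(2) unfolding overlap_def by blast
  then show ?thesis using transition_chart_map[OF assms(1), of p d] by (auto simp: overlap_def)
qed

lemma transition_self: "c \<in> A \<Longrightarrow> x \<in> chart_image c \<Longrightarrow> transition c c x = x"
  using transition_chart_map[of c _ c] by (auto simp: chart_image_def)

lemma transition_C: "c \<in> A \<Longrightarrow> d \<in> A \<Longrightarrow> C_on k (overlap c d) (transition c d)"
  using riemannian unfolding riemannian_manifold_def smooth_manifold_def smooth_on_def by blast

lemma transition_diff:
  "c \<in> A \<Longrightarrow> d \<in> A \<Longrightarrow> x \<in> overlap c d \<Longrightarrow> transition c d differentiable (at x)"
  using C_on_differentiable[OF transition_C] .

lemma linear_jacobian: "c \<in> A \<Longrightarrow> d \<in> A \<Longrightarrow> x \<in> overlap c d \<Longrightarrow> linear (jacobian c d x)"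
  unfolding jacobian_def by (rule fd_linear[OF transition_diff])

lemma jacobian_self:
  assumes c: "c \<in> A" and x: "x \<in> chart_image c"
  shows "jacobian c c x u = u"
proof -
  have "(transition c c has_derivative (\<lambda>u. u)) (at x)"
    by (rule has_derivative_transform_within_open[OF has_derivative_ident open_image[OF c] x])
       (simp add: transition_self[OF c])
  from fd_eq[OF this] show ?thesis by (simp add: jacobian_def)
qed

lemma jacobian_compose:
  assumes A: "c \<in> A" "d \<in> A" "e \<in> A" and x: "x \<in> overlap c d" "x \<in> overlap c e"
  shows "jacobian d e (transition c d x) (jacobian c d x u) = jacobian c e x u"
proof -
  have comp: "transition d e (transition c d y) = transition c e y" "transition c d y \<in> overlap d e"
    if "y \<in> overlap c d \<inter> overlap c e" for y
  proof -
    obtain p q where p: "p \<in> chart_dom c" "p \<in> chart_dom d" "y = chart_map c p"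
      and q: "q \<in> chart_dom c" "q \<in> chart_dom e" "y = chart_map c q"
      using \<open>y \<in> overlap c d \<inter> overlap c e\<close> unfolding overlap_def by blast
    have "p = q" using inj_onD[OF chart_inj[OF A(1)]] p q by metis
    then show "transition d e (transition c d y) = transition c e y" "transition c d y \<in> overlap d e"
      using p q transition_chart_map[OF A(1), of p] transition_chart_map[OF A(2), of p] by (auto simp: overlap_def)
  qed
  have "(transition d e has_derivative jacobian d e (transition c d x)) (at (transition c d x))"
    unfolding jacobian_def using comp(2)[of x] x by (intro fd_has_derivative transition_diff A) blast
  from has_derivative_compose[OF fd_has_derivative[OF transition_diff[OF A(1,2) x(1)]] this]
  have "((\<lambda>y. transition d e (transition c d y)) has_derivative
      (\<lambda>u. jacobian d e (transition c d x) (jacobian c d x u))) (at x)"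
    by (simp add: jacobian_def)
  then have "(transition c e has_derivative
      (\<lambda>u. jacobian d e (transition c d x) (jacobian c d x u))) (at x)"
    by (rule has_derivative_transform_within_open[OF _ open_Int[OF open_overlap[OF A(1,2)] open_overlap[OF A(1,3)]]])
       (use x comp(1) in blast)+
  from fd_eq[OF this] show ?thesis by (simp add: jacobian_def)
qed

text \<open>The inverse is the Jacobian of the reverse transition.\<close>

lemma jacobian_surj:
  assumes A: "c \<in> A" "d \<in> A" and x: "x \<in> overlap c d"
  shows "\<exists>z. jacobian c d x z = w"
proof -
  let ?y = "transition c d x"
  have y: "?y \<in> overlap d c" by (rule transition_in_overlap[OF A(1) x])
  have "?y \<in> chart_image d" using y overlap_subset by blast
  obtain p where p: "p \<in> chart_dom c" "p \<in> chart_dom d" "x = chart_map c p"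
    using x unfolding overlap_def by blast
  have "transition d c ?y = x"
    using p transition_chart_map[OF A(1), of p d] transition_chart_map[OF A(2), of p c] by simp
  then have "jacobian c d x (jacobian d c ?y w) = w"
    using jacobian_compose[OF A(2,1,2) y, of w] jacobian_self[OF A(2)] \<open>?y \<in> chart_image d\<close>
    by (simp add: overlap_self)
  then show ?thesis by blast
qed

lemma metric_transform:
  assumes "c \<in> A" "d \<in> A" "x \<in> overlap c d"
  shows "gram (g c x) u w = gram (g d (transition c d x)) (jacobian c d x u) (jacobian c d x w)"
  using riemannian assms unfolding riemannian_manifold_def scal_gram by blast

lemma force_transform:
  assumes "c \<in> A" "d \<in> A" "x \<in> overlap c d"
  shows "F d (transition c d x) (jacobian c d x v) = jacobian c d x (F c x v)"
  using force assms unfolding force_field_def by blast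

abbreviation hessian :: "('a, 'n) chart \<Rightarrow> ('a, 'n) chart \<Rightarrow> real ^ 'n \<Rightarrow> real ^ 'n \<Rightarrow> real ^ 'n \<Rightarrow> real ^ 'n" where
  "hessian c d x a b \<equiv> fd (\<lambda>y. jacobian c d y b) x a"

lemma hessian_commute:
  assumes "c \<in> A" "d \<in> A" "x \<in> overlap c d"
  shows "hessian c d x a b = hessian c d x b a"
  unfolding jacobian_def
  by (rule fd_commute[OF transition_C open_overlap]) (use assms in auto)

text \<open>The transformation law of the metric, differentiated along a line.\<close>

lemma metric_derivative_transform:
  assumes A: "c \<in> A" "d \<in> A" and x: "x \<in> overlap c d"
  defines "y \<equiv> transition c d x" and "J \<equiv> jacobian c d x"
  shows "gram (fd (g c) x a) u w = gram (fd (g d) y (J a)) (J u) (J w)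
    + gram (g d y) (hessian c d x a u) (J w) + gram (g d y) (J u) (hessian c d x a w)"
proof -
  interpret C: force_chart "chart_image c" "g c" "F c" by (rule force_chart[OF A(1)])
  interpret D: force_chart "chart_image d" "g d" "F d" by (rule force_chart[OF A(2)])
  define l where "l = (\<lambda>s::real. x + s *\<^sub>R a)"
  have l0: "l 0 = x" by (simp add: l_def)
  have l: "(l has_vector_derivative a) (at 0)"
    unfolding l_def by (auto intro!: derivative_eq_intros simp: has_vector_derivative_def)
  have xc: "l 0 \<in> chart_image c" using x overlap_subset l0 by blast
  have yd: "transition c d (l 0) \<in> chart_image d"
    unfolding l0 using transition_in_overlap[OF A(1) x] overlap_subset by blast
  have T: "((\<lambda>s. transition c d (l s)) has_vector_derivative J a) (at 0)"
    using fd_along_curve[of "transition c d" l 0, OF _ l] transition_diff[OF A x]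
    by (simp add: l0 J_def jacobian_def)
  have Ju: "((\<lambda>s. jacobian c d (l s) u) has_vector_derivative hessian c d x a u) (at 0)" for u
  proof -
    have "(\<lambda>y. jacobian c d y u) differentiable (at (l 0))"
      unfolding jacobian_def l0 by (rule C_on_differentiable[OF C_on_fd[OF transition_C[OF A]] x])
    from fd_along_curve[of "\<lambda>y. jacobian c d y u" l, OF this l] show ?thesis by (simp add: l0)
  qed
  have 1: "((\<lambda>s. gram (g c (l s)) u w) has_real_derivative gram (fd (g c) x a) u w) (at 0)"
    using gram_along_curve[of "g c" l, OF C.h_diff[OF xc] l has_vector_derivative_const has_vector_derivative_const, of u w]
    by (simp add: l0)
  have 2: "((\<lambda>s. gram (g d (transition c d (l s))) (jacobian c d (l s) u) (jacobian c d (l s) w))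
      has_real_derivative gram (fd (g d) y (J a)) (J u) (J w)
    + gram (g d y) (hessian c d x a u) (J w) + gram (g d y) (J u) (hessian c d x a w)) (at 0)"
    using gram_along_curve[of "g d" "\<lambda>s. transition c d (l s)", OF D.h_diff[OF yd] T Ju Ju, of u w]
    by (simp add: l0 y_def J_def)
  have "open (l -` overlap c d)" unfolding l_def
    by (intro open_vimage open_overlap A continuous_intros)
  then have "((\<lambda>s. gram (g c (l s)) u w) has_real_derivative gram (fd (g d) y (J a)) (J u) (J w)
    + gram (g d y) (hessian c d x a u) (J w) + gram (g d y) (J u) (hessian c d x a w)) (at 0)"
    by (rule has_field_derivative_transform_within_open[OF 2])
       (use x l0 metric_transform[OF A] in auto)
  from DERIV_unique[OF 1 this] show ?thesis .
qed

text \<open>Comparison of the Koszul formulas in the two charts. In the combination that occurs there, the second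
  derivatives of the transition cancel, except for the one in the direction \<open>v\<close> twice.\<close>

lemma christoffel_transform:
  assumes A: "c \<in> A" "d \<in> A" and x: "x \<in> overlap c d"
  shows "bil (christoffel (g d)) (transition c d x) (jacobian c d x v) (jacobian c d x v)
    = jacobian c d x (bil (christoffel (g c)) x v v) - hessian c d x v v"
proof -
  interpret C: force_chart "chart_image c" "g c" "F c" by (rule force_chart[OF A(1)])
  interpret D: force_chart "chart_image d" "g d" "F d" by (rule force_chart[OF A(2)])
  define y where "y = transition c d x"
  define J where "J = jacobian c d x"
  have xc: "x \<in> chart_image c" using x overlap_subset by blast
  have yd: "y \<in> chart_image d" using transition_in_overlap[OF A(1) x] overlap_subset unfolding y_def by blast
  define E where "E = J (C.\<Gamma> x v v) - D.\<Gamma> y (J v) (J v) - hessian c d x v v"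
  have "gram (g d y) (J z) E = 0" for z
  proof -
    have "2 * gram (g d y) (J z) (J (C.\<Gamma> x v v)) = 2 * gram (g c x) z (C.\<Gamma> x v v)"
      unfolding J_def y_def metric_transform[OF A x] ..
    also have "\<dots> = 2 * gram (fd (g c) x v) z v - gram (fd (g c) x z) v v"
      using C.koszul[OF xc, of z v v] by simp
    also have "\<dots> = 2 * (gram (fd (g d) y (J v)) (J z) (J v)) - gram (fd (g d) y (J z)) (J v) (J v)
        + 2 * gram (g d y) (J z) (hessian c d x v v)"
      using metric_derivative_transform[OF A x, of v z v] metric_derivative_transform[OF A x, of z v v]
        hessian_commute[OF A x, of v z] D.gram_commute[OF yd, of "J v" "hessian c d x z v"]
      unfolding J_def y_def by simp
    also have "\<dots> = 2 * gram (g d y) (J z) (D.\<Gamma> y (J v) (J v)) + 2 * gram (g d y) (J z) (hessian c d x v v)"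
      using D.koszul[OF yd, of "J z" "J v" "J v"] by simp
    finally show ?thesis by (simp add: E_def)
  qed
  \<comment> \<open>\<open>J\<close> is onto, so the defect \<open>E\<close> may be tested against itself\<close>
  moreover obtain z where "J z = E" using jacobian_surj[OF A x, of E] unfolding J_def by blast
  ultimately have "gram (g d y) E E = 0" by metis
  then have "E = 0" using D.gram_pos[OF yd, of E] by fastforce
  then show ?thesis by (simp add: E_def y_def J_def algebra_simps)
qed

abbreviation "spray c \<equiv> force_chart.spray (g c) (F c)"

text \<open>The second derivative of the transition in \<open>christoffel_transform\<close> is exactly the one that arises when the
  velocity \<open>jacobian c d x v\<close> is differentiated along a trajectory.\<close>

lemma spray_transform:
  assumes A: "c \<in> A" "d \<in> A" and x: "x \<in> overlap c d"
  shows "spray d (transition c d x, jacobian c d x v) = hessian c d x v v + jacobian c d x (spray c (x, v))"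
proof -
  interpret C: force_chart "chart_image c" "g c" "F c" by (rule force_chart[OF A(1)])
  interpret D: force_chart "chart_image d" "g d" "F d" by (rule force_chart[OF A(2)])
  show ?thesis
    by (simp add: C.spray_def D.spray_def force_transform[OF A x] christoffel_transform[OF A x]
        linear_diff[OF linear_jacobian[OF A x]])
qed

text \<open>The fibre component of the tangent map of the transition, as a map on the tangent bundle.\<close>

definition tangent :: "('a, 'n) chart \<Rightarrow> ('a, 'n) chart \<Rightarrow> (real ^ 'n) \<times> (real ^ 'n) \<Rightarrow> real ^ 'n" where
  "tangent c d z = jacobian c d (fst z) (snd z)"

lemma tangent_C:
  assumes "c \<in> A" "d \<in> A"
  shows "C_on k (overlap c d \<times> UNIV) (tangent c d)"
  using C_on_tangent[OF transition_C open_overlap] assms unfolding tangent_def[abs_def] jacobian_def by blast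

lemma fd_tangent_transition:
  assumes "c \<in> A" "d \<in> A" "x \<in> overlap c d"
  shows "fd (tangent c d) (x, v) (a, b) = hessian c d x a v + jacobian c d x b"
  using fd_tangent[OF transition_C open_overlap assms(3)] assms unfolding tangent_def[abs_def] jacobian_def by blast

text \<open>Differentiating the relation between the sprays once more, in the direction \<open>(a, b)\<close>, relates their
  linearizations; this is where the symmetry of second derivatives on the tangent bundle enters.\<close>

lemma spray_transform_linearized:
  assumes A: "c \<in> A" "d \<in> A" and x: "x \<in> overlap c d"
  shows "fd (spray d) (transition c d x, jacobian c d x v) (jacobian c d x a, fd (tangent c d) (x, v) (a, b))
    = fd (\<lambda>z. fd (tangent c d) z (a, b)) (x, v) (v, spray c (x, v))
      + fd (tangent c d) (x, v) (b, fd (spray c) (x, v) (a, b))"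
proof -
  interpret C: force_chart "chart_image c" "g c" "F c" by (rule force_chart[OF A(1)])
  interpret D: force_chart "chart_image d" "g d" "F d" by (rule force_chart[OF A(2)])
  have xc: "x \<in> chart_image c" using x overlap_subset by blast
  have yd: "transition c d x \<in> chart_image d" using transition_in_overlap[OF A(1) x] overlap_subset by blast
  have O: "open (overlap c d \<times> (UNIV :: (real ^ 'n) set))" by (intro open_Times open_overlap A open_UNIV)
  have xO: "(x, v) \<in> overlap c d \<times> UNIV" using x by simp
  define p where "p = (\<lambda>s::real. x + s *\<^sub>R a)"
  define q where "q = (\<lambda>s::real. v + s *\<^sub>R b)"
  have p: "(p has_vector_derivative a) (at 0)" and q: "(q has_vector_derivative b) (at 0)"
    unfolding p_def q_def by (auto intro!: derivative_eq_intros simp: has_vector_derivative_def)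
  have p0: "p 0 = x" and q0: "q 0 = v" by (simp_all add: p_def q_def)
  have z: "((\<lambda>s. (p s, q s)) has_vector_derivative (a, b)) (at 0)"
    by (rule has_vector_derivative_Pair[OF p q])
  have "spray c differentiable (at (p 0, q 0))"
    unfolding p0 q0 using C_on_differentiable[OF C.spray_C] xc by simp
  from fd_along_curve[of "spray c" "\<lambda>s. (p s, q s)", OF this z]
  have sc: "((\<lambda>s. spray c (p s, q s)) has_vector_derivative fd (spray c) (x, v) (a, b)) (at 0)"
    by (simp add: p0 q0)
  have "(p 0, q 0) \<in> overlap c d \<times> UNIV" using xO by (simp add: p0 q0)
  from tangent_along_curve[of _ "tangent c d" "\<lambda>s. (p s, q s)", OF tangent_C[OF A] O this z has_vector_derivative_Pair[OF q sc]]
  have 1: "((\<lambda>s. fd (tangent c d) (p s, q s) (q s, spray c (p s, q s))) has_vector_derivative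
      fd (\<lambda>z. fd (tangent c d) z (v, spray c (x, v))) (x, v) (a, b)
      + fd (tangent c d) (x, v) (b, fd (spray c) (x, v) (a, b))) (at 0)"
    by (simp add: p0 q0)
  have T: "((\<lambda>s. transition c d (p s)) has_vector_derivative jacobian c d x a) (at 0)"
    using fd_along_curve[of "transition c d" p 0, OF _ p] transition_diff[OF A x] by (simp add: p0 jacobian_def)
  have "tangent c d differentiable (at (p 0, q 0))"
    unfolding p0 q0 by (rule C_on_differentiable[OF tangent_C[OF A] xO])
  from fd_along_curve[of "tangent c d" "\<lambda>s. (p s, q s)", OF this z]
  have "((\<lambda>s. jacobian c d (p s) (q s)) has_vector_derivative fd (tangent c d) (x, v) (a, b)) (at 0)"
    by (simp add: p0 q0 tangent_def)
  note Tz = has_vector_derivative_Pair[OF T this]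
  have "spray d differentiable (at (transition c d (p 0), jacobian c d (p 0) (q 0)))"
    unfolding p0 q0 using C_on_differentiable[OF D.spray_C] yd by simp
  from fd_along_curve[of "spray d" "\<lambda>s. (transition c d (p s), jacobian c d (p s) (q s))", OF this Tz]
  have 2: "((\<lambda>s. spray d (transition c d (p s), jacobian c d (p s) (q s))) has_vector_derivative
      fd (spray d) (transition c d x, jacobian c d x v) (jacobian c d x a, fd (tangent c d) (x, v) (a, b))) (at 0)"
    by (simp add: p0 q0)
  have "open (p -` overlap c d)" unfolding p_def
    by (intro open_vimage open_overlap A continuous_intros)
  then have "((\<lambda>s. spray d (transition c d (p s), jacobian c d (p s) (q s))) has_vector_derivative
      fd (\<lambda>z. fd (tangent c d) z (v, spray c (x, v))) (x, v) (a, b)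
      + fd (tangent c d) (x, v) (b, fd (spray c) (x, v) (a, b))) (at 0)"
  proof (rule has_vector_derivative_transform_within_open[OF 1])
    show "0 \<in> p -` overlap c d" using x p0 by simp
    show "fd (tangent c d) (p s, q s) (q s, spray c (p s, q s)) = spray d (transition c d (p s), jacobian c d (p s) (q s))"
      if "s \<in> p -` overlap c d" for s
      using that spray_transform[OF A] fd_tangent_transition[OF A] by simp
  qed
  from vector_derivative_unique_at[OF 2 this]
  show ?thesis
    unfolding fd_commute[OF tangent_C[OF A] O xO, of "(v, spray c (x, v))" "(a, b)"] .
qed

end

section \<open>Trajectories, vectors of variation and weak normality\<close>

lemma cov_deriv_eq:
  "cov_deriv h c p w t = vector_derivative w (at t)
    + bil (christoffel h) (chart_map c (p t)) (velocity c p t) (w t)"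
  by (simp add: cov_deriv_def bil_def vec_eq_iff)

lemma has_vector_derivative_cov_deriv:
  assumes "w differentiable (at t)"
  shows "(w has_vector_derivative cov_deriv h c p w t
    - bil (christoffel h) (chart_map c (p t)) (velocity c p t) (w t)) (at t)"
  using assms by (simp add: cov_deriv_eq vector_derivative_works)

context newtonian_system
begin

abbreviation "\<xi> c \<equiv> force_chart.\<xi> (g c) (F c)"
abbreviation "\<eta> c \<equiv> force_chart.\<eta> (g c) (F c)"

lemma open_in_chart:
  assumes p: "trajectory M A g F I p" and c: "c \<in> A"
  shows "open {s \<in> I. p s \<in> chart_dom c}"
proof -
  have "openin (top_of_set I) {s \<in> topspace (top_of_set I). p s \<in> chart_dom c}"
    using p is_chart[OF c] unfolding trajectory_def is_chart_def
    by (intro openin_continuous_map_preimage) auto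
  then show ?thesis
    using p openin_open_trans unfolding trajectory_def by auto
qed

lemma trajectory_derivatives:
  assumes p: "trajectory M A g F I p" and c: "c \<in> A" and t: "t \<in> I" "p t \<in> chart_dom c"
  shows "((\<lambda>s. chart_map c (p s)) has_vector_derivative velocity c p t) (at t)"
    "(velocity c p has_vector_derivative F c (chart_map c (p t)) (velocity c p t)
      - bil (christoffel (g c)) (chart_map c (p t)) (velocity c p t) (velocity c p t)) (at t)"
proof -
  have d: "(chart_map c \<circ> p) differentiable (at t)" "velocity c p differentiable (at t)"
    and e: "cov_deriv (g c) c p (velocity c p) t = F c (chart_map c (p t)) (velocity c p t)"
    using assms unfolding trajectory_def by blast+
  show "((\<lambda>s. chart_map c (p s)) has_vector_derivative velocity c p t) (at t)"
    using vector_derivative_works[THEN iffD1, OF d(1)] by (simp add: velocity_def o_def)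
  show "(velocity c p has_vector_derivative F c (chart_map c (p t)) (velocity c p t)
      - bil (christoffel (g c)) (chart_map c (p t)) (velocity c p t) (velocity c p t)) (at t)"
    using has_vector_derivative_cov_deriv[OF d(2), of "g c" c p] unfolding e .
qed

lemma variation_vectorD:
  assumes \<tau>: "variation_vector A g F I p \<tau>" and c: "c \<in> A" and t: "t \<in> I" "p t \<in> chart_dom c"
  shows "\<tau> c differentiable (at t)" "cov_deriv (g c) c p (\<tau> c) differentiable (at t)"
    "cov_deriv (g c) c p (cov_deriv (g c) c p (\<tau> c)) t = force_chart.variation_rhs (g c) (F c)
      (chart_map c (p t)) (velocity c p t) (\<tau> c t) (cov_deriv (g c) c p (\<tau> c) t)"
proof -
  interpret C: force_chart "chart_image c" "g c" "F c" by (rule force_chart[OF c])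
  note D = \<tau>[unfolded variation_vector_def Let_def, THEN conjunct2, rule_format, OF c t]
  show "\<tau> c differentiable (at t)" "cov_deriv (g c) c p (\<tau> c) differentiable (at t)"
    using D by blast+
  show "cov_deriv (g c) c p (cov_deriv (g c) c p (\<tau> c)) t = C.variation_rhs
      (chart_map c (p t)) (velocity c p t) (\<tau> c t) (cov_deriv (g c) c p (\<tau> c) t)"
    unfolding vec_eq_iff C.variation_rhs_components[OF chart_map_in[OF t(2)], symmetric]
    using D by blast
qed

text \<open>Both implications use these derivatives: to find the coefficients of the differential equation, and to
  evaluate it on a particular vector of variation.\<close>

lemma deviation_at:
  assumes p: "trajectory M A g F I p" and \<tau>: "variation_vector A g F I p \<tau>"
    and \<phi>: "deviation_function A g I p \<tau> \<phi>"
    and c: "c \<in> A" and t: "t \<in> I" "p t \<in> chart_dom c"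
  defines "x \<equiv> chart_map c (p t)" and "v \<equiv> velocity c p t" and "D \<equiv> cov_deriv (g c) c p (\<tau> c) t"
  shows "\<phi> t = gram (g c x) v (\<tau> c t)"
    "(\<phi> has_real_derivative gram (g c x) (F c x v) (\<tau> c t) + gram (g c x) v D) (at t)"
    "(deriv \<phi> has_real_derivative \<xi> c x v D + \<eta> c x v (\<tau> c t)) (at t)"
proof -
  interpret C: force_chart "chart_image c" "g c" "F c" by (rule force_chart[OF c])
  define U where "U = {s \<in> I. p s \<in> chart_dom c}"
  have U: "open U" "t \<in> U" using open_in_chart[OF p c] t by (auto simp: U_def)
  define X where "X = (\<lambda>s. chart_map c (p s))"
  define V where "V = velocity c p"
  define DD where "DD = cov_deriv (g c) c p (\<tau> c)"
  have X: "X s \<in> chart_image c" if "s \<in> U" for s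
    using that by (auto simp: U_def X_def chart_map_in)
  have X': "(X has_vector_derivative V s) (at s)"
    and V': "(V has_vector_derivative F c (X s) (V s) - C.\<Gamma> (X s) (V s) (V s)) (at s)" if "s \<in> U" for s
    using trajectory_derivatives[OF p c, of s] that by (auto simp: U_def X_def V_def)
  have d: "\<tau> c differentiable (at s)" "DD differentiable (at s)"
    and W: "cov_deriv (g c) c p DD s = C.variation_rhs (X s) (V s) (\<tau> c s) (DD s)"
    if "s \<in> U" for s
    using variation_vectorD[OF \<tau> c, of s] that by (simp_all add: X_def V_def DD_def U_def)
  have \<tau>': "(\<tau> c has_vector_derivative DD s - C.\<Gamma> (X s) (V s) (\<tau> c s)) (at s)" if "s \<in> U" for s
    using has_vector_derivative_cov_deriv[OF d(1)[OF that], of "g c" c p] by (simp add: DD_def X_def V_def)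
  have D': "(DD has_vector_derivative C.variation_rhs (X s) (V s) (\<tau> c s) (DD s) - C.\<Gamma> (X s) (V s) (DD s)) (at s)"
    if "s \<in> U" for s
    using has_vector_derivative_cov_deriv[OF d(2)[OF that], of "g c" c p]
    unfolding W[OF that] X_def V_def .
  have \<phi>_eq: "\<phi> s = gram (g c (X s)) (V s) (\<tau> c s)" if "s \<in> U" for s
    using \<phi> c that by (auto simp: deviation_function_def scal_gram U_def X_def V_def)
  then show "\<phi> t = gram (g c x) v (\<tau> c t)"
    using U(2) by (simp add: X_def V_def x_def v_def)
  have \<phi>': "(\<phi> has_real_derivative gram (g c (X s)) (F c (X s) (V s)) (\<tau> c s) + gram (g c (X s)) (V s) (DD s)) (at s)"
    if s: "s \<in> U" for s
    by (rule has_field_derivative_transform_within_open[OF C.deviation_derivative[of X s V "\<tau> c" DD, OF X[OF s] X'[OF s] V'[OF s] \<tau>'[OF s]] U(1) s])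
       (rule \<phi>_eq[symmetric])
  from \<phi>'[OF U(2)]
  show "(\<phi> has_real_derivative gram (g c x) (F c x v) (\<tau> c t) + gram (g c x) v D) (at t)"
    by (simp add: X_def V_def x_def v_def DD_def D_def)
  note t' = U(2)
  have "(deriv \<phi> has_real_derivative \<xi> c (X t) (V t) (DD t) + \<eta> c (X t) (V t) (\<tau> c t)) (at t)"
    by (rule has_field_derivative_transform_within_open[OF C.deviation_second_derivative[of X t V "\<tau> c" DD, OF
            X[OF t'] X'[OF t'] V'[OF t'] \<tau>'[OF t'] D'[OF t']] U])
       (rule DERIV_imp_deriv[OF \<phi>', symmetric])
  then show "(deriv \<phi> has_real_derivative \<xi> c x v D + \<eta> c x v (\<tau> c t)) (at t)"
    by (simp add: X_def V_def x_def v_def DD_def D_def)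
qed

text \<open>In the other chart, \<open>\<sigma>\<close> and \<open>\<Omega>\<close> are the components of the derivative of the tangent map applied to
  \<open>(\<tau>, \<omega>)\<close>. That \<open>\<Omega>\<close> is the derivative of \<open>\<sigma>\<close> is the symmetry of the Hessian of the transition.\<close>

lemma solution_in_chart:
  assumes A: "c \<in> A" "d \<in> A" and t: "x t \<in> overlap c d"
    and x: "(x has_vector_derivative v t) (at t)"
    and v: "(v has_vector_derivative spray c (x t, v t)) (at t)"
    and \<tau>: "(\<tau> has_vector_derivative \<omega> t) (at t)"
    and \<omega>: "(\<omega> has_vector_derivative fd (spray c) (x t, v t) (\<tau> t, \<omega> t)) (at t)"
  defines "y \<equiv> \<lambda>s. transition c d (x s)" and "V \<equiv> \<lambda>s. jacobian c d (x s) (v s)"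
    and "\<sigma> \<equiv> \<lambda>s. jacobian c d (x s) (\<tau> s)" and "\<Omega> \<equiv> \<lambda>s. fd (tangent c d) (x s, v s) (\<tau> s, \<omega> s)"
  shows "(y has_vector_derivative V t) (at t)" "(V has_vector_derivative spray d (y t, V t)) (at t)"
    "(\<sigma> has_vector_derivative \<Omega> t) (at t)"
    "(\<Omega> has_vector_derivative fd (spray d) (y t, V t) (\<sigma> t, \<Omega> t)) (at t)"
proof -
  have O: "open (overlap c d \<times> (UNIV :: (real ^ 'n) set))" by (intro open_Times open_overlap A open_UNIV)
  have diff: "tangent c d differentiable (at (x t, u))" for u
    by (rule C_on_differentiable[OF tangent_C[OF A]]) (use t in simp)
  show "(y has_vector_derivative V t) (at t)"
    unfolding y_def V_def jacobian_def by (rule fd_along_curve[OF transition_diff[OF A t] x])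
  show "(V has_vector_derivative spray d (y t, V t)) (at t)"
    using fd_along_curve[of "tangent c d" "\<lambda>s. (x s, v s)", OF diff has_vector_derivative_Pair[OF x v]]
    by (simp add: fd_tangent_transition[OF A t] spray_transform[OF A t] y_def V_def tangent_def)
  show "(\<sigma> has_vector_derivative \<Omega> t) (at t)"
    using fd_along_curve[of "tangent c d" "\<lambda>s. (x s, \<tau> s)", OF diff has_vector_derivative_Pair[OF x \<tau>]]
    by (simp add: fd_tangent_transition[OF A t] hessian_commute[OF A t, of "v t"] \<sigma>_def \<Omega>_def tangent_def)
  have "(x t, v t) \<in> overlap c d \<times> UNIV" using t by simp
  from tangent_along_curve[of _ "tangent c d" "\<lambda>s. (x s, v s)" t, OF tangent_C[OF A] O this
      has_vector_derivative_Pair[OF x v] has_vector_derivative_Pair[OF \<tau> \<omega>]]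
  show "(\<Omega> has_vector_derivative fd (spray d) (y t, V t) (\<sigma> t, \<Omega> t)) (at t)"
    unfolding y_def V_def \<sigma>_def \<Omega>_def spray_transform_linearized[OF A t] .
qed

text \<open>One autonomous system for the four unknowns, so that trajectory and variation share an interval.\<close>

lemma linearized_flow_exists:
  assumes c: "c \<in> A" and x0: "x0 \<in> chart_image c"
  obtains e x v \<tau> \<omega> where "e > 0" "x 0 = x0" "v 0 = v0" "\<tau> 0 = \<tau>0" "\<omega> 0 = \<omega>0"
    "\<And>t. t \<in> {-e<..<e} \<Longrightarrow> x t \<in> chart_image c"
    "\<And>t. t \<in> {-e<..<e} \<Longrightarrow> (x has_vector_derivative v t) (at t)"
    "\<And>t. t \<in> {-e<..<e} \<Longrightarrow> (v has_vector_derivative spray c (x t, v t)) (at t)"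
    "\<And>t. t \<in> {-e<..<e} \<Longrightarrow> (\<tau> has_vector_derivative \<omega> t) (at t)"
    "\<And>t. t \<in> {-e<..<e} \<Longrightarrow> (\<omega> has_vector_derivative fd (spray c) (x t, v t) (\<tau> t, \<omega> t)) (at t)"
proof -
  interpret C: force_chart "chart_image c" "g c" "F c" by (rule force_chart[OF c])
  let ?S = "(chart_image c \<times> (UNIV :: (real ^ 'n) set)) \<times> (UNIV :: ((real ^ 'n) \<times> (real ^ 'n)) set)"
  define f where "f = (\<lambda>z :: ((real ^ 'n) \<times> (real ^ 'n)) \<times> ((real ^ 'n) \<times> (real ^ 'n)).
    ((snd (fst z), spray c (fst z)), (snd (snd z), fd (spray c) (fst z) (snd z))))"
  have O: "open ?S" by (intro open_Times C.S_UNIV open_UNIV)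
  have "C_on (Suc 0) ?S f" unfolding f_def
    by (intro C_on_Pair C_on_bounded_linear C_on_tangent[OF C.spray_C C.S_UNIV] O
        C_on_compose_linear[OF bounded_linear_fst C.spray_C O] bounded_linear_compose[OF bounded_linear_snd]
        bounded_linear_fst bounded_linear_snd) auto
  moreover have "((x0, v0), (\<tau>0, \<omega>0)) \<in> ?S" using x0 by simp
  ultimately obtain e Z where e: "e > 0" and Z: "Z 0 = ((x0, v0), (\<tau>0, \<omega>0))"
    "\<And>t. t \<in> {-e<..<e} \<Longrightarrow> Z t \<in> ?S" "\<And>t. t \<in> {-e<..<e} \<Longrightarrow> (Z has_vector_derivative f (Z t)) (at t)"
    using local_solution_exists[OF _ O] by metis
  note fstd = bounded_linear.has_vector_derivative[OF bounded_linear_fst]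
  note sndd = bounded_linear.has_vector_derivative[OF bounded_linear_snd]
  show thesis
  proof (rule that[of e "\<lambda>t. fst (fst (Z t))" "\<lambda>t. snd (fst (Z t))" "\<lambda>t. fst (snd (Z t))" "\<lambda>t. snd (snd (Z t))"])
    fix t assume t: "t \<in> {-e<..<e}"
    show "fst (fst (Z t)) \<in> chart_image c" using Z(2)[OF t] by (auto simp: mem_Times_iff)
    show "((\<lambda>t. fst (fst (Z t))) has_vector_derivative snd (fst (Z t))) (at t)"
      using fstd[OF fstd[OF Z(3)[OF t]]] by (simp add: f_def)
    show "((\<lambda>t. snd (fst (Z t))) has_vector_derivative spray c (fst (fst (Z t)), snd (fst (Z t)))) (at t)"
      using sndd[OF fstd[OF Z(3)[OF t]]] by (simp add: f_def)
    show "((\<lambda>t. fst (snd (Z t))) has_vector_derivative snd (snd (Z t))) (at t)"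
      using fstd[OF sndd[OF Z(3)[OF t]]] by (simp add: f_def)
    show "((\<lambda>t. snd (snd (Z t))) has_vector_derivative
        fd (spray c) (fst (fst (Z t)), snd (fst (Z t))) (fst (snd (Z t)), snd (snd (Z t)))) (at t)"
      using sndd[OF sndd[OF Z(3)[OF t]]] by (simp add: f_def)
  qed (use e Z(1) in simp_all)
qed

lemma continuous_map_chart_inverse:
  assumes c: "c \<in> A" and x: "continuous_on I x" "x ` I \<subseteq> chart_image c"
  shows "continuous_map (top_of_set I) M (\<lambda>s. inv_into (chart_dom c) (chart_map c) (x s))"
proof -
  obtain f where f: "homeomorphic_maps (subtopology M (chart_dom c)) (top_of_set (chart_image c)) (chart_map c) f"
    using is_chart[OF c] unfolding is_chart_def homeomorphic_map_maps by blast
  have "continuous_map (top_of_set (chart_image c)) (subtopology M (chart_dom c)) f"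
    using f by (simp add: homeomorphic_maps_def)
  then have fM: "continuous_map (top_of_set (chart_image c)) M f"
    by (rule continuous_map_into_fulltopology)
  have "continuous_map (top_of_set I) (top_of_set (chart_image c)) x"
    using x by (auto simp: continuous_map_in_subtopology)
  from continuous_map_compose[OF this fM]
  have "continuous_map (top_of_set I) M (f \<circ> x)" .
  moreover have "(f \<circ> x) s = inv_into (chart_dom c) (chart_map c) (x s)" if "s \<in> I" for s
  proof -
    have "x s \<in> chart_map c ` chart_dom c"
      using subsetD[OF x(2) imageI[OF that]] unfolding chart_image_def .
    then obtain q where q: "x s = chart_map c q" "q \<in> chart_dom c" by (rule imageE)
    have "chart_dom c \<subseteq> topspace M"
      using is_chart[OF c] openin_subset unfolding is_chart_def by blast
    then have "q \<in> topspace (subtopology M (chart_dom c))"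
      using q by (auto simp: topspace_subtopology)
    then have "f (chart_map c q) = q" using f by (auto simp: homeomorphic_maps_def)
    then show ?thesis using q by (simp add: inv_into_f_f[OF chart_inj[OF c]])
  qed
  ultimately show ?thesis
    by (rule continuous_map_eq) simp
qed

text \<open>The solution constructed in \<open>c\<close> is carried to all other charts by the Jacobians of the transitions; near each
  time the chart components are the functions of \<open>solution_in_chart\<close>, which solve the equations there.\<close>

proposition trajectory_with_variation_exists:
  assumes c: "c \<in> A" and x0: "x0 \<in> chart_image c"
  obtains I p \<tau> \<phi> where "trajectory M A g F I p" "variation_vector A g F I p \<tau>"
    "deviation_function A g I p \<tau> \<phi>" "0 \<in> I" "p 0 \<in> chart_dom c" "chart_map c (p 0) = x0"
    "velocity c p 0 = v0" "\<tau> c 0 = \<tau>0" "cov_deriv (g c) c p (\<tau> c) 0 = D0"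
proof -
  interpret C: force_chart "chart_image c" "g c" "F c" by (rule force_chart[OF c])
  \<comment> \<open>the initial value of \<open>\<tau>'\<close> for which the covariant derivative is \<open>D0\<close>\<close>
  obtain e x v \<tau> \<omega> where e: "e > 0"
    and init: "x 0 = x0" "v 0 = v0" "\<tau> 0 = \<tau>0" "\<omega> 0 = D0 - C.\<Gamma> x0 v0 \<tau>0"
    and xc: "\<And>t. t \<in> {-e<..<e} \<Longrightarrow> x t \<in> chart_image c"
    and x': "\<And>t. t \<in> {-e<..<e} \<Longrightarrow> (x has_vector_derivative v t) (at t)"
    and v': "\<And>t. t \<in> {-e<..<e} \<Longrightarrow> (v has_vector_derivative spray c (x t, v t)) (at t)"
    and \<tau>': "\<And>t. t \<in> {-e<..<e} \<Longrightarrow> (\<tau> has_vector_derivative \<omega> t) (at t)"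
    and \<omega>': "\<And>t. t \<in> {-e<..<e} \<Longrightarrow> (\<omega> has_vector_derivative fd (spray c) (x t, v t) (\<tau> t, \<omega> t)) (at t)"
    using linearized_flow_exists[OF c x0, of v0 \<tau>0 "D0 - C.\<Gamma> x0 v0 \<tau>0"] by metis
  define I where "I = {-e<..<e}"
  have I: "open I" "is_interval I" "0 \<in> I" using e by (auto simp: I_def is_interval_oo)
  define p where "p = (\<lambda>s. inv_into (chart_dom c) (chart_map c) (x s))"
  have pc: "p s \<in> chart_dom c" "chart_map c (p s) = x s" if "s \<in> I" for s
    using xc[of s] that inv_into_into f_inv_into_f by (auto simp: p_def I_def chart_image_def intro: inv_into_into f_inv_into_f)
  have pd: "chart_map d (p s) = transition c d (x s)" for d s
    by (simp add: p_def transition_def)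
  have ov: "x s \<in> overlap c d \<longleftrightarrow> p s \<in> chart_dom d" if "s \<in> I" for s d
  proof
    assume "p s \<in> chart_dom d" then show "x s \<in> overlap c d" using pc[OF that] by (force simp: overlap_def)
  next
    assume "x s \<in> overlap c d"
    then show "p s \<in> chart_dom d" using inv_into_f_f[OF chart_inj[OF c]] by (force simp: overlap_def p_def)
  qed
  have contx: "continuous_on I x"
    unfolding I_def
    by (intro continuous_at_imp_continuous_on ballI) (rule has_vector_derivative_continuous[OF x'])
  have cont: "continuous_map (top_of_set I) M p"
    unfolding p_def by (rule continuous_map_chart_inverse[OF c contx]) (use xc in \<open>auto simp: I_def\<close>)
  define y where "y = (\<lambda>d s. transition c d (x s))"
  define V where "V = (\<lambda>d s. jacobian c d (x s) (v s))"
  define \<sigma> where "\<sigma> = (\<lambda>d s. jacobian c d (x s) (\<tau> s))"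
  define \<Omega> where "\<Omega> = (\<lambda>d s. fd (tangent c d) (x s, v s) (\<tau> s, \<omega> s))"
  define U where "U = (\<lambda>d :: ('a, 'n) chart. {s \<in> I. p s \<in> chart_dom d})"
  have openU: "open (U d)" if "d \<in> A" for d
  proof -
    have "U d = I \<inter> x -` overlap c d" unfolding U_def using ov by blast
    then show ?thesis using continuous_open_preimage[OF contx I(1) open_overlap[OF c that]] by simp
  qed
  have sol: "(y d has_vector_derivative V d s) (at s)"
    "(V d has_vector_derivative spray d (y d s, V d s)) (at s)"
    "(\<sigma> d has_vector_derivative \<Omega> d s) (at s)"
    "(\<Omega> d has_vector_derivative fd (spray d) (y d s, V d s) (\<sigma> d s, \<Omega> d s)) (at s)"
    if "d \<in> A" "s \<in> U d" for d s
  proof -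
    have "x s \<in> overlap c d" "s \<in> {-e<..<e}" using that ov[of s d] by (auto simp: U_def I_def)
    then show "(y d has_vector_derivative V d s) (at s)"
      "(V d has_vector_derivative spray d (y d s, V d s)) (at s)"
      "(\<sigma> d has_vector_derivative \<Omega> d s) (at s)"
      "(\<Omega> d has_vector_derivative fd (spray d) (y d s, V d s) (\<sigma> d s, \<Omega> d s)) (at s)"
      using solution_in_chart[OF c that(1), of x s v \<tau> \<omega>] x' v' \<tau>' \<omega>'
      unfolding y_def V_def \<sigma>_def \<Omega>_def by blast+
  qed
  have vel: "velocity d p s = V d s" if "d \<in> A" "s \<in> U d" for d s
    using vector_derivative_at[OF sol(1)[OF that]] by (simp add: velocity_def o_def pd y_def)
  have vel': "(velocity d p has_vector_derivative spray d (y d s, V d s)) (at s)" if "d \<in> A" "s \<in> U d" for d s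
    by (rule has_vector_derivative_transform_within_open[OF sol(2)[OF that] openU[OF that(1)] that(2)])
       (rule vel[OF that(1), symmetric])
  have yd: "y d s \<in> chart_image d" if "d \<in> A" "s \<in> U d" for d s
    using chart_map_in[of "p s" d] that by (simp add: U_def y_def pd)
  have traj: "trajectory M A g F I p"
    unfolding trajectory_def
  proof (intro conjI I cont ballI impI)
    fix d t assume d: "d \<in> A" and "t \<in> I" "p t \<in> chart_dom d"
    then have t: "t \<in> U d" by (simp add: U_def)
    interpret D: force_chart "chart_image d" "g d" "F d" by (rule force_chart[OF d])
    show "(chart_map d \<circ> p) differentiable (at t)"
      using differentiableI_vector[OF sol(1)[OF d t]] by (simp add: o_def pd y_def)
    show "velocity d p differentiable (at t)"
      by (rule differentiableI_vector[OF vel'[OF d t]])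
    show "cov_deriv (g d) d p (velocity d p) t = F d (chart_map d (p t)) (velocity d p t)"
      unfolding cov_deriv_eq vector_derivative_at[OF vel'[OF d t]] vel[OF d t] pd
      by (simp add: D.spray_def y_def)
  qed
  have var: "variation_vector A g F I p \<sigma>"
    unfolding variation_vector_def Let_def
  proof (intro conjI ballI impI allI)
    fix d d' t assume "d \<in> A" "d' \<in> A" "t \<in> I" "p t \<in> chart_dom d \<inter> chart_dom d'"
    then show "\<sigma> d' t = jacobian d d' (chart_map d (p t)) (\<sigma> d t)"
      using jacobian_compose[OF c, of d d' "x t" "\<tau> t"] ov[of t d] ov[of t d'] by (simp add: \<sigma>_def pd)
  next
    fix d t assume d: "d \<in> A" and "t \<in> I" "p t \<in> chart_dom d"
    then have t: "t \<in> U d" by (simp add: U_def)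
    interpret D: force_chart "chart_image d" "g d" "F d" by (rule force_chart[OF d])
    show "\<sigma> d differentiable (at t)" by (rule differentiableI_vector[OF sol(3)[OF d t]])
    define E where "E = (\<lambda>s. \<Omega> d s + D.\<Gamma> (y d s) (V d s) (\<sigma> d s))"
    have E: "cov_deriv (g d) d p (\<sigma> d) s = E s" if "s \<in> U d" for s
      unfolding cov_deriv_eq vector_derivative_at[OF sol(3)[OF d that]] vel[OF d that] pd
      by (simp add: E_def y_def)
    have "(E has_vector_derivative D.variation_rhs (y d t) (V d t) (\<sigma> d t) (E t) - D.\<Gamma> (y d t) (V d t) (E t)) (at t)"
      by (rule D.linearized_imp_covariant[of "y d" t "V d" "\<sigma> d" "\<Omega> d" E, OF yd[OF d t] sol[OF d t] E_def])
    then have D': "(cov_deriv (g d) d p (\<sigma> d) has_vector_derivative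
        D.variation_rhs (y d t) (V d t) (\<sigma> d t) (E t) - D.\<Gamma> (y d t) (V d t) (E t)) (at t)"
      by (rule has_vector_derivative_transform_within_open[OF _ openU[OF d] t]) (rule E[symmetric])
    then show "cov_deriv (g d) d p (\<sigma> d) differentiable (at t)" by (rule differentiableI_vector)
    fix k
    have "cov_deriv (g d) d p (cov_deriv (g d) d p (\<sigma> d)) t
      = D.variation_rhs (y d t) (V d t) (\<sigma> d t) (E t)"
      unfolding cov_deriv_eq[of _ _ _ "cov_deriv (g d) d p (\<sigma> d)"] vector_derivative_at[OF D'] vel[OF d t] pd E[OF t]
      by (simp add: y_def)
    then show "cov_deriv (g d) d p (cov_deriv (g d) d p (\<sigma> d)) t $ k =
        - (\<Sum>m\<in>UNIV. \<Sum>i\<in>UNIV. \<Sum>j\<in>UNIV. curvature (g d) k m i j (chart_map d (p t)) * \<sigma> d t $ i *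
             velocity d p t $ j * velocity d p t $ m)
        + (\<Sum>m\<in>UNIV. cov_deriv (g d) d p (\<sigma> d) t $ m *
             vel_grad m (\<lambda>y w. F d y w $ k) (chart_map d (p t)) (velocity d p t))
        + (\<Sum>m\<in>UNIV. \<sigma> d t $ m * spat_grad_vec (g d) m (F d) k (chart_map d (p t)) (velocity d p t))"
      using D.variation_rhs_components[OF yd[OF d t]] by (simp add: vel[OF d t] E[OF t] pd y_def)
  qed
  have dev: "deviation_function A g I p \<sigma> (\<lambda>s. gram (g c (x s)) (v s) (\<tau> s))"
    unfolding deviation_function_def scal_gram
  proof (intro ballI impI)
    fix d t assume d: "d \<in> A" and "t \<in> I" "p t \<in> chart_dom d"
    then have t: "t \<in> U d" and "x t \<in> overlap c d" using ov[of t d] by (auto simp: U_def)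
    from metric_transform[OF c d this(2)]
    show "gram (g c (x t)) (v t) (\<tau> t) = gram (g d (chart_map d (p t))) (velocity d p t) (\<sigma> d t)"
      by (simp add: vel[OF d t] pd V_def \<sigma>_def)
  qed
  have Uc: "s \<in> U c" if "s \<in> I" for s using pc that by (simp add: U_def)
  have self: "V c s = v s" "\<sigma> c s = \<tau> s" if "s \<in> I" for s
    using jacobian_self[OF c xc] that by (simp_all add: V_def \<sigma>_def I_def)
  have "0 \<in> {-e<..<e}" using I(3) by (simp add: I_def)
  from has_vector_derivative_transform_within_open[OF \<tau>'[OF this] I(1,3) self(2)[symmetric]]
  have "(\<sigma> c has_vector_derivative \<omega> 0) (at 0)" .
  then have "cov_deriv (g c) c p (\<sigma> c) 0 = D0"
    unfolding cov_deriv_eq using vel[OF c Uc[OF I(3)]] self[OF I(3)] pc(2)[OF I(3)] init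
    by (simp add: vector_derivative_at)
  then show thesis
    using that[OF traj var dev I(3)] pc[OF I(3)] vel[OF c Uc[OF I(3)]] self[OF I(3)] init by simp
qed

text \<open>Necessity evaluates the differential equation at time zero on a solution with \<open>\<phi> = \<phi>' = 0\<close>. For sufficiency,
  coefficients are chosen at each time in some chart around the point of the trajectory.\<close>

theorem weak_normality_iff_normal_at:
  assumes n: "CARD('n) \<ge> 2"
  shows "weak_normality M A g F \<longleftrightarrow>
    (\<forall>c\<in>A. \<forall>x\<in>chart_image c. \<forall>v. v \<noteq> 0 \<longrightarrow> force_chart.normal_at (g c) (F c) x v)"
proof (intro iffI ballI allI impI)
  fix c x and v :: "real ^ 'n"
  assume W: "weak_normality M A g F" and c: "c \<in> A" and x: "x \<in> chart_image c" and v: "v \<noteq> 0"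
  interpret C: force_chart "chart_image c" "g c" "F c" by (rule force_chart[OF c])
  show "C.normal_at x v"
  proof (rule C.normal_atI[OF x v])
    fix u w assume u: "gram (g c x) v u = 0" and w: "gram (g c x) (F c x v) u + gram (g c x) v w = 0"
    obtain I p \<tau> \<phi> where p: "trajectory M A g F I p" and \<tau>: "variation_vector A g F I p \<tau>"
      and \<phi>: "deviation_function A g I p \<tau> \<phi>" and I: "0 \<in> I" "p 0 \<in> chart_dom c"
      and init: "chart_map c (p 0) = x" "velocity c p 0 = v" "\<tau> c 0 = u" "cov_deriv (g c) c p (\<tau> c) 0 = w"
      using trajectory_with_variation_exists[OF c x, of v u w] by metis
    obtain a b where "solves_linear_ode2 I a b \<phi>"
      using W p \<tau> \<phi> unfolding weak_normality_def by blast
    then have ode: "(deriv \<phi> has_real_derivative a 0 * deriv \<phi> 0 + b 0 * \<phi> 0) (at 0)"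
      using I unfolding solves_linear_ode2_def by blast
    note dev = deviation_at[OF p \<tau> \<phi> c I, unfolded init]
    have "deriv \<phi> 0 = 0" using DERIV_imp_deriv[OF dev(2)] w by simp
    then show "C.\<xi> x v w + C.\<eta> x v u = 0"
      using DERIV_unique[OF ode dev(3)] dev(1) u by simp
  qed
next
  assume N: "\<forall>c\<in>A. \<forall>x\<in>chart_image c. \<forall>v. v \<noteq> 0 \<longrightarrow> force_chart.normal_at (g c) (F c) x v"
  show "weak_normality M A g F"
    unfolding weak_normality_def
  proof (intro allI impI)
    fix I p assume p: "trajectory M A g F I p"
    have "\<exists>\<alpha> \<beta>. \<forall>\<tau> \<phi>. variation_vector A g F I p \<tau> \<and> deviation_function A g I p \<tau> \<phi> \<longrightarrow>
      \<phi> differentiable (at t) \<and> (deriv \<phi> has_real_derivative \<alpha> * deriv \<phi> t + \<beta> * \<phi> t) (at t)"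
      if t: "t \<in> I" for t
    proof -
      have "continuous_map (top_of_set I) M p" using p by (simp add: trajectory_def)
      then have "p t \<in> topspace M" using t by (auto simp: continuous_map_def)
      then obtain c where c: "c \<in> A" "p t \<in> chart_dom c" using covered by blast
      interpret C: force_chart "chart_image c" "g c" "F c" by (rule force_chart[OF c(1)])
      define x where "x = chart_map c (p t)"
      define v where "v = velocity c p t"
      have x: "x \<in> chart_image c" using c by (simp add: x_def chart_map_in)
      obtain \<alpha> \<beta> where ab: "\<And>u w. C.\<xi> x v w + C.\<eta> x v u
          = \<alpha> * (gram (g c x) (F c x v) u + gram (g c x) v w) + \<beta> * gram (g c x) v u"
        using C.normality_coefficients[OF x n] N c(1) x by blast
      have "\<phi> differentiable (at t) \<and> (deriv \<phi> has_real_derivative \<alpha> * deriv \<phi> t + \<beta> * \<phi> t) (at t)"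
        if "variation_vector A g F I p \<tau>" "deviation_function A g I p \<tau> \<phi>" for \<tau> \<phi>
      proof -
        note dev = deviation_at[OF p that c(1) t c(2), folded x_def v_def]
        show ?thesis
          using dev(3) unfolding ab DERIV_imp_deriv[OF dev(2)] dev(1)
          using dev(2) real_differentiable_def by blast
      qed
      then show ?thesis by blast
    qed
    then obtain a b where "\<And>t. t \<in> I \<Longrightarrow> \<forall>\<tau> \<phi>. variation_vector A g F I p \<tau> \<and> deviation_function A g I p \<tau> \<phi> \<longrightarrow>
      \<phi> differentiable (at t) \<and> (deriv \<phi> has_real_derivative a t * deriv \<phi> t + b t * \<phi> t) (at t)"
      by metis
    then show "\<exists>a b. \<forall>\<tau> \<phi>. variation_vector A g F I p \<tau> \<and> deviation_function A g I p \<tau> \<phi> \<longrightarrow>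
           solves_linear_ode2 I a b \<phi>"
      unfolding solves_linear_ode2_def by blast
  qed
qed

end

theorem theorem6p2:
  fixes M :: "'a topology"
    and A :: "('a, 'n::finite) chart set"
    and g :: "('a, 'n) chart \<Rightarrow> 'n local_metric"
    and F :: "('a, 'n) chart \<Rightarrow> 'n ext_field"
  assumes "CARD('n) \<ge> 2"
    and "riemannian_manifold M A g"
    and "force_field A F"
  shows "weak_normality M A g F \<longleftrightarrow>
    (\<forall>c\<in>A. \<forall>x\<in>chart_image c. \<forall>v. v \<noteq> 0 \<longrightarrow>
      (let s = speed (g c) x v;
           N = unit_dir (g c);
           P = projector (g c);
           Fl = lower (g c) (F c)
       in \<forall>k.
        (\<Sum>i\<in>UNIV. (Fl x v $ i / s
            + (\<Sum>j\<in>UNIV. vel_grad i (\<lambda>y w. N y w $ j * Fl y w $ j) x v)) * P i k x v) = 0 \<and>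
        (\<Sum>i\<in>UNIV. \<Sum>j\<in>UNIV.
            (spat_grad_covec (g c) i Fl j x v + spat_grad_covec (g c) j Fl i x v
              - 2 / s\<^sup>2 * Fl x v $ i * Fl x v $ j) * N x v $ j * P i k x v)
        + (\<Sum>i\<in>UNIV. \<Sum>j\<in>UNIV.
            (F c x v $ j * vel_grad j (\<lambda>y w. Fl y w $ i) x v / s
              - (\<Sum>r\<in>UNIV. N x v $ r * N x v $ j * vel_grad j (\<lambda>y w. Fl y w $ r) x v / s
                   * Fl x v $ i)) * P i k x v) = 0))"
proof -
  interpret newtonian_system M A g F
    using assms(2,3) by unfold_locales
  show ?thesis
    unfolding weak_normality_iff_normal_at[OF assms(1)]
    by (intro ball_cong refl all_cong force_chart.normality_equations_iff_normal_at[OF force_chart, symmetric])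
qed

end
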